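(* For every nontrivial oriented link $L$ in $S^3$, \[ td(L)\ \le\ \min_{\beta}\Big\{\,c_{\beta}(L) - s_{\beta}(L) + 1 \,+\, \min\big(c^+_{\beta}(L),\;c^-_{\beta}(L)\big)\Big\}, \] where the outer minimum is taken over all non-split braid representations $\beta$ of $L$, that is, over all non-split braid words $\beta$ (on any number of strands) whose closure is $L$; here $s_\beta(L)$ is the number of strands of $\beta$, $c_\beta(L)$ is the length of the word $\beta$, and $c^+_\beta(L)$, $c^-_\beta(L)$ are the numbers of positive and negative crossings in the word $\beta$, respectively.
   Context: Links are oriented links in $S^3$, with one or more components, considered up to ambient isotopy. An unlink (trivial link) is a link isotopic to a disjoint union of $r\ge 1$ unlinked unknotted circles; a link is nontrivial if it is not an unlink. Skein triples. $L_+,L_-,L_0$ denote three oriented links having diagrams that are identical except near one crossing, where $L_+$ has a positive crossing, $L_-$ has a negative crossing, and $L_0$ has the oriented smoothing of that crossing. Skein tree. A skein tree for $L$ is a finite rooted binary tree whose nodes are oriented links (given by diagrams, where the diagram of any node may be replaced by any other diagram of an isotopic link), whose root is $L$, whose leaves are unlinks, and in which each non-leaf node has exactly two children, obtained by choosing a crossing in a diagram of the node and performing a skein resolution there: if the crossing is positive (the node is $L_+$) the children are $L_-$ and $L_0$; if it is negative (the node is $L_-$) the children are $L_+$ and $L_0$. The depth of a skein tree is the number of edges in its longest root-to-leaf path. The skein tree depth $td(L)$ is the minimum depth over all skein trees for $L$ (so $td$ of an unlink is $0$). Braids. A braid word on $s$ strands is a finite word in the standard generators $\sigma_1,\dots,\sigma_{s-1}$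 of the braid group on $s$ strands and their inverses (not necessarily reduced). Each letter gives one crossing of the closed braid diagram, where all strands are oriented in the same direction along the braid; letters $\sigma_i$ give crossings of one sign (positive) and letters $\sigma_i^{-1}$ crossings of the other sign (negative). Thus $c_\beta(L)=c^+_\beta(L)+c^-_\beta(L)$. A braid word on $s$ strands is non-split if its closed braid diagram is connected, i.e. for every $1\le i\le s-1$ at least one of $\sigma_i,\sigma_i^{-1}$ occurs in the word. *)

theory Defs
  imports "HOL-Analysis.Analysis"
begin

section \<open>Oriented links in the three-sphere\<close>

type_synonym plane = "real \<times> real"
type_synonym space = "plane \<times> real"  \<comment> \<open>vertical projection \<open>fst\<close>, height \<open>snd\<close>\<close>
type_synonym sphere_pt = "space \<times> real"

abbreviation S3 :: "sphere_pt set" where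
  "S3 \<equiv> sphere 0 1"

text \<open>Inverse stereographic projection: the usual identification of $\mathbb{R}^3$ with
  $S^3$ minus the north pole \<open>(0, 1)\<close>.\<close>

definition to_S3 :: "space \<Rightarrow> sphere_pt" where
  "to_S3 x = ((2 / ((norm x)\<^sup>2 + 1)) *\<^sub>R x, ((norm x)\<^sup>2 - 1) / ((norm x)\<^sup>2 + 1))"

text \<open>An oriented knot is given by a parametrisation of period 1, i.e. an injective map of the
  circle \<open>\<real> / \<int>\<close>, and an oriented link by one parametrisation for each component. The
  choice of the parametrisations is irrelevant up to \<open>same_oriented\<close>.\<close>

definition simple_loop :: "(real \<Rightarrow> 'a::topological_space) \<Rightarrow> bool" where
  "simple_loop \<gamma> \<longleftrightarrow> continuous_on UNIV \<gamma> \<and> (\<forall>s t. \<gamma> s = \<gamma> t \<longleftrightarrow> s - t \<in> \<int>)"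

definition disjoint_loops :: "(real \<Rightarrow> 'a::topological_space) set \<Rightarrow> bool" where
  "disjoint_loops L \<longleftrightarrow> finite L \<and> L \<noteq> {} \<and> (\<forall>\<gamma>\<in>L. simple_loop \<gamma>) \<and> disjoint_family_on range L"

definition reparametrisation :: "(real \<Rightarrow> 'a) \<Rightarrow> (real \<Rightarrow> 'a) \<Rightarrow> bool" where
  "reparametrisation \<gamma> \<delta> \<longleftrightarrow>
     (\<exists>\<phi>::real \<Rightarrow> real. continuous_on UNIV \<phi> \<and> strict_mono \<phi> \<and> (\<forall>t. \<phi> (t + 1) = \<phi> t + 1) \<and>
        \<delta> = \<gamma> \<circ> \<phi>)"

definition same_oriented :: "(real \<Rightarrow> 'a) set \<Rightarrow> (real \<Rightarrow> 'a) set \<Rightarrow> bool" where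
  "same_oriented L M \<longleftrightarrow>
     (\<forall>\<gamma>\<in>L. \<exists>\<delta>\<in>M. reparametrisation \<gamma> \<delta>) \<and> (\<forall>\<delta>\<in>M. \<exists>\<gamma>\<in>L. reparametrisation \<gamma> \<delta>)"

definition ambient_isotopy :: "(real \<Rightarrow> sphere_pt \<Rightarrow> sphere_pt) \<Rightarrow> bool" where
  "ambient_isotopy H \<longleftrightarrow>
     continuous_on ({0..1} \<times> S3) (\<lambda>(t, x). H t x) \<and>
     (\<forall>t\<in>{0..1}. \<exists>G. homeomorphism S3 S3 (H t) G) \<and>
     (\<forall>x\<in>S3. H 0 x = x)"

definition isotopic :: "(real \<Rightarrow> sphere_pt) set \<Rightarrow> (real \<Rightarrow> sphere_pt) set \<Rightarrow> bool" where
  "isotopic L M \<longleftrightarrow> (\<exists>H. ambient_isotopy H \<and> same_oriented ((\<lambda>\<gamma>. H 1 \<circ> \<gamma>) ` L) M)"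

text \<open>A polygonal oriented link in $\mathbb{R}^3$ is given by its set of directed edges.\<close>

definition polygonal_link :: "(space \<times> space) set \<Rightarrow> bool" where
  "polygonal_link E \<longleftrightarrow>
     finite E \<and> E \<noteq> {} \<and> (\<forall>(p, q)\<in>E. p \<noteq> q) \<and>
     inj_on fst E \<and> inj_on snd E \<and> fst ` E = snd ` E \<and>
     (\<forall>(p, q)\<in>E. \<forall>(p', q')\<in>E. (p, q) \<noteq> (p', q') \<longrightarrow>
        closed_segment p q \<inter> closed_segment p' q' \<subseteq> {p, q} \<inter> {p', q'})"

definition parametrises :: "(real \<Rightarrow> space) set \<Rightarrow> (space \<times> space) set \<Rightarrow> bool" where
  "parametrises C E \<longleftrightarrow>
     disjoint_loops C \<and> (\<Union>\<gamma>\<in>C. range \<gamma>) = (\<Union>(p, q)\<in>E. closed_segment p q) \<and>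
     (\<forall>(p, q)\<in>E. \<exists>\<gamma>\<in>C. \<exists>u v. u \<le> v \<and> \<gamma> u = p \<and> \<gamma> v = q \<and> \<gamma> ` {u..v} = closed_segment p q)"

definition isotopic_to_polygonal :: "(real \<Rightarrow> sphere_pt) set \<Rightarrow> (space \<times> space) set \<Rightarrow> bool" where
  "isotopic_to_polygonal L E \<longleftrightarrow>
     polygonal_link E \<and> (\<exists>C. parametrises C E \<and> isotopic L ((\<lambda>\<gamma>. to_S3 \<circ> \<gamma>) ` C))"

text \<open>Links are tame, as always when they are described by diagrams; this is the last conjunct.\<close>

definition oriented_link :: "(real \<Rightarrow> sphere_pt) set \<Rightarrow> bool" where
  "oriented_link L \<longleftrightarrow>
     disjoint_loops L \<and> (\<forall>\<gamma>\<in>L. range \<gamma> \<subseteq> S3) \<and> (\<exists>E. isotopic_to_polygonal L E)"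

text \<open>The model unlink consists of round circles of radius 1 about \<open>(0, 0)\<close>, \<open>(3, 0)\<close>,
  \<open>(6, 0)\<close>, \dots{} in the horizontal plane.\<close>

definition unlink_circle :: "nat \<Rightarrow> real \<Rightarrow> space" where
  "unlink_circle k t = ((3 * real k + cos (2 * pi * t), sin (2 * pi * t)), 0)"

definition unlink :: "(real \<Rightarrow> sphere_pt) set \<Rightarrow> bool" where
  "unlink L \<longleftrightarrow>
     oriented_link L \<and> (\<exists>r\<ge>1. isotopic L ((\<lambda>k. to_S3 \<circ> unlink_circle k) ` {..<r}))"


section \<open>Diagrams\<close>

text \<open>A diagram consists of the directed edges of a projection to the plane together with
  the set of pairs (over-passing edge, under-passing edge).\<close>

type_synonym plane_edge = "plane \<times> plane"
type_synonym diagram = "plane_edge set \<times> (plane_edge \<times> plane_edge) set"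

text \<open>In a regular projection no vertex is projected onto an edge it does not belong to and
  there are no triple points. Hence the only multiple points are finitely many transverse double
  points in the interior of edges: an overlap of two edges would contain a vertex.\<close>

definition regular_projection :: "(space \<times> space) set \<Rightarrow> bool" where
  "regular_projection E \<longleftrightarrow>
     (\<forall>(p, q)\<in>E. fst p \<noteq> fst q) \<and>
     (\<forall>v\<in>fst ` E. \<forall>(p, q)\<in>E. fst v \<in> closed_segment (fst p) (fst q) \<longrightarrow> v = p \<or> v = q) \<and>
     (\<forall>e1\<in>E. \<forall>e2\<in>E. \<forall>e3\<in>E. e1 \<noteq> e2 \<and> e1 \<noteq> e3 \<and> e2 \<noteq> e3 \<longrightarrow>
        closed_segment (fst (fst e1)) (fst (snd e1)) \<inter>
        closed_segment (fst (fst e2)) (fst (snd e2)) \<inter>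
        closed_segment (fst (fst e3)) (fst (snd e3)) = {})"

definition diagram_of :: "(space \<times> space) set \<Rightarrow> diagram" where
  "diagram_of E =
     ({(fst p, fst q) | p q. (p, q) \<in> E},
      {((fst p, fst q), (fst p', fst q')) | p q p' q'. (p, q) \<in> E \<and> (p', q') \<in> E \<and>
         (\<exists>x h h'. (x, h) \<in> closed_segment p q \<and> (x, h') \<in> closed_segment p' q' \<and> h' < h)})"

definition has_diagram :: "(real \<Rightarrow> sphere_pt) set \<Rightarrow> diagram \<Rightarrow> bool" where
  "has_diagram L D \<longleftrightarrow>
     (\<exists>E. isotopic_to_polygonal L E \<and> regular_projection E \<and> diagram_of E = D)"


section \<open>Skein trees\<close>

text \<open>Three diagrams that differ only at a crossing of \<open>(a, b)\<close> and \<open>(c, d)\<close>. The disc in which they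
  differ is the quadrilateral with diagonals \<open>a b\<close> and \<open>c d\<close>, and the oriented smoothing replaces
  the diagonals by the opposite sides \<open>(a, d)\<close> and \<open>(c, b)\<close>. Every crossing of every diagram has
  this form once vertices are inserted on its two edges close to the crossing. The determinant
  of \<open>b - a\<close> and \<open>d - c\<close> is positive, so the crossing is positive iff \<open>(a, b)\<close> is the over-passing
  edge.\<close>

definition skein_triple :: "diagram \<Rightarrow> diagram \<Rightarrow> diagram \<Rightarrow> bool" where
  "skein_triple Dpos Dneg Dzero \<longleftrightarrow>
     (\<exists>a b c d R X.
        open_segment a b \<inter> open_segment c d \<noteq> {} \<and>
        fst (b - a) * snd (d - c) - snd (b - a) * fst (d - c) > 0 \<and>
        (\<forall>(p, q)\<in>R. closed_segment p q \<inter> convex hull {a, b, c, d} \<subseteq> {a, b, c, d}) \<and>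
        X \<subseteq> R \<times> R \<and>
        Dpos = (R \<union> {(a, b), (c, d)}, X \<union> {((a, b), (c, d))}) \<and>
        Dneg = (R \<union> {(a, b), (c, d)}, X \<union> {((c, d), (a, b))}) \<and>
        Dzero = (R \<union> {(a, d), (c, b)}, X))"

definition skein_links ::
    "(real \<Rightarrow> sphere_pt) set \<Rightarrow> (real \<Rightarrow> sphere_pt) set \<Rightarrow> (real \<Rightarrow> sphere_pt) set \<Rightarrow> bool" where
  "skein_links Lpos Lneg Lzero \<longleftrightarrow>
     (\<exists>Dpos Dneg Dzero. skein_triple Dpos Dneg Dzero \<and>
        has_diagram Lpos Dpos \<and> has_diagram Lneg Dneg \<and> has_diagram Lzero Dzero)"

datatype skein_tree =
    Leaf "(real \<Rightarrow> sphere_pt) set"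
  | Node "(real \<Rightarrow> sphere_pt) set" skein_tree skein_tree

fun root_link :: "skein_tree \<Rightarrow> (real \<Rightarrow> sphere_pt) set" where
  "root_link (Leaf L) = L"
| "root_link (Node L _ _) = L"

fun depth :: "skein_tree \<Rightarrow> nat" where
  "depth (Leaf _) = 0"
| "depth (Node _ T U) = Suc (max (depth T) (depth U))"

text \<open>The first child of a node is obtained by the crossing change, the second one by the
  smoothing.\<close>

fun valid_skein_tree :: "skein_tree \<Rightarrow> bool" where
  "valid_skein_tree (Leaf L) \<longleftrightarrow> unlink L"
| "valid_skein_tree (Node L T U) \<longleftrightarrow>
     oriented_link L \<and>
     (skein_links L (root_link T) (root_link U) \<or> skein_links (root_link T) L (root_link U)) \<and>
     valid_skein_tree T \<and> valid_skein_tree U"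

text \<open>The infimum of the empty set is \<open>\<infinity>\<close> in \<^typ>\<open>enat\<close>.\<close>

definition td :: "(real \<Rightarrow> sphere_pt) set \<Rightarrow> enat" where
  "td L = (INF T\<in>{T. valid_skein_tree T \<and> root_link T = L}. enat (depth T))"


section \<open>Closed braids\<close>

text \<open>The letter \<open>(i, True)\<close> is the generator $\sigma_i$, and \<open>(i, False)\<close> is its inverse.\<close>

type_synonym braid_word = "(nat \<times> bool) list"

definition braid_word_on :: "nat \<Rightarrow> braid_word \<Rightarrow> bool" where
  "braid_word_on s w \<longleftrightarrow> s \<ge> 1 \<and> (\<forall>(i, \<epsilon>)\<in>set w. 1 \<le> i \<and> i < s)"

definition non_split :: "nat \<Rightarrow> braid_word \<Rightarrow> bool" where
  "non_split s w \<longleftrightarrow> (\<forall>i. 1 \<le> i \<and> i < s \<longrightarrow> i \<in> fst ` set w)"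

definition pos_crossings :: "braid_word \<Rightarrow> nat" where
  "pos_crossings w = length (filter snd w)"

definition neg_crossings :: "braid_word \<Rightarrow> nat" where
  "neg_crossings w = length (filter (\<lambda>x. \<not> snd x) w)"

text \<open>The braid runs upwards, strand positions being the abscissae \<open>1, \<dots>, s\<close>; letter number \<open>k\<close>
  (counted from 0) occupies the ordinates between \<open>k\<close> and \<open>k + 1\<close>. The closing arcs are nested
  rectangular arcs on the right.\<close>

abbreviation grid :: "nat \<Rightarrow> nat \<Rightarrow> plane" where
  "grid i k \<equiv> (real i, real k)"

definition rising_edge :: "nat \<Rightarrow> nat \<Rightarrow> plane_edge" where
  "rising_edge k i = (grid i k, grid (i + 1) (k + 1))"

definition falling_edge :: "nat \<Rightarrow> nat \<Rightarrow> plane_edge" where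
  "falling_edge k i = (grid (i + 1) k, grid i (k + 1))"

definition level_edges :: "nat \<Rightarrow> nat \<Rightarrow> nat \<Rightarrow> plane_edge set" where
  "level_edges s k i =
     {rising_edge k i, falling_edge k i} \<union>
     {(grid j k, grid j (k + 1)) | j. 1 \<le> j \<and> j \<le> s \<and> j \<noteq> i \<and> j \<noteq> i + 1}"

definition closing_edges :: "nat \<Rightarrow> nat \<Rightarrow> nat \<Rightarrow> plane_edge set" where
  "closing_edges s n j =
     (let x = real j; x' = 2 * real s + 1 - real j; m = real s + 1 - real j; y = real n in
      {((x, y), (x, y + m)), ((x, y + m), (x', y + m)), ((x', y + m), (x', - m)),
       ((x', - m), (x, - m)), ((x, - m), (x, 0))})"

text \<open>Both strands at a crossing run upwards, so it is positive iff the strand from the bottom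
  left to the top right passes over.\<close>

definition closed_braid_diagram :: "nat \<Rightarrow> braid_word \<Rightarrow> diagram" where
  "closed_braid_diagram s w =
     ((\<Union>k<length w. level_edges s k (fst (w ! k))) \<union> (\<Union>j\<in>{1..s}. closing_edges s (length w) j),
      {if snd (w ! k) then (rising_edge k (fst (w ! k)), falling_edge k (fst (w ! k)))
       else (falling_edge k (fst (w ! k)), rising_edge k (fst (w ! k))) | k. k < length w})"

definition non_split_braid_reps :: "(real \<Rightarrow> sphere_pt) set \<Rightarrow> (nat \<times> braid_word) set" where
  "non_split_braid_reps L =
     {(s, w). braid_word_on s w \<and> non_split s w \<and> has_diagram L (closed_braid_diagram s w)}"

end

theory Submission
  imports Defs
begin

text \<open>A closed braid diagram is travelled through strand by strand. Every component is entered at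
the bottom of the leftmost strand position that has not been visited before, and the components are
travelled through one after the other. Suppose that every crossing is met for the first time on its
over-passing strand. Then the whole link may be lifted so that its height falls along this journey, apart
from one edge of each component that returns to the beginning and takes part in no crossing, and such a
link is an unlink (\<open>descending_diagram_unlink\<close>, \<open>good_diagram_unlink\<close>).

Otherwise the first wrong crossing on the journey is resolved. The crossing change puts it right. The
smoothing replaces its two edges by vertical ones, and so it leads to a braid diagram again, of a word in
which one letter has been replaced by an empty level (\<open>skein_triple_braid\<close>). Both leave the
journey before that crossing as it was (\<open>journey_change\<close>, \<open>journey_smooth\<close>).
Hence the crossings are put right in the order in which they are met, a skein tree arises, and none of
its diagrams has to be moved before the next resolution.

The depth is bounded by means of the number of positive crossings, plus twice the number of negative
crossings that the journey has not met yet, minus the number of different indices of letters in the word.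
Each resolution lowers it by at least one. The decisive observation is
\<open>first_crossing_from_left\<close>: among the crossings of one index $i$ the first one that is met
is entered from the left. This is where the choice of leftmost base points matters. If that crossing is
positive, it is therefore met on the over-passing strand and is never resolved. So the smoothing of a
positive crossing never removes the last letter of an index, and at a leaf each index that occurs belongs
to some positive crossing, so that the number is not negative. For a non-split word of length $c$ it
starts as $c^+ + 2 c^- - (s - 1) = c - s + 1 + c^-$. The same argument with over and under exchanged
gives the bound with $c^+$ instead of $c^-$.

The topological part consists of three facts. First, a link in space can be moved along vertical lines to
prescribed heights if their differences on each vertical line are at least a fixed positive multiple of
the old ones (\<open>vertical_extension\<close>, \<open>isotopic_to_identity_vertical\<close>); so only
the diagram of a link matters. Second, once the height falls along the components, each horizontal plane
meets the link in at most two points, and maps $z \mapsto a z + b$ of these planes, with $a$ and $b$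
depending on the height, turn all components into round circles (\<open>straighten_stack\<close>). Third,
a link whose components run around the circles of the model unlink in the right direction is an unlink
(\<open>unlink_of_circles\<close>). Conversely, all nodes of the skein tree are realised by links because
polygonal links can be parametrised (\<open>polygonal_link_parametrisable\<close>) and the crossings of a
braid diagram can be realised by heights (\<open>braid_diagram_realised\<close>).\<close>

section \<open>Isotopic links\<close>

lemma reparametrisation_refl: "reparametrisation \<gamma> \<gamma>"
  unfolding reparametrisation_def by (intro exI[of _ "\<lambda>t. t"]) (auto simp: strict_mono_def fun_eq_iff)

lemma reparametrisation_trans:
  assumes "reparametrisation \<gamma> \<delta>" "reparametrisation \<delta> \<epsilon>"
  shows "reparametrisation \<gamma> \<epsilon>"
proof -
  obtain \<phi> where \<phi>: "continuous_on UNIV \<phi>" "strict_mono \<phi>" "\<And>t. \<phi> (t + 1) = \<phi> t + 1" "\<delta> = \<gamma> \<circ> \<phi>"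
    using assms(1) unfolding reparametrisation_def by blast
  obtain \<psi> where \<psi>: "continuous_on UNIV \<psi>" "strict_mono \<psi>" "\<And>t. \<psi> (t + 1) = \<psi> t + 1" "\<epsilon> = \<delta> \<circ> \<psi>"
    using assms(2) unfolding reparametrisation_def by blast
  show ?thesis
    unfolding reparametrisation_def
  proof (intro exI[of _ "\<phi> \<circ> \<psi>"] conjI)
    show "continuous_on UNIV (\<phi> \<circ> \<psi>)"
      using \<phi>(1) \<psi>(1) by (metis continuous_on_compose continuous_on_subset subset_UNIV)
    show "strict_mono (\<phi> \<circ> \<psi>)"
      using \<phi>(2) \<psi>(2) by (simp add: strict_mono_def)
  qed (use \<phi> \<psi> in \<open>auto simp: comp_assoc\<close>)
qed

lemma reparametrisation_comp:
  "reparametrisation \<gamma> \<delta> \<Longrightarrow> reparametrisation (f \<circ> \<gamma>) (f \<circ> \<delta>)"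
  unfolding reparametrisation_def by (auto simp: comp_assoc)

lemma same_oriented_refl: "same_oriented L L"
  unfolding same_oriented_def using reparametrisation_refl by blast

lemma same_oriented_trans:
  assumes LM: "same_oriented L M" and MN: "same_oriented M N"
  shows "same_oriented L N"
  unfolding same_oriented_def
proof (intro conjI ballI)
  fix \<gamma> assume "\<gamma> \<in> L"
  then obtain \<delta> where \<delta>: "\<delta> \<in> M" "reparametrisation \<gamma> \<delta>" using LM unfolding same_oriented_def by blast
  then obtain \<nu> where "\<nu> \<in> N" "reparametrisation \<delta> \<nu>" using MN unfolding same_oriented_def by blast
  then show "\<exists>\<nu>\<in>N. reparametrisation \<gamma> \<nu>" using reparametrisation_trans[OF \<delta>(2)] by blast
next
  fix \<nu> assume "\<nu> \<in> N"
  then obtain \<delta> where \<delta>: "\<delta> \<in> M" "reparametrisation \<delta> \<nu>" using MN unfolding same_oriented_def by blast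
  then obtain \<gamma> where "\<gamma> \<in> L" "reparametrisation \<gamma> \<delta>" using LM unfolding same_oriented_def by blast
  then show "\<exists>\<gamma>\<in>L. reparametrisation \<gamma> \<nu>" using reparametrisation_trans[OF _ \<delta>(2)] by blast
qed

lemma same_oriented_image: "same_oriented L M \<Longrightarrow> same_oriented ((\<lambda>\<gamma>. f \<circ> \<gamma>) ` L) ((\<lambda>\<gamma>. f \<circ> \<gamma>) ` M)"
  unfolding same_oriented_def using reparametrisation_comp by blast

lemma isotopic_refl: "isotopic L L"
  unfolding isotopic_def ambient_isotopy_def
proof (intro exI[of _ "\<lambda>t x. x"] conjI ballI)
  show "continuous_on ({0..1} \<times> S3) (\<lambda>(t::real, x). x)"
    by (simp add: case_prod_beta continuous_on_snd)
  show "\<exists>G. homeomorphism S3 S3 (\<lambda>x. x) G"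
    by (rule exI[of _ "\<lambda>x. x"]) (auto simp: homeomorphism_def)
  show "same_oriented ((\<lambda>\<gamma>. (\<lambda>x. x) \<circ> \<gamma>) ` L) L"
    by (simp add: same_oriented_refl comp_def)
qed auto

text \<open>Two ambient isotopies are composed at each time, not run one after the other; this avoids any
concatenation of paths.\<close>

lemma isotopic_trans:
  assumes "isotopic L M" "isotopic M N"
  shows "isotopic L N"
proof -
  obtain H where "ambient_isotopy H" and H4: "same_oriented ((\<lambda>\<gamma>. H 1 \<circ> \<gamma>) ` L) M"
    using assms(1) unfolding isotopic_def by blast
  then have H: "continuous_on ({0..1} \<times> S3) (\<lambda>(t, x). H t x)"
    "\<And>t. t \<in> {0..1} \<Longrightarrow> \<exists>G. homeomorphism S3 S3 (H t) G" "\<And>x. x \<in> S3 \<Longrightarrow> H 0 x = x"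
    by (simp_all add: ambient_isotopy_def)
  obtain G where "ambient_isotopy G" and G4: "same_oriented ((\<lambda>\<gamma>. G 1 \<circ> \<gamma>) ` M) N"
    using assms(2) unfolding isotopic_def by blast
  then have G: "continuous_on ({0..1} \<times> S3) (\<lambda>(t, x). G t x)"
    "\<And>t. t \<in> {0..1} \<Longrightarrow> \<exists>F. homeomorphism S3 S3 (G t) F" "\<And>x. x \<in> S3 \<Longrightarrow> G 0 x = x"
    by (simp_all add: ambient_isotopy_def)
  have HS: "H t x \<in> S3" if "t \<in> {0..1}" "x \<in> S3" for t x
    using H(2)[OF that(1)] that(2) by (auto simp: homeomorphism_def)
  show ?thesis
    unfolding isotopic_def ambient_isotopy_def
  proof (intro exI[of _ "\<lambda>t. G t \<circ> H t"] conjI ballI)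
    have "continuous_on ({0..1} \<times> S3) (\<lambda>z. (\<lambda>(t, x). G t x) (fst z, (\<lambda>(t, x). H t x) z))"
      by (rule continuous_on_compose2[OF G(1)])
        (use HS in \<open>auto intro!: continuous_on_Pair continuous_on_fst continuous_on_id H(1)\<close>)
    then show "continuous_on ({0..1} \<times> S3) (\<lambda>(t, x). (G t \<circ> H t) x)"
      by (simp add: case_prod_beta)
    show "\<exists>F. homeomorphism S3 S3 (G t \<circ> H t) F" if "t \<in> {0..1}" for t
      using H(2)[OF that] G(2)[OF that] homeomorphism_compose by blast
    show "(G 0 \<circ> H 0) x = x" if "x \<in> S3" for x
      using H(3) G(3) that by simp
    have "same_oriented ((\<lambda>\<gamma>. G 1 \<circ> \<gamma>) ` (\<lambda>\<gamma>. H 1 \<circ> \<gamma>) ` L) N"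
      using same_oriented_trans[OF same_oriented_image[OF H4] G4] .
    then show "same_oriented ((\<lambda>\<gamma>. G 1 \<circ> H 1 \<circ> \<gamma>) ` L) N"
      by (simp add: image_image comp_assoc)
  qed
qed

section \<open>Stereographic projection\<close>

definition from_S3 :: "sphere_pt \<Rightarrow> space" where
  "from_S3 y = (1 / (1 - snd y)) *\<^sub>R fst y"

lemma norm_space_pos: "(norm (x::space))\<^sup>2 + 1 > 0"
  by (simp add: add_nonneg_pos)

lemma to_S3_in_S3: "to_S3 x \<in> S3"
proof -
  define m where "m = (norm x)\<^sup>2 + 1"
  have m: "m > 0" "(norm x)\<^sup>2 = m - 1" using norm_space_pos[of x] by (auto simp: m_def)
  have "(norm (to_S3 x))\<^sup>2 = (2 / m)\<^sup>2 * (norm x)\<^sup>2 + ((m - 2) / m)\<^sup>2"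
    by (simp add: to_S3_def norm_Pair m_def power_divide power_mult_distrib)
  also have "\<dots> = (4 * (m - 1) + (m - 2)\<^sup>2) / m\<^sup>2"
    using m by (simp add: power_divide add_divide_distrib)
  also have "\<dots> = 1" using m(1) by (simp add: field_simps power2_eq_square)
  finally have "(norm (to_S3 x))\<^sup>2 = 1" .
  then have "norm (to_S3 x) = 1" by (metis abs_norm_cancel abs_1 one_power2 power2_eq_iff_nonneg norm_ge_zero zero_le_one)
  then show ?thesis by (simp add: dist_norm)
qed

lemma dist_to_S3_north: "dist (to_S3 x) (0, 1) = 2 / sqrt ((norm x)\<^sup>2 + 1)"
proof -
  define m where "m = (norm x)\<^sup>2 + 1"
  have m: "m > 0" "(norm x)\<^sup>2 = m - 1" using norm_space_pos[of x] by (auto simp: m_def)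
  have "(dist (to_S3 x) (0, 1))\<^sup>2 = (2 / m)\<^sup>2 * (norm x)\<^sup>2 + ((m - 2) / m - 1)\<^sup>2"
    by (simp add: to_S3_def dist_Pair_Pair dist_real_def m_def power_divide power_mult_distrib)
  also have "(m - 2) / m - 1 = - 2 / m" using m by (simp add: field_simps)
  also have "(2 / m)\<^sup>2 * (norm x)\<^sup>2 + (- 2 / m)\<^sup>2 = 4 / m"
    using m(1) unfolding m(2) by (simp add: field_simps power2_eq_square)
  also have "\<dots> = (2 / sqrt m)\<^sup>2" using m(1) by (simp add: power_divide)
  finally show ?thesis using m(1) unfolding m_def[symmetric]
    by (simp add: power2_eq_iff_nonneg)
qed

lemma to_S3_neq_north: "to_S3 x \<noteq> (0, 1)"
proof
  assume "to_S3 x = (0, 1)"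
  then have "2 / sqrt ((norm x)\<^sup>2 + 1) = 0" using dist_to_S3_north[of x] by simp
  then show False using norm_space_pos[of x] by simp
qed

lemma from_to_S3: "from_S3 (to_S3 x) = x"
proof -
  define m where "m = (norm x)\<^sup>2 + 1"
  have m: "m > 0" "(norm x)\<^sup>2 = m - 1" using norm_space_pos[of x] by (auto simp: m_def)
  have "1 / (1 - (m - 2) / m) * (2 / m) = 1" using m by (simp add: field_simps)
  then show ?thesis
    using m by (simp add: from_S3_def to_S3_def m_def[symmetric])
qed

lemma to_from_S3:
  assumes "y \<in> S3" "y \<noteq> (0, 1)"
  shows "to_S3 (from_S3 y) = y"
proof -
  obtain x h where y: "y = (x, h)" by (cases y)
  have nx: "(norm x)\<^sup>2 = 1 - h\<^sup>2"
    using assms(1) unfolding y by (simp add: dist_norm norm_Pair)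
  have "h \<noteq> 1"
    using nx assms(2) y by auto
  have "h\<^sup>2 \<le> 1" using nx by (metis diff_ge_0_iff_ge zero_le_power2)
  then have h: "h < 1" using \<open>h \<noteq> 1\<close> by (simp add: power2_le_iff_abs_le abs_square_le_1)
  have n: "(norm (from_S3 y))\<^sup>2 = (1 + h) / (1 - h)"
  proof -
    have "(norm (from_S3 y))\<^sup>2 = (1 - h\<^sup>2) / (1 - h)\<^sup>2"
      by (simp add: from_S3_def y power_divide nx)
    also have "1 - h\<^sup>2 = (1 - h) * (1 + h)" by (simp add: power2_eq_square algebra_simps)
    finally show ?thesis using h by (simp add: power2_eq_square)
  qed
  have m: "(norm (from_S3 y))\<^sup>2 + 1 = 2 / (1 - h)" unfolding n using h by (simp add: field_simps)
  have k: "((1 + h) / (1 - h) - 1) / (2 / (1 - h)) = h" using h by (simp add: field_simps)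
  show ?thesis
    unfolding to_S3_def m unfolding n k using h by (simp add: from_S3_def y)
qed

lemma continuous_on_to_S3: "continuous_on A to_S3"
  unfolding to_S3_def
  by (intro continuous_intros) (metis norm_space_pos less_irrefl)+

lemma continuous_on_from_S3: "continuous_on (S3 - {(0, 1)}) from_S3"
proof -
  have "snd y \<noteq> 1" if "y \<in> S3 - {(0, 1)}" for y :: sphere_pt
  proof
    assume 1: "snd y = 1"
    have "(norm (fst y))\<^sup>2 + (norm (snd y))\<^sup>2 = 1"
      using that by (cases y) (simp add: dist_norm norm_Pair)
    then show False using 1 that by (cases y) auto
  qed
  then show ?thesis
    unfolding from_S3_def by (intro continuous_intros) auto
qed

lemma inj_to_S3: "inj to_S3"
  by (metis from_to_S3 injI)

section \<open>Isotopies of space\<close>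

text \<open>An isotopy of space that extends to the point at infinity: the last conjunct says that points
which end up in a ball come from a fixed ball.\<close>

definition proper_isotopy :: "(real \<Rightarrow> space \<Rightarrow> space) \<Rightarrow> bool" where
  "proper_isotopy H \<longleftrightarrow>
     continuous_on ({0..1} \<times> UNIV) (\<lambda>(t, x). H t x) \<and> (\<forall>t\<in>{0..1}. bij (H t)) \<and>
     (\<forall>x. H 0 x = x) \<and>
     (\<forall>B. \<exists>R. \<forall>t\<in>{0..1}. \<forall>x. norm (H t x) \<le> B \<longrightarrow> norm x \<le> R)"

definition isotopic_to_identity :: "(space \<Rightarrow> space) \<Rightarrow> bool" where
  "isotopic_to_identity \<Phi> \<longleftrightarrow> (\<exists>H. proper_isotopy H \<and> H 1 = \<Phi>)"

lemma proper_isotopyD: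
  assumes "proper_isotopy H"
  shows "continuous_on ({0..1::real} \<times> UNIV) (\<lambda>(t, x). H t x)"
    "\<And>t. t \<in> {0..1} \<Longrightarrow> bij (H t)" "\<And>x. H 0 x = x"
    "\<And>B. \<exists>R. \<forall>t\<in>{0..1}. \<forall>x. norm (H t x) \<le> B \<longrightarrow> norm x \<le> R"
  using assms unfolding proper_isotopy_def by blast+

lemma isotopic_to_identity_bij: "isotopic_to_identity \<Phi> \<Longrightarrow> bij \<Phi>"
  unfolding isotopic_to_identity_def proper_isotopy_def by auto

lemma isotopic_to_identity_continuous: 
  assumes "isotopic_to_identity \<Phi>"
  shows "continuous_on A \<Phi>"
proof -
  obtain H where H0: "proper_isotopy H" "H 1 = \<Phi>"
    using assms unfolding isotopic_to_identity_def by blast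
  note H = proper_isotopyD[OF H0(1)] H0(2)
  have "continuous_on A (\<lambda>x. (\<lambda>(t, x). H t x) (1::real, x))"
    by (rule continuous_on_compose2[OF H(1)]) (auto intro!: continuous_intros)
  then show ?thesis using H(5) by simp
qed

lemma isotopic_to_identity_comp:
  assumes "isotopic_to_identity \<Phi>" "isotopic_to_identity \<Psi>"
  shows "isotopic_to_identity (\<Psi> \<circ> \<Phi>)"
proof -
  obtain H where H0: "proper_isotopy H" "H 1 = \<Phi>"
    using assms(1) unfolding isotopic_to_identity_def by blast
  note H = proper_isotopyD[OF H0(1)] H0(2)
  obtain G where G0: "proper_isotopy G" "G 1 = \<Psi>"
    using assms(2) unfolding isotopic_to_identity_def by blast
  note G = proper_isotopyD[OF G0(1)] G0(2)
  show ?thesis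
    unfolding isotopic_to_identity_def proper_isotopy_def
  proof (intro exI[of _ "\<lambda>t. G t \<circ> H t"] conjI ballI allI)
    have "continuous_on ({0..1} \<times> UNIV) (\<lambda>z. (\<lambda>(t, x). G t x) (fst z, (\<lambda>(t, x). H t x) z))"
      by (rule continuous_on_compose2[OF G(1)])
        (auto intro!: continuous_on_Pair continuous_on_fst continuous_on_id H(1))
    then show "continuous_on ({0..1} \<times> UNIV) (\<lambda>(t, x). (G t \<circ> H t) x)"
      by (simp add: case_prod_beta)
    show "bij (G t \<circ> H t)" if "t \<in> {0..1}" for t
      using H(2)[OF that] G(2)[OF that] by (rule bij_comp)
    fix B
    obtain R where R: "\<And>t x. t \<in> {0..1} \<Longrightarrow> norm (G t x) \<le> B \<Longrightarrow> norm x \<le> R" using G(4) by blast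
    obtain R' where "\<And>t x. t \<in> {0..1} \<Longrightarrow> norm (H t x) \<le> R \<Longrightarrow> norm x \<le> R'" using H(4) by blast
    then show "\<exists>R. \<forall>t\<in>{0..1}. \<forall>x. norm ((G t \<circ> H t) x) \<le> B \<longrightarrow> norm x \<le> R"
      using R by (metis comp_apply)
  qed (use H G in auto)
qed

text \<open>A proper isotopy of space, together with the fixed north pole, is an ambient isotopy of the
sphere. Continuity at the north pole is what properness is for. The inverse maps are continuous because
the sphere is compact.\<close>

lemma isotopic_of_isotopic_to_identity:
  assumes "isotopic_to_identity \<Phi>"
  shows "isotopic ((\<lambda>\<gamma>. to_S3 \<circ> \<gamma>) ` C) ((\<lambda>\<gamma>. to_S3 \<circ> (\<Phi> \<circ> \<gamma>)) ` C)"
proof -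
  obtain H where H0: "proper_isotopy H" "H 1 = \<Phi>"
    using assms(1) unfolding isotopic_to_identity_def by blast
  note H = proper_isotopyD[OF H0(1)] H0(2)
  define N :: sphere_pt where "N = (0, 1)"
  define G where "G t y = (if y = N then N else to_S3 (H t (from_S3 y)))" for t y
  have GN: "G t y = N \<longleftrightarrow> y = N" for t y
    using to_S3_neq_north by (auto simp: G_def N_def)
  have NS: "N \<in> S3" by (simp add: N_def dist_norm norm_Pair)
  have G_to: "G t (to_S3 x) = to_S3 (H t x)" for t x
    using to_S3_neq_north by (simp add: G_def N_def from_to_S3)
  have GS: "G t y \<in> S3" for t y using NS to_S3_in_S3 unfolding G_def by auto
  have fromD: "\<exists>x. y = to_S3 x" if "y \<in> S3" "y \<noteq> N" for y
    using to_from_S3 that by (metis N_def)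
  have cont: "continuous_on ({0..1} \<times> S3) (\<lambda>(t, x). G t x)"
  proof -
    have 1: "continuous_on ({0..1} \<times> (S3 - {N})) (\<lambda>(t, x). G t x)"
    proof -
      have "continuous_on ({0..1} \<times> (S3 - {N})) (\<lambda>z. to_S3 ((\<lambda>(t, x). H t x) (fst z, from_S3 (snd z))))"
        by (intro continuous_on_compose2[OF continuous_on_to_S3[of UNIV]] continuous_on_compose2[OF H(1)]
            continuous_on_Pair continuous_on_fst continuous_on_id
            continuous_on_compose2[OF continuous_on_from_S3] continuous_on_snd)
          (auto simp: N_def)
      then show ?thesis
      proof (rule continuous_on_eq)
        fix z :: "real \<times> sphere_pt" assume "z \<in> {0..1} \<times> (S3 - {N})"
        then have "snd z \<noteq> N" by (simp add: mem_Times_iff)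
        then show "to_S3 ((\<lambda>(t, x). H t x) (fst z, from_S3 (snd z))) = (\<lambda>(t, x). G t x) z"
          by (simp add: G_def case_prod_unfold)
      qed
    qed
    show ?thesis
      unfolding continuous_on_eq_continuous_within
    proof
      fix z :: "real \<times> sphere_pt" assume z: "z \<in> {0..1} \<times> S3"
      obtain t y where ty: "z = (t, y)" by (cases z)
      show "continuous (at z within {0..1} \<times> S3) (\<lambda>(t, x). G t x)"
      proof (cases "y = N")
        case False
        have "continuous (at z within {0..1} \<times> (S3 - {N})) (\<lambda>(t, x). G t x)"
          using 1 z ty False by (auto simp: continuous_on_eq_continuous_within)
        moreover have "at z within {0..1} \<times> S3 = at z within {0..1} \<times> (S3 - {N})"
          by (rule at_within_nhd[of _ "UNIV \<times> (- {N})"]) (use ty False in \<open>auto intro: open_Times\<close>)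
        ultimately show ?thesis by simp
      next
        case True
        show ?thesis
          unfolding continuous_within_eps_delta
        proof (intro allI impI)
          fix e :: real assume e: "e > 0"
          obtain R where R: "\<And>t x. t \<in> {0..1} \<Longrightarrow> norm (H t x) \<le> 2 / e \<Longrightarrow> norm x \<le> R" using H(4) by blast
          define d where "d = 2 / sqrt (R\<^sup>2 + 1)"
          have "R\<^sup>2 + 1 > 0" by (simp add: add_nonneg_pos)
          then have d: "d > 0" by (simp add: d_def)
          show "\<exists>d>0. \<forall>x'\<in>{0..1} \<times> S3. dist x' z < d \<longrightarrow> dist (case x' of (t, x) \<Rightarrow> G t x) (case z of (t, x) \<Rightarrow> G t x) < e"
          proof (intro exI[of _ d] conjI d ballI impI)
            fix z' assume z': "z' \<in> {0..1} \<times> S3" "dist z' z < d"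
            obtain t' y' where ty': "z' = (t', y')" by (cases z')
            have t': "t' \<in> {0..1}" and y': "y' \<in> S3" using z' ty' by auto
            have dy: "dist y' N < d"
              using z'(2) dist_snd_le[of z' z] True ty ty' by simp
            have "dist (G t' y') N < e"
            proof (cases "y' = N")
              case True then show ?thesis using e by (simp add: G_def)
            next
              case F: False
              then obtain x where x: "y' = to_S3 x" using fromD y' by blast
              have "2 / sqrt ((norm x)\<^sup>2 + 1) < 2 / sqrt (R\<^sup>2 + 1)"
                using dy dist_to_S3_north[of x] unfolding x N_def d_def by simp
              then have "\<not> norm x \<le> R"
              proof -
                assume a: "2 / sqrt ((norm x)\<^sup>2 + 1) < 2 / sqrt (R\<^sup>2 + 1)"
                have "(norm x)\<^sup>2 \<le> R\<^sup>2" if "norm x \<le> R" using that by (simp add: power_mono)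
                then have "norm x \<le> R \<Longrightarrow> 2 / sqrt (R\<^sup>2 + 1) \<le> 2 / sqrt ((norm x)\<^sup>2 + 1)"
                  using norm_space_pos[of x] by (intro divide_left_mono) auto
                then show ?thesis using a by linarith
              qed
              then have "norm (H t' x) > 2 / e" using R[OF t', of x] by linarith
              then have "(2 / e)\<^sup>2 < (norm (H t' x))\<^sup>2" using e by (intro power_strict_mono) auto
              then have "sqrt ((2 / e)\<^sup>2) < sqrt ((norm (H t' x))\<^sup>2 + 1)" by (intro real_sqrt_less_mono) auto
              then have gt: "2 / e < sqrt ((norm (H t' x))\<^sup>2 + 1)" using e by simp
              then have "2 / sqrt ((norm (H t' x))\<^sup>2 + 1) < e"
                using e by (smt (verit, best) divide_pos_pos mult.commute pos_divide_less_eq)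
              then show ?thesis
                unfolding x G_to using dist_to_S3_north N_def by simp
            qed
            moreover have "G t N = N" by (simp add: G_def)
            ultimately show "dist (case z' of (t, x) \<Rightarrow> G t x) (case z of (t, x) \<Rightarrow> G t x) < e"
              using ty ty' True by simp
          qed
        qed
      qed
    qed
  qed
  have homeo: "\<exists>F. homeomorphism S3 S3 (G t) F" if t: "t \<in> {0..1}" for t
  proof (rule homeomorphism_compact)
    have "continuous_on S3 (\<lambda>x. (\<lambda>(t, x). G t x) (t, x))"
      by (rule continuous_on_compose2[OF cont]) (use t in \<open>auto intro!: continuous_intros\<close>)
    then show "continuous_on S3 (G t)" by simp
    show "G t ` S3 = S3"
    proof
      show "S3 \<subseteq> G t ` S3"
      proof
        fix y assume y: "y \<in> S3"
        show "y \<in> G t ` S3"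
        proof (cases "y = N")
          case True then show ?thesis using GN NS by (metis image_eqI)
        next
          case False
          then obtain x where x: "y = to_S3 x" using fromD y by blast
          obtain x' where "x = H t x'" using H(2)[OF t] by (metis bij_pointE)
          then show ?thesis using G_to x to_S3_in_S3 by (metis image_eqI)
        qed
      qed
    qed (use GS in auto)
    show "inj_on (G t) S3"
    proof (rule inj_onI)
      fix y z assume yz: "y \<in> S3" "z \<in> S3" "G t y = G t z"
      show "y = z"
      proof (cases "y = N \<or> z = N")
        case True then show ?thesis using GN yz by metis
      next
        case False
        then obtain a b where "y = to_S3 a" "z = to_S3 b" using fromD yz by metis
        then show ?thesis using yz G_to inj_to_S3 H(2)[OF t] by (metis bij_pointE injD)
      qed
    qed
  qed simp
  have G0: "G 0 y = y" if "y \<in> S3" for y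
    using that H(3) to_from_S3 by (simp add: G_def N_def)
  have "ambient_isotopy G"
    unfolding ambient_isotopy_def using cont homeo G0 by blast
  moreover have "(\<lambda>\<gamma>. G 1 \<circ> \<gamma>) ` (\<lambda>\<gamma>. to_S3 \<circ> \<gamma>) ` C = (\<lambda>\<gamma>. to_S3 \<circ> (\<Phi> \<circ> \<gamma>)) ` C"
    unfolding image_image
    by (rule image_cong) (auto simp: fun_eq_iff G_to H(5))
  ultimately show ?thesis
    unfolding isotopic_def using same_oriented_refl by metis
qed

section \<open>Vertical, horizontal and rotating isotopies\<close>

text \<open>On the compact set where \<open>\<psi>\<close> is at least \<open>e\<close>, the function
\<open>d\<close> has a positive minimum.\<close>

lemma compact_modulus:
  fixes \<psi> d :: "'a::metric_space \<Rightarrow> real"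
  assumes Y: "compact Y" and \<psi>: "continuous_on Y \<psi>" and d: "continuous_on Y d"
    and pos: "\<And>y. y \<in> Y \<Longrightarrow> d y \<ge> 0" and zero: "\<And>y. y \<in> Y \<Longrightarrow> d y = 0 \<Longrightarrow> \<psi> y \<le> 0" and "e > 0"
  shows "\<exists>M\<ge>0. \<forall>y\<in>Y. \<psi> y \<le> e + M * d y"
proof -
  define S where "S = Y \<inter> \<psi> -` {e..}"
  have S: "compact S"
  proof -
    have "closed S" unfolding S_def
      using continuous_closed_preimage[OF \<psi> compact_imp_closed[OF Y] closed_atLeast] .
    moreover have "S = Y \<inter> S" by (auto simp: S_def)
    ultimately show ?thesis using Y by (metis compact_Int_closed)
  qed
  show ?thesis
  proof (cases "S = {}")
    case True
    then show ?thesis by (intro exI[of _ 0]) (force simp: S_def)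
  next
    case False
    obtain m where m: "m \<in> S" "\<And>y. y \<in> S \<Longrightarrow> d m \<le> d y"
      using continuous_attains_inf[OF S False continuous_on_subset[OF d]] by (auto simp: S_def)
    obtain C where C: "C \<in> S" "\<And>y. y \<in> S \<Longrightarrow> \<psi> y \<le> \<psi> C"
      using continuous_attains_sup[OF S False continuous_on_subset[OF \<psi>]] by (auto simp: S_def)
    have dm: "d m > 0"
      using m(1) pos[of m] zero[of m] \<open>e > 0\<close> by (force simp: S_def)
    have pC: "\<psi> C > 0" using C(1) \<open>e > 0\<close> by (simp add: S_def)
    show ?thesis
    proof (intro exI[of _ "\<psi> C / d m"] conjI ballI)
      show "\<psi> C / d m \<ge> 0" using dm pC by simp
      fix y assume y: "y \<in> Y"
      show "\<psi> y \<le> e + \<psi> C / d m * d y"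
      proof (cases "y \<in> S")
        case True
        have "\<psi> C = \<psi> C / d m * d m" using dm by simp
        also have "\<dots> \<le> \<psi> C / d m * d y" using m(2)[OF True] dm pC by (intro mult_left_mono) auto
        finally show ?thesis using C(2)[OF True] \<open>e > 0\<close> by linarith
      next
        case False
        then have "\<psi> y < e" using y by (auto simp: S_def)
        moreover have "\<psi> C / d m * d y \<ge> 0" using dm pC pos[OF y] by simp
        ultimately show ?thesis by linarith
      qed
    qed
  qed
qed

text \<open>The relation \<open>Z\<close> prescribes heights \<open>y\<close> at some points \<open>(x,
h)\<close>. After subtraction of the linear function \<open>c * h\<close> the prescribed values
\<open>g\<close> are still monotone on each vertical line. They are extended as in McShane's theorem by
an infimum of \<open>g z + \<omega> (e p z)\<close>, where the asymmetric distance \<open>e\<close>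
neglects descents, which makes the extension monotone in the height. Lipschitz bounds need not exist;
instead of a Lipschitz constant there is the modulus \<open>\<omega>\<close>, an infimum of affine
functions \<open>1 / n + M\<^sub>n * r\<close> whose slopes come from compactness. Such an infimum is
subadditive, and that is all that McShane's argument uses.\<close>

lemma vertical_extension:
  fixes Z :: "(space \<times> real) set"
  assumes Z: "compact Z" and c: "c > 0"
    and mono: "\<And>x h y h' y'. ((x, h), y) \<in> Z \<Longrightarrow> ((x, h'), y') \<in> Z \<Longrightarrow> h' \<le> h \<Longrightarrow> c * (h - h') \<le> y - y'"
  shows "\<exists>F. continuous_on UNIV F \<and> (\<forall>(P, y)\<in>Z. F P = y) \<and> (\<forall>x. strict_mono (\<lambda>h. F (x, h))) \<and>
           (\<exists>B. \<forall>x h. \<bar>F (x, h) - c * h\<bar> \<le> B)"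
proof (cases "Z = {}")
  case True
  show ?thesis
    by (rule exI[of _ "\<lambda>p. c * snd p"]) (use True c in \<open>auto intro!: continuous_intros exI[of _ 0] simp: strict_mono_def\<close>)
next
  case ne: False
  define g where "g z = snd z - c * snd (fst z)" for z :: "space \<times> real"
  \<comment> \<open>Only ascents from \<open>p'\<close> to \<open>p\<close> count.\<close>
  define e where "e p p' = norm (fst p - fst p') + max 0 (snd p - snd p')" for p p' :: space
  have e0: "e p p' \<ge> 0" for p p' by (simp add: e_def)
  have e_tri: "e p q \<le> e p r + e r q" for p q r
    using norm_triangle_ineq[of "fst p - fst r" "fst r - fst q"] by (simp add: e_def)
  have gcont: "continuous_on A g" for A unfolding g_def by (intro continuous_intros)
  have "\<exists>M\<ge>0. \<forall>u\<in>Z \<times> Z. g (fst u) - g (snd u) \<le> 1 / real (Suc n) + M * e (fst (fst u)) (fst (snd u))" for n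
  proof (rule compact_modulus)
    show "compact (Z \<times> Z)" using Z by (rule compact_Times[OF _ Z])
    show "continuous_on (Z \<times> Z) (\<lambda>u. g (fst u) - g (snd u))" unfolding g_def by (intro continuous_intros)
    show "continuous_on (Z \<times> Z) (\<lambda>u. e (fst (fst u)) (fst (snd u)))" unfolding e_def by (intro continuous_intros)
    show "e (fst (fst u)) (fst (snd u)) \<ge> 0" for u :: "(space \<times> real) \<times> (space \<times> real)" by (rule e0)
    fix u assume u: "u \<in> Z \<times> Z" and eu: "e (fst (fst u)) (fst (snd u)) = 0"
    obtain x h y x' h' y' where uu: "u = (((x, h), y), ((x', h'), y'))" by (metis surj_pair)
    have eq: "norm (x - x') + max 0 (h - h') = 0" using eu by (simp add: e_def uu)
    have ge: "norm (x - x') \<ge> 0" "max 0 (h - h') \<ge> 0" by auto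
    have "norm (x - x') = 0" "max 0 (h - h') = 0" using eq ge by linarith+
    then have "x = x'" "h \<le> h'" by (auto simp: max_def split: if_splits)
    then have "c * (h' - h) \<le> y' - y"
      using mono[of x h' y' h y] u uu by auto
    then show "g (fst u) - g (snd u) \<le> 0" by (simp add: g_def uu algebra_simps)
  qed simp
  then obtain M where M0: "\<And>n. M n \<ge> 0" and M: "\<And>n z z'. z \<in> Z \<Longrightarrow> z' \<in> Z \<Longrightarrow>
      g z - g z' \<le> 1 / real (Suc n) + M n * e (fst z) (fst z')"
    by (metis fst_conv snd_conv mem_Times_iff)
  define T where "T r n = 1 / real (Suc n) + M n * r" for r n
  define \<omega> where "\<omega> r = (INF n. T r n)" for r
  have bdd: "bdd_below (range (T r))" if "r \<ge> 0" for r
    using M0 that by (auto intro!: bdd_belowI[of _ 0] simp: T_def)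
  have \<omega>_le: "\<omega> r \<le> T r n" if "r \<ge> 0" for r n
    unfolding \<omega>_def by (rule cINF_lower[OF bdd[OF that]]) simp
  have \<omega>_ge: "a \<le> \<omega> r" if "\<And>n. a \<le> T r n" for a r
    unfolding \<omega>_def by (rule cINF_greatest) (use that in auto)
  have \<omega>0: "\<omega> r \<ge> 0" if "r \<ge> 0" for r by (rule \<omega>_ge) (use M0 that in \<open>simp add: T_def\<close>)
  have \<omega>_zero: "\<omega> 0 = 0"
  proof (rule antisym)
    show "\<omega> 0 \<le> 0"
    proof (rule field_le_epsilon)
      fix \<epsilon> :: real assume "\<epsilon> > 0"
      then obtain n where "1 / real (Suc n) < \<epsilon>" using nat_approx_posE by blast
      then show "\<omega> 0 \<le> 0 + \<epsilon>" using \<omega>_le[of 0 n] by (simp add: T_def)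
    qed
  qed (rule \<omega>0, simp)
  have \<omega>_mono: "\<omega> a \<le> \<omega> b" if "0 \<le> a" "a \<le> b" for a b
  proof (rule \<omega>_ge)
    fix n
    have "T a n \<le> T b n" using that M0[of n] by (simp add: T_def mult_left_mono)
    then show "\<omega> a \<le> T b n" using \<omega>_le[OF that(1), of n] by linarith
  qed
  have \<omega>_sub: "\<omega> (a + b) \<le> \<omega> a + \<omega> b" if ab: "0 \<le> a" "0 \<le> b" for a b
  proof -
    have 1: "\<omega> (a + b) \<le> T a n + T b m" for n m
    proof (cases "M n \<le> M m")
      case True
      have "T (a + b) n \<le> T a n + M m * b" using True ab by (simp add: T_def distrib_left mult_right_mono)
      also have "\<dots> \<le> T a n + T b m" by (simp add: T_def)
      finally show ?thesis using \<omega>_le[of "a + b" n] ab by simp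
    next
      case False
      have "T (a + b) m \<le> T b m + M n * a" using False ab by (simp add: T_def distrib_left mult_right_mono)
      also have "\<dots> \<le> T a n + T b m" by (simp add: T_def)
      finally show ?thesis using \<omega>_le[of "a + b" m] ab by simp
    qed
    have "\<omega> (a + b) - T a n \<le> \<omega> b" for n by (rule \<omega>_ge) (use 1[of n] in \<open>simp add: algebra_simps\<close>)
    then have "\<omega> (a + b) - \<omega> b \<le> \<omega> a" by (intro \<omega>_ge) (simp add: algebra_simps)
    then show ?thesis by simp
  qed
  have g_\<omega>: "g z \<le> g z' + \<omega> (e (fst z) (fst z'))" if "z \<in> Z" "z' \<in> Z" for z z'
  proof -
    have "g z - g z' \<le> \<omega> (e (fst z) (fst z'))" by (rule \<omega>_ge) (use M[OF that] in \<open>simp add: T_def\<close>)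
    then show ?thesis by simp
  qed
  obtain C where C: "\<And>z. z \<in> Z \<Longrightarrow> \<bar>g z\<bar> \<le> C"
  proof -
    have "bounded (g ` Z)" using compact_continuous_image[OF gcont Z] by (rule compact_imp_bounded)
    then show thesis using that unfolding bounded_real by blast
  qed
  define G where "G p = (INF z\<in>Z. g z + \<omega> (e p (fst z)))" for p
  have Gbdd: "bdd_below ((\<lambda>z. g z + \<omega> (e p (fst z))) ` Z)" for p
  proof (rule bdd_belowI)
    fix a assume "a \<in> (\<lambda>z. g z + \<omega> (e p (fst z))) ` Z"
    then obtain z where z: "z \<in> Z" "a = g z + \<omega> (e p (fst z))" by blast
    show "- C \<le> a" using C[OF z(1)] \<omega>0[OF e0, of p "fst z"] unfolding z(2) by linarith
  qed
  have G_le: "G p \<le> g z + \<omega> (e p (fst z))" if "z \<in> Z" for p z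
    unfolding G_def by (rule cINF_lower[OF Gbdd that])
  have G_ge: "a \<le> G p" if "\<And>z. z \<in> Z \<Longrightarrow> a \<le> g z + \<omega> (e p (fst z))" for a p
    unfolding G_def by (rule cINF_greatest) (use that ne in auto)
  have G_ext: "G (fst z) = g z" if "z \<in> Z" for z
  proof (rule antisym)
    show "G (fst z) \<le> g z" using G_le[OF that, of "fst z"] \<omega>_zero by (simp add: e_def)
    show "g z \<le> G (fst z)" by (rule G_ge) (use g_\<omega>[OF that] in auto)
  qed
  have G_mod: "G p \<le> G q + \<omega> (e p q)" for p q
  proof -
    have "G p - \<omega> (e p q) \<le> G q"
    proof (rule G_ge)
      fix z assume z: "z \<in> Z"
      have "\<omega> (e p (fst z)) \<le> \<omega> (e p q + e q (fst z))" by (rule \<omega>_mono) (use e0 e_tri in auto)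
      also have "\<dots> \<le> \<omega> (e p q) + \<omega> (e q (fst z))" by (rule \<omega>_sub) (use e0 in auto)
      finally show "G p - \<omega> (e p q) \<le> g z + \<omega> (e q (fst z))" using G_le[OF z, of p] by linarith
    qed
    then show ?thesis by simp
  qed
  have G_mono: "G (x, h) \<le> G (x, h')" if "h \<le> h'" for x h h'
    using G_mod[of "(x, h)" "(x, h')"] that \<omega>_zero by (simp add: e_def)
  have G_cont: "continuous_on UNIV G"
    unfolding continuous_on_iff
  proof (intro ballI allI impI)
    fix p :: space and \<epsilon> :: real assume \<epsilon>: "\<epsilon> > 0"
    then obtain n where n: "1 / real (Suc n) < \<epsilon> / 2" using nat_approx_posE[of "\<epsilon> / 2"] by auto
    define \<delta> where "\<delta> = \<epsilon> / (4 * (M n + 1))"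
    have \<delta>: "\<delta> > 0" using \<epsilon> M0[of n] by (simp add: \<delta>_def add_nonneg_pos)
    show "\<exists>\<delta>>0. \<forall>q\<in>UNIV. dist q p < \<delta> \<longrightarrow> dist (G q) (G p) < \<epsilon>"
    proof (intro exI[of _ \<delta>] conjI \<delta> ballI impI)
      fix q assume q: "dist q p < \<delta>"
      have e2: "e a b \<le> 2 * dist a b" for a b
        using dist_fst_le[of a b] dist_snd_le[of a b] zero_le_dist[of a b] unfolding e_def dist_norm real_norm_def by linarith
      have sm: "\<omega> (e a b) < \<epsilon>" if "dist a b < \<delta>" for a b
      proof -
        have "\<omega> (e a b) \<le> 1 / real (Suc n) + M n * e a b" using \<omega>_le[OF e0] by (simp add: T_def)
        also have "M n * e a b \<le> (M n + 1) * (2 * \<delta>)"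
          using e2[of a b] that M0[of n] e0[of a b] by (intro mult_mono) auto
        also have "\<dots> = \<epsilon> / 2" using M0[of n] by (simp add: \<delta>_def field_simps)
        finally show ?thesis using n by linarith
      qed
      show "dist (G q) (G p) < \<epsilon>"
        using G_mod[of q p] G_mod[of p q] sm[OF q] sm[of p q] q by (simp add: dist_real_def dist_commute abs_less_iff)
    qed
  qed
  define F where "F p = max (- C) (min C (G p)) + c * snd p" for p
  show ?thesis
  proof (intro exI[of _ F] conjI allI ballI)
    show "continuous_on UNIV F" unfolding F_def by (intro continuous_intros G_cont)
    show "\<And>z. z \<in> Z \<Longrightarrow> (case z of (P, y) \<Rightarrow> F P = y)"
    proof -
      fix z assume z: "z \<in> Z"
      have "F (fst z) = g z + c * snd (fst z)" using G_ext[OF z] C[OF z] by (simp add: F_def abs_le_iff)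
      then show "case z of (P, y) \<Rightarrow> F P = y" by (cases z) (simp add: g_def)
    qed
    show "strict_mono (\<lambda>h. F (x, h))" for x
    proof (rule strict_monoI)
      fix h h' :: real assume "h < h'"
      then have "G (x, h) \<le> G (x, h')" "c * h < c * h'" using G_mono c by auto
      then show "F (x, h) < F (x, h')" by (simp add: F_def)
    qed
    have "C \<ge> 0" using ne C by force
    then show "\<exists>B. \<forall>x h. \<bar>F (x, h) - c * h\<bar> \<le> B" by (intro exI[of _ C]) (auto simp: F_def abs_le_iff)
  qed
qed

lemma isotopic_to_identity_vertical:
  fixes F :: "space \<Rightarrow> real"
  assumes F: "continuous_on UNIV F" and mono: "\<And>x. strict_mono (\<lambda>h. F (x, h))"
    and c: "c > 0" and B: "\<And>x h. \<bar>F (x, h) - c * h\<bar> \<le> B"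
  shows "isotopic_to_identity (\<lambda>p. (fst p, F p))"
proof -
  define g where "g t x h = (1 - t) * h + t * F (x, h)" for t x h
  \<comment> \<open>All the interpolated maps have slopes between those of the identity and of \<open>c * h\<close>, up to the
     bounded error \<open>B\<close>.\<close>
  define m where "m = min 1 c"
  have m: "m > 0" using c by (simp add: m_def)
  have B0: "B \<ge> 0" using B[of 0 0] by linarith
  have g_mono: "strict_mono (g t x)" if "t \<in> {0..1}" for t x
  proof (rule strict_monoI)
    fix h h' :: real assume h: "h < h'"
    then have F': "F (x, h) < F (x, h')" using mono by (simp add: strict_mono_def)
    show "g t x h < g t x h'"
    proof (cases "t = 0")
      case False
      then have "t * F (x, h) < t * F (x, h')" using that F' by simp
      moreover have "(1 - t) * h \<le> (1 - t) * h'" using that h by (simp add: mult_left_mono)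
      ultimately show ?thesis by (simp add: g_def)
    qed (simp add: g_def h)
  qed
  have gB: "\<exists>k\<ge>m. \<bar>g t x h - k * h\<bar> \<le> B" if t: "t \<in> {0..1}" for t x h
  proof (intro exI[of _ "(1 - t) + t * c"] conjI)
    have "(1 - t) * m \<le> (1 - t) * 1" "t * m \<le> t * c" using t by (intro mult_left_mono; simp add: m_def)+
    then show "m \<le> (1 - t) + t * c" by (simp add: algebra_simps)
    have "g t x h - ((1 - t) + t * c) * h = t * (F (x, h) - c * h)" by (simp add: g_def algebra_simps)
    also have "\<bar>\<dots>\<bar> \<le> 1 * B" unfolding abs_mult using t B by (intro mult_mono) auto
    finally show "\<bar>g t x h - ((1 - t) + t * c) * h\<bar> \<le> B" by simp
  qed
  have g_cont: "continuous_on UNIV (g t x)" for t x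
    unfolding g_def by (intro continuous_intros continuous_on_compose2[OF F]) auto
  have g_surj: "\<exists>h. g t x h = y" if t: "t \<in> {0..1}" for t x y
  proof -
    define h0 where "h0 = (\<bar>y\<bar> + B) / m"
    have h0: "h0 \<ge> 0" using m B0 by (simp add: h0_def)
    have mh: "m * h0 = \<bar>y\<bar> + B" using m by (simp add: h0_def)
    obtain k where k: "k \<ge> m" "\<bar>g t x h0 - k * h0\<bar> \<le> B" using gB[OF t] by blast
    obtain l where l: "l \<ge> m" "\<bar>g t x (- h0) - l * (- h0)\<bar> \<le> B" using gB[OF t] by blast
    have "m * h0 \<le> k * h0" "m * h0 \<le> l * h0" using k l h0 by (auto intro: mult_right_mono)
    then have "g t x (- h0) \<le> y" "y \<le> g t x h0" using k(2) l(2) mh by (auto simp: abs_le_iff)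
    then show ?thesis using IVT'[of "g t x" "- h0" y h0] h0 g_cont[of t x]
      using continuous_on_subset subset_UNIV by fastforce
  qed
  define H where "H t p = (fst p, g t (fst p) (snd p))" for t and p :: space
  have "proper_isotopy H"
    unfolding proper_isotopy_def
  proof (intro conjI ballI allI)
    show "continuous_on ({0..1} \<times> UNIV) (\<lambda>(t, x). H t x)"
      unfolding H_def g_def case_prod_unfold
      by (intro continuous_intros continuous_on_compose2[OF F]) auto
    show "bij (H t)" if t: "t \<in> {0..1}" for t
    proof (rule bijI)
      show "inj (H t)"
        using strict_mono_eq[OF g_mono[OF t]] by (auto simp: inj_def H_def)
      show "surj (H t)"
        unfolding surj_def H_def using g_surj[OF t] by (metis fst_conv prod.collapse snd_conv)
    qed
    show "H 0 p = p" for p by (simp add: H_def g_def)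
    fix R
    show "\<exists>R'. \<forall>t\<in>{0..1}. \<forall>p. norm (H t p) \<le> R \<longrightarrow> norm p \<le> R'"
    proof (intro exI[of _ "R + (R + B) / m"] ballI allI impI)
      fix t p assume t: "t \<in> {0..1::real}" and n: "norm (H t p) \<le> R"
      obtain x h where p: "p = (x, h)" by (cases p)
      have nx: "norm x \<le> R" using n norm_fst_le[of x "g t x h"] by (simp add: H_def p)
      have ng: "\<bar>g t x h\<bar> \<le> R" using n norm_snd_le[of "g t x h" x] by (simp add: H_def p)
      obtain k where k: "k \<ge> m" "\<bar>g t x h - k * h\<bar> \<le> B" using gB[OF t] by blast
      have "m * \<bar>h\<bar> \<le> k * \<bar>h\<bar>" using k by (intro mult_right_mono) auto
      also have "\<dots> = \<bar>k * h\<bar>" using k m by (simp add: abs_mult)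
      also have "\<dots> \<le> R + B" using k(2) ng by linarith
      finally have "\<bar>h\<bar> \<le> (R + B) / m" using m by (simp add: pos_le_divide_eq mult.commute)
      then show "norm p \<le> R + (R + B) / m"
        using norm_Pair_le[of x h] nx by (simp add: p)
    qed
  qed
  moreover have "H 1 = (\<lambda>p. (fst p, F p))" by (simp add: H_def g_def fun_eq_iff)
  ultimately show ?thesis unfolding isotopic_to_identity_def by blast
qed

definition to_C :: "plane \<Rightarrow> complex" where "to_C x = Complex (fst x) (snd x)"
definition of_C :: "complex \<Rightarrow> plane" where "of_C z = (Re z, Im z)"

lemma to_of_C [simp]: "to_C (of_C z) = z" and of_to_C [simp]: "of_C (to_C x) = x"
  by (simp_all add: to_C_def of_C_def)

lemma norm_of_C [simp]: "norm (of_C z) = norm z"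
  by (simp add: of_C_def norm_prod_def cmod_def)

lemma norm_to_C [simp]: "norm (to_C z) = norm z"
  by (simp add: to_C_def norm_prod_def cmod_def)

lemma continuous_on_of_C [continuous_intros]: "continuous_on A f \<Longrightarrow> continuous_on A (\<lambda>x. of_C (f x))"
  unfolding of_C_def by (intro continuous_intros)

lemma continuous_on_to_C [continuous_intros]: "continuous_on A f \<Longrightarrow> continuous_on A (\<lambda>x. to_C (f x))"
  unfolding to_C_def Complex_eq by (intro continuous_intros)

text \<open>The factor \<open>exp (A h)\<close> is contracted to 1 along \<open>exp (t * A h)\<close>;
this is why the factor must have a continuous logarithm.\<close>

lemma isotopic_to_identity_horizontal:
  fixes A B :: "real \<Rightarrow> complex"
  assumes A: "continuous_on UNIV A" "\<And>h. norm (A h) \<le> K" and B: "continuous_on UNIV B" "\<And>h. norm (B h) \<le> K"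
  shows "isotopic_to_identity (\<lambda>p. (of_C (exp (A (snd p)) * to_C (fst p) + B (snd p)), snd p))"
proof -
  define H where "H t p = (of_C (exp (of_real t * A (snd p)) * to_C (fst p) + of_real t * B (snd p)), snd p)"
    for t :: real and p :: space
  have "proper_isotopy H"
    unfolding proper_isotopy_def
  proof (intro conjI ballI allI)
    show "continuous_on ({0..1} \<times> UNIV) (\<lambda>(t, x). H t x)"
      unfolding H_def case_prod_unfold
      by (intro continuous_intros continuous_on_compose2[OF A(1)] continuous_on_compose2[OF B(1)]) auto
    show "H 0 p = p" for p by (simp add: H_def)
    have inv: "of_C ((to_C (fst (H t p)) - of_real t * B (snd p)) * exp (- (of_real t * A (snd p)))) = fst p" for t p
      by (simp add: H_def exp_minus field_simps)
    show "bij (H t)" if t: "t \<in> {0..1}" for t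
    proof (rule bijI)
      show "inj (H t)"
      proof (rule injI)
        fix p q assume pq: "H t p = H t q"
        then have "snd p = snd q" by (simp add: H_def)
        moreover have "fst p = fst q" using inv[of t p] inv[of t q] pq calculation by metis
        ultimately show "p = q" by (simp add: prod_eq_iff)
      qed
      show "surj (H t)"
        unfolding surj_def
      proof
        fix q
        show "\<exists>p. q = H t p"
          by (intro exI[of _ "(of_C ((to_C (fst q) - of_real t * B (snd q)) * exp (- (of_real t * A (snd q)))), snd q)"])
            (rule prod_eqI; simp add: H_def exp_minus field_simps)
      qed
    qed
    fix R
    show "\<exists>R'. \<forall>t\<in>{0..1}. \<forall>p. norm (H t p) \<le> R \<longrightarrow> norm p \<le> R'"
    proof (intro exI[of _ "(R + K) * exp K + R"] ballI allI impI)
      fix t p assume t: "t \<in> {0..1::real}" and n: "norm (H t p) \<le> R"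
      obtain x h where p: "p = (x, h)" by (cases p)
      have h: "\<bar>h\<bar> \<le> R" using n norm_snd_le[of "snd (H t p)" "fst (H t p)"] by (simp add: H_def p)
      have f: "norm (to_C (fst (H t p))) \<le> R" using n norm_fst_le[of "fst (H t p)" "snd (H t p)"] by simp
      have K0: "K \<ge> 0" using A(2)[of 0] norm_ge_zero order_trans by blast
      have tK: "t * norm (B h) \<le> 1 * K" "t * norm (A h) \<le> 1 * K" using t A B K0 by (intro mult_mono; auto)+
      have "norm x = norm (to_C (fst (H t p)) - of_real t * B h) * norm (exp (- (of_real t * A h)))"
        using arg_cong[OF inv[of t p], of norm] by (simp add: p norm_mult)
      also have "\<dots> \<le> (R + K) * exp K"
      proof (intro mult_mono)
        show "norm (to_C (fst (H t p)) - of_real t * B h) \<le> R + K"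
          using norm_triangle_ineq4[of "to_C (fst (H t p))" "of_real t * B h"] f tK t by (simp add: norm_mult)
        have "Re (- (of_real t * A h)) \<le> norm (- (of_real t * A h))" by (rule complex_Re_le_cmod)
        also have "\<dots> \<le> K" using tK t by (simp add: norm_mult)
        finally show "norm (exp (- (of_real t * A h))) \<le> exp K" unfolding norm_exp_eq_Re by simp
        show "R + K \<ge> 0" using K0 n norm_ge_zero order_trans by (metis add_nonneg_nonneg)
      qed simp
      finally show "norm p \<le> (R + K) * exp K + R"
        using norm_Pair_le[of x h] h by (simp add: p)
    qed
  qed
  moreover have "H 1 = (\<lambda>p. (of_C (exp (A (snd p)) * to_C (fst p) + B (snd p)), snd p))" by (simp add: H_def fun_eq_iff)
  ultimately show ?thesis unfolding isotopic_to_identity_def by blast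
qed

lemma isotopic_to_identity_rotation:
  assumes H: "continuous_on ({0..1} \<times> UNIV) (\<lambda>(t, x). H t x)"
    and n: "\<And>t p. norm (H t p) = norm p" and G: "\<And>t p. H t (G t p) = p" "\<And>t p. G t (H t p) = p"
    and "\<And>p. H 0 p = p"
  shows "isotopic_to_identity (H (1::real))"
  unfolding isotopic_to_identity_def proper_isotopy_def
  by (intro exI[of _ H] conjI ballI allI refl H assms(5) bij_betw_byWitness[where f' = "G _"])
    (use G n in auto)

definition quarter_turn :: "real \<Rightarrow> plane \<Rightarrow> plane" where
  "quarter_turn t z = (cos (t * pi / 2) * fst z - sin (t * pi / 2) * snd z, sin (t * pi / 2) * fst z + cos (t * pi / 2) * snd z)"

lemma quarter_turn_norm: "(fst (quarter_turn t z))\<^sup>2 + (snd (quarter_turn t z))\<^sup>2 = (fst z)\<^sup>2 + (snd z)\<^sup>2"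
proof -
  have "(c * a - s * b)\<^sup>2 + (s * a + c * b)\<^sup>2 = (c\<^sup>2 + s\<^sup>2) * (a\<^sup>2 + b\<^sup>2)" for a b c s :: real
    by (simp add: power2_eq_square algebra_simps)
  then show ?thesis by (simp add: quarter_turn_def)
qed

lemma quarter_turn_minus: "quarter_turn t (quarter_turn (- t) z) = z"
proof -
  have "c * (c * a + s * b) - s * (c * b - s * a) = (c\<^sup>2 + s\<^sup>2) * a"
    "s * (c * a + s * b) + c * (c * b - s * a) = (c\<^sup>2 + s\<^sup>2) * b" for a b c s :: real
    by (simp_all add: power2_eq_square algebra_simps)
  then show ?thesis by (simp add: quarter_turn_def prod_eq_iff)
qed

lemma quarter_turn_ends: "quarter_turn 0 z = z" "quarter_turn 1 z = (- snd z, fst z)" "quarter_turn (- 1) z = (snd z, - fst z)"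
  by (simp_all add: quarter_turn_def)

lemma isotopic_to_identity_rotation_y: "isotopic_to_identity (\<lambda>p. ((- snd p, snd (fst p)), fst (fst p)))"
proof -
  define H :: "real \<Rightarrow> space \<Rightarrow> space" where
    "H t p = (let w = quarter_turn t (fst (fst p), snd p) in ((fst w, snd (fst p)), snd w))" for t p
  have "isotopic_to_identity (H 1)"
  proof (rule isotopic_to_identity_rotation[where G = "\<lambda>t p. H (- t) p"])
    show "continuous_on ({0..1} \<times> UNIV) (\<lambda>(t, x). H t x)"
      unfolding H_def Let_def quarter_turn_def case_prod_unfold by (intro continuous_intros) auto
    show "norm (H t p) = norm p" for t p
      using quarter_turn_norm[of t "(fst (fst p), snd p)"] by (simp add: H_def Let_def norm_prod_def)
    show "H t (H (- t) p) = p" "H (- t) (H t p) = p" "H 0 p = p" for t p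
      using quarter_turn_minus[of t] quarter_turn_minus[of "- t"] by (simp_all add: H_def Let_def quarter_turn_ends)
  qed
  moreover have "H 1 = (\<lambda>p. ((- snd p, snd (fst p)), fst (fst p)))"
    by (simp add: H_def Let_def quarter_turn_ends fun_eq_iff)
  ultimately show ?thesis by simp
qed

lemma isotopic_to_identity_rotation_x: "isotopic_to_identity (\<lambda>p. ((fst (fst p), snd p), - snd (fst p)))"
proof -
  define H :: "real \<Rightarrow> space \<Rightarrow> space" where
    "H t p = (let w = quarter_turn (- t) (snd (fst p), snd p) in ((fst (fst p), fst w), snd w))" for t p
  have "isotopic_to_identity (H 1)"
  proof (rule isotopic_to_identity_rotation[where G = "\<lambda>t p. H (- t) p"])
    show "continuous_on ({0..1} \<times> UNIV) (\<lambda>(t, x). H t x)"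
      unfolding H_def Let_def quarter_turn_def case_prod_unfold by (intro continuous_intros) auto
    show "norm (H t p) = norm p" for t p
      using quarter_turn_norm[of "- t" "(snd (fst p), snd p)"] by (simp add: H_def Let_def norm_prod_def)
    show "H t (H (- t) p) = p" "H (- t) (H t p) = p" "H 0 p = p" for t p
      using quarter_turn_minus[of t] quarter_turn_minus[of "- t"] by (simp_all add: H_def Let_def quarter_turn_ends)
  qed
  moreover have "H 1 = (\<lambda>p. ((fst (fst p), snd p), - snd (fst p)))"
    by (simp add: H_def Let_def quarter_turn_ends fun_eq_iff)
  ultimately show ?thesis by simp
qed

section \<open>Loops around circles\<close>

text \<open>The lift to the line of an embedding of the circle into itself: \<open>\<phi> (t + 1) -
\<phi> t\<close> is a constant integer. It does not vanish because \<open>\<phi>\<close> is injective on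
intervals of length less than 1, and it is not greater than 1 by the intermediate value theorem.\<close>

lemma degree_one_lift:
  fixes \<phi> :: "real \<Rightarrow> real"
  assumes cont: "continuous_on UNIV \<phi>" and int: "\<And>s t. \<phi> s - \<phi> t \<in> \<int> \<longleftrightarrow> s - t \<in> \<int>"
    and uw: "u < w" "\<phi> u < \<phi> w"
  shows "strict_mono \<phi>" "\<phi> (t + 1) = \<phi> t + 1"
proof -
  have "(\<lambda>t. \<phi> (t + 1) - \<phi> t) constant_on UNIV"
  proof (rule continuous_discrete_range_constant)
    show "continuous_on UNIV (\<lambda>t. \<phi> (t + 1) - \<phi> t)"
      by (intro continuous_intros cont continuous_on_compose2[OF cont]) auto
    fix t :: real
    show "\<exists>e>0. \<forall>s. s \<in> UNIV \<and> \<phi> (s + 1) - \<phi> s \<noteq> \<phi> (t + 1) - \<phi> t \<longrightarrow>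
        e \<le> norm (\<phi> (s + 1) - \<phi> s - (\<phi> (t + 1) - \<phi> t))"
    proof (intro exI[of _ 1] conjI allI impI)
      fix s assume s: "s \<in> UNIV \<and> \<phi> (s + 1) - \<phi> s \<noteq> \<phi> (t + 1) - \<phi> t"
      have "\<phi> (s + 1) - \<phi> s \<in> \<int>" "\<phi> (t + 1) - \<phi> t \<in> \<int>"
        using int[of "s + 1" s] int[of "t + 1" t] by simp_all
      then have "\<phi> (s + 1) - \<phi> s - (\<phi> (t + 1) - \<phi> t) \<in> \<int>" by (rule Ints_diff)
      then show "1 \<le> norm (\<phi> (s + 1) - \<phi> s - (\<phi> (t + 1) - \<phi> t))"
        using s Ints_nonzero_abs_ge1 by fastforce
    qed simp
  qed simp
  then obtain d where d': "\<And>t. \<phi> (t + 1) - \<phi> t = d" unfolding constant_on_def by blast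
  then have d: "\<phi> (t + 1) = \<phi> t + d" for t by (metis diff_add_cancel add.commute)
  have dnat: "\<phi> (t + real n) = \<phi> t + real n * d" for t n
  proof (induction n)
    case (Suc n)
    have "\<phi> (t + real (Suc n)) = \<phi> (t + real n + 1)" by (simp add: algebra_simps)
    also have "\<dots> = \<phi> t + real (Suc n) * d" unfolding d Suc by (simp add: algebra_simps)
    finally show ?case .
  qed simp
  \<comment> \<open>The intervals starting at 0 and at 1/2 overlap, so \<open>\<phi>\<close> is monotone in the same sense on both and
     cannot return to the same value at 1.\<close>
  have local: "strict_mono_on {a..a+3/4} \<phi> \<or> strict_antimono_on {a..a+3/4} \<phi>" for a
  proof (rule injective_eq_monotone_map[THEN iffD1])
    show "is_interval {a..a + 3/4}" by (rule is_interval_cc)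
    show "continuous_on {a..a + 3/4} \<phi>" using cont continuous_on_subset by blast
    show "inj_on \<phi> {a..a + 3/4}"
    proof (rule inj_onI)
      fix s t assume st: "s \<in> {a..a + 3/4}" "t \<in> {a..a + 3/4}" "\<phi> s = \<phi> t"
      then have "s - t \<in> \<int>" using int[of s t] by simp
      moreover have "\<bar>s - t\<bar> < 1" using st by auto
      ultimately show "s = t" using Ints_nonzero_abs_less1[of "s - t"] by simp
    qed
  qed
  have "d \<noteq> 0"
  proof
    assume "d = 0"
    then have eq: "\<phi> 1 = \<phi> 0" using d[of 0] by simp
    show False
      using local[of 0] local[of "1/2"]
    proof (elim disjE)
      assume a: "strict_mono_on {0..0 + 3/4} \<phi>" and b: "strict_mono_on {1/2..1/2 + 3/4} \<phi>"
      show False using strict_mono_onD[OF a, of 0 "1/2"] strict_mono_onD[OF b, of "1/2" 1] eq by auto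
    next
      assume a: "strict_mono_on {0..0 + 3/4} \<phi>" and b: "strict_antimono_on {1/2..1/2 + 3/4} \<phi>"
      show False using strict_mono_onD[OF a, of "1/2" "3/4"] monotone_onD[OF b, of "1/2" "3/4"] eq by auto
    next
      assume a: "strict_antimono_on {0..0 + 3/4} \<phi>" and b: "strict_mono_on {1/2..1/2 + 3/4} \<phi>"
      show False using monotone_onD[OF a, of "1/2" "3/4"] strict_mono_onD[OF b, of "1/2" "3/4"] eq by auto
    next
      assume a: "strict_antimono_on {0..0 + 3/4} \<phi>" and b: "strict_antimono_on {1/2..1/2 + 3/4} \<phi>"
      show False using monotone_onD[OF a, of 0 "1/2"] monotone_onD[OF b, of "1/2" 1] eq by auto
    qed
  qed
  have neq: "\<phi> s \<noteq> \<phi> t" if "s < t" for s t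
  proof
    assume eq: "\<phi> s = \<phi> t"
    then have "t - s \<in> \<int>" using int[of t s] by simp
    then obtain k where k: "t - s = of_int k" by (auto elim: Ints_cases)
    then have "t = s + real (nat k)" using that by simp
    then have "real (nat k) * d = 0" using dnat[of s "nat k"] eq by simp
    then show False using \<open>d \<noteq> 0\<close> k that by simp
  qed
  have "inj \<phi>" by (rule linorder_injI) (use neq in auto)
  then have "strict_mono_on UNIV \<phi> \<or> strict_antimono_on UNIV \<phi>"
    using injective_eq_monotone_map[OF is_interval_univ cont] by simp
  then show mono: "strict_mono \<phi>"
    using uw monotone_onD[of UNIV "(<)" "(>)" \<phi> u w] by fastforce
  have "d > 0" using d[of 0] strict_monoD[OF mono, of 0 1] by simp
  moreover have "d \<in> \<int>" using int[of 1 0] d[of 0] by simp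
  ultimately have "d \<ge> 1" using Ints_nonzero_abs_ge1[of d] by simp
  have "\<not> d > 1"
  proof
    assume "d > 1"
    have "\<exists>x\<ge>0. x \<le> 1 \<and> \<phi> x = \<phi> 0 + 1"
      by (rule IVT') (use d[of 0] \<open>d > 1\<close> cont continuous_on_subset in auto)
    then obtain x where x: "0 \<le> x" "x \<le> 1" "\<phi> x = \<phi> 0 + 1" by blast
    then have "x - 0 \<in> \<int>" using int[of x 0] by simp
    moreover have "x \<noteq> 0" "x \<noteq> 1" using x d[of 0] \<open>d > 1\<close> by auto
    ultimately show False using x Ints_nonzero_abs_less1[of x] by auto
  qed
  then show "\<phi> (t + 1) = \<phi> t + 1" using d \<open>d \<ge> 1\<close> by simp
qed

lemma strict_mono_degree_one_inverse:
  fixes \<phi> :: "real \<Rightarrow> real"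
  assumes cont: "continuous_on UNIV \<phi>" and mono: "strict_mono \<phi>" and deg: "\<And>t. \<phi> (t + 1) = \<phi> t + 1"
  shows "surj \<phi>" "continuous_on UNIV (inv \<phi>)" "strict_mono (inv \<phi>)" "inv \<phi> (t + 1) = inv \<phi> t + 1"
proof -
  have degn: "\<phi> (t + of_int k) = \<phi> t + of_int k" for t k
  proof (induction k rule: int_induct[of _ 0])
    case (step1 i) then show ?case using deg[of "t + of_int i"] by (simp add: algebra_simps)
  next
    case (step2 i) then show ?case using deg[of "t + of_int (i - 1)"] by (simp add: algebra_simps)
  qed simp
  show surj: "surj \<phi>"
    unfolding surj_def
  proof
    fix y
    define k where "k = \<lfloor>y - \<phi> 0\<rfloor>"
    have "of_int k \<le> y - \<phi> 0" "y - \<phi> 0 < of_int k + 1" unfolding k_def by linarith+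
    then have "\<exists>x\<ge>of_int k. x \<le> of_int (k + 1) \<and> \<phi> x = y"
      using degn[of 0 k] degn[of 0 "k + 1"] by (intro IVT' continuous_on_subset[OF cont]) auto
    then show "\<exists>x. y = \<phi> x" by blast
  qed
  have inv: "\<phi> (inv \<phi> y) = y" for y using surj by (rule surj_f_inv_f)
  show smono: "strict_mono (inv \<phi>)"
    by (rule strict_monoI) (metis inv mono strict_mono_less)
  show "continuous_on UNIV (inv \<phi>)"
  proof (rule continuous_onI_mono)
    have "range (inv \<phi>) = UNIV" using mono by (metis inj_imp_surj_inv strict_mono_imp_inj_on)
    then show "open (range (inv \<phi>))" by simp
  qed (use smono in \<open>simp add: strict_mono_less_eq\<close>)
  show "inv \<phi> (t + 1) = inv \<phi> t + 1"
    by (metis inv deg mono strict_mono_eq)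
qed

lemma cis_2pi_eq_iff: "cis (2 * pi * a) = cis (2 * pi * b) \<longleftrightarrow> a - b \<in> \<int>"
proof -
  have "cis (2 * pi * a) = cis (2 * pi * b) \<longleftrightarrow> cis (2 * pi * (a - b)) = 1"
    by (simp add: right_diff_distrib flip: cis_divide)
  also have "\<dots> \<longleftrightarrow> a - b \<in> \<int>"
  proof
    assume "cis (2 * pi * (a - b)) = 1"
    then have "cos (2 * pi * (a - b)) = 1" by (simp add: complex_eq_iff)
    then obtain n :: int where "2 * pi * (a - b) = n * 2 * pi" unfolding cos_one_2pi_int by auto
    then have "a - b = of_int n" by simp
    then show "a - b \<in> \<int>" by simp
  next
    assume "a - b \<in> \<int>"
    then show "cis (2 * pi * (a - b)) = 1" by (rule cis_multiple_2pi)
  qed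
  finally show ?thesis .
qed

text \<open>A simple loop on the unit circle is a reparametrisation of the circle, up to its direction.
The direction is decided by one arc: the upper half circle is traced starting from 1.\<close>

lemma counterclockwise_circle_loop:
  fixes g :: "real \<Rightarrow> complex"
  assumes cont: "continuous_on UNIV g" and one: "\<And>t. norm (g t) = 1"
    and simple: "\<And>s t. g s = g t \<longleftrightarrow> s - t \<in> \<int>"
    and arc: "u \<le> v" "g u = 1" "g ` {u..v} = {z. norm z = 1 \<and> Im z \<ge> 0}"
  shows "\<exists>\<phi>. continuous_on UNIV \<phi> \<and> strict_mono \<phi> \<and> (\<forall>t. \<phi> (t + 1) = \<phi> t + 1) \<and> (\<forall>t. cis (2 * pi * t) = g (\<phi> t))"
proof -
  obtain h where h: "continuous_on UNIV h" "\<And>t. g t = exp (h t)"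
    using continuous_logarithm_on_contractible[OF cont contractible_UNIV] one
    by (metis norm_zero zero_neq_one UNIV_I)
  have Re: "Re (h t) = 0" for t using one[of t] by (simp add: h)
  define \<phi> where "\<phi> t = Im (h t) / (2 * pi)" for t
  have g\<phi>: "g t = cis (2 * pi * \<phi> t)" for t
    using Re[of t] by (simp add: h(2) \<phi>_def exp_eq_polar)
  have c\<phi>: "continuous_on UNIV \<phi>" unfolding \<phi>_def by (intro continuous_intros h) auto
  have int: "\<phi> s - \<phi> t \<in> \<int> \<longleftrightarrow> s - t \<in> \<int>" for s t
    using simple[of s t] unfolding g\<phi> cis_2pi_eq_iff .
  have "cis (2 * pi * \<phi> u) = cis (2 * pi * 0)" using arc(2) by (simp add: g\<phi>)
  then have "\<phi> u \<in> \<int>" unfolding cis_2pi_eq_iff by simp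
  then obtain n where n: "\<phi> u = of_int n" by (auto elim: Ints_cases)
  have "- 1 \<in> g ` {u..v}" unfolding arc(3) by simp
  then obtain w where w: "u \<le> w" "w \<le> v" "g w = -1" by auto
  have uw: "u < w"
    using w arc(2) by (metis less_eq_real_def one_neq_neg_one)
  \<comment> \<open>Otherwise the lift passes through \<open>n - 1/4\<close>, where the loop is at the bottom of the circle.\<close>
  have "\<not> \<phi> w < \<phi> u"
  proof
    assume lt: "\<phi> w < \<phi> u"
    have "cis (2 * pi * \<phi> w) = cis (2 * pi * (1/2))" using w(3) by (simp add: g\<phi>)
    then have "\<phi> w - 1/2 \<in> \<int>" unfolding cis_2pi_eq_iff .
    then obtain m where m: "\<phi> w = of_int m + 1/2" by (auto elim!: Ints_cases simp: algebra_simps)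
    have "of_int m + 1/2 < (of_int n :: real)" using lt m n by simp
    then have "m < n" by linarith
    then have "m + 1 \<le> n" by simp
    then have "(of_int (m + 1) :: real) \<le> of_int n" unfolding of_int_le_iff .
    then have "\<phi> w \<le> of_int n - 1/4" using m by simp
    then have "\<exists>x\<ge>u. x \<le> w \<and> \<phi> x = of_int n - 1/4"
      using n uw by (intro IVT2' continuous_on_subset[OF c\<phi>]) auto
    then obtain x where x: "u \<le> x" "x \<le> w" "\<phi> x = of_int n - 1/4" by blast
    have "cis (2 * pi * \<phi> x) = cis (2 * pi * (- 1/4))"
      unfolding cis_2pi_eq_iff x(3) by simp
    then have "Im (g x) = sin (2 * pi * (- 1 / 4))" by (simp add: g\<phi>)
    also have "2 * pi * (- 1 / 4) = - (pi / 2)" by simp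
    finally have "Im (g x) = - 1" by simp
    moreover have "g x \<in> {z. norm z = 1 \<and> Im z \<ge> 0}" unfolding arc(3)[symmetric] using x w by auto
    ultimately show False by simp
  qed
  moreover have "\<phi> u \<noteq> \<phi> w" using arc(2) w(3) g\<phi> by (metis one_neq_neg_one)
  ultimately have lt: "\<phi> u < \<phi> w" by simp
  note lift = degree_one_lift[OF c\<phi> int uw lt]
  note inv = strict_mono_degree_one_inverse[OF c\<phi> lift]
  show ?thesis
  proof (intro exI[of _ "inv \<phi>"] conjI allI)
    show "cis (2 * pi * t) = g (inv \<phi> t)" for t
      unfolding g\<phi> surj_f_inv_f[OF inv(1)] ..
  qed (use inv in auto)
qed

lemma unlink_circle_eq: "unlink_circle k t = (of_C (of_real (3 * real k) + cis (2 * pi * t)), 0)"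
  by (simp add: unlink_circle_def of_C_def)

definition half_circle :: "nat \<Rightarrow> space set" where
  "half_circle k = (\<lambda>z. (of_C (of_real (3 * real k) + z), 0)) ` {z. norm z = 1 \<and> Im z \<ge> 0}"

lemma range_unlink_circle:
  "range (unlink_circle k) = {(of_C (of_real (3 * real k) + z), 0) | z. norm z = 1}"
proof -
  have "\<exists>t. cis (2 * pi * t) = z" if "norm z = 1" for z
  proof -
    have "cis (2 * pi * (Arg z / (2 * pi))) = z" using that rcis_cmod_Arg[of z] by (simp add: rcis_def)
    then show ?thesis by blast
  qed
  then show ?thesis unfolding unlink_circle_eq
    by (fastforce simp: image_iff)
qed

text \<open>Each loop runs on one circle because its abscissa cannot skip the gaps between the circles,
and each circle belongs to exactly one loop because different loops are disjoint.\<close>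

lemma unlink_of_circles:
  assumes link: "oriented_link L" and iso: "isotopic L ((\<lambda>\<gamma>. to_S3 \<circ> \<gamma>) ` C)" and C: "disjoint_loops C"
    and \<Phi>: "isotopic_to_identity \<Phi>" and r: "r \<ge> 1"
    and sub: "\<And>\<gamma> t. \<gamma> \<in> C \<Longrightarrow> \<exists>k<r. \<Phi> (\<gamma> t) \<in> range (unlink_circle k)"
    and arcs: "\<And>k. k < r \<Longrightarrow> \<exists>\<gamma>\<in>C. \<exists>u v. u \<le> v \<and> \<Phi> (\<gamma> u) = unlink_circle k 0 \<and> (\<Phi> \<circ> \<gamma>) ` {u..v} = half_circle k"
  shows "unlink L"
proof -
  have sl: "simple_loop \<gamma>" if "\<gamma> \<in> C" for \<gamma> using C that by (simp add: disjoint_loops_def)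
  have Ccont: "continuous_on UNIV (\<lambda>t. \<Phi> (\<gamma> t))" if "\<gamma> \<in> C" for \<gamma>
    using sl[OF that] continuous_on_compose2[OF isotopic_to_identity_continuous[OF \<Phi>, of UNIV]] 
    by (auto simp: simple_loop_def)
  have inj: "\<Phi> (\<gamma> s) = \<Phi> (\<gamma> t) \<longleftrightarrow> s - t \<in> \<int>" if "\<gamma> \<in> C" for \<gamma> s t
    using isotopic_to_identity_bij[OF \<Phi>] sl[OF that] by (simp add: simple_loop_def bij_is_inj[THEN inj_eq])
  have x_range: "\<bar>fst (fst p) - 3 * real k\<bar> \<le> 1" if "p \<in> range (unlink_circle k)" for p k
    using that by (auto simp: unlink_circle_def)
  have one_circle: "range (\<Phi> \<circ> \<gamma>) \<subseteq> range (unlink_circle k)"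
    if \<gamma>: "\<gamma> \<in> C" and t: "\<Phi> (\<gamma> t) \<in> range (unlink_circle k)" for \<gamma> k t
  proof -
    have no_gap: False if a: "\<Phi> (\<gamma> a) \<in> range (unlink_circle i)" and b: "\<Phi> (\<gamma> b) \<in> range (unlink_circle j)"
      and ij: "i < j" for a b i j
    proof -
      let ?f = "\<lambda>t. fst (fst (\<Phi> (\<gamma> t)))"
      have cf: "continuous_on UNIV ?f" by (intro continuous_intros Ccont \<gamma>)
      have con: "connected (range ?f)" by (rule connected_continuous_image[OF cf]) simp
      have le: "?f a \<le> 3 * real i + 3/2" using x_range[OF a] by simp
      have ge: "3 * real i + 3/2 \<le> ?f b" using x_range[OF b] ij by simp
      have "3 * real i + 3/2 \<in> range ?f"
        using connectedD_interval[OF con rangeI[of ?f a] rangeI[of ?f b] le ge] .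
      then obtain t' where t': "3 * real i + 3/2 = ?f t'" by (rule rangeE)
      obtain l where "\<Phi> (\<gamma> t') \<in> range (unlink_circle l)" using sub[OF \<gamma>] by blast
      then have "\<bar>3 * real i + 3/2 - 3 * real l\<bar> \<le> 1" unfolding t' by (rule x_range)
      then have "6 * real i + 3 - 6 * real l \<le> 2" "- 2 \<le> 6 * real i + 3 - 6 * real l"
        by (simp_all add: abs_le_iff)
      then have "real_of_int (6 * int i + 3 - 6 * int l) \<le> real_of_int 2"
        "real_of_int (- 2) \<le> real_of_int (6 * int i + 3 - 6 * int l)" by simp_all
      then have "6 * int i + 3 - 6 * int l \<le> 2" "- 2 \<le> 6 * int i + 3 - 6 * int l"
        unfolding of_int_le_iff by simp_all
      then show False by presburger
    qed
    show ?thesis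
    proof
      fix p assume "p \<in> range (\<Phi> \<circ> \<gamma>)"
      then obtain t' where t': "p = \<Phi> (\<gamma> t')" by auto
      then obtain l where l: "p \<in> range (unlink_circle l)" using sub[OF \<gamma>] by blast
      have "l = k" using no_gap[of t k t' l] no_gap[of t' l t k] t l t' by (metis linorder_neqE_nat)
      then show "p \<in> range (unlink_circle k)" using l by simp
    qed
  qed
  have loop: "\<exists>\<gamma>\<in>C. reparametrisation (\<Phi> \<circ> \<gamma>) (unlink_circle k)" if k: "k < r" for k
  proof -
    obtain \<gamma> u v where \<gamma>: "\<gamma> \<in> C" "u \<le> v" "\<Phi> (\<gamma> u) = unlink_circle k 0" "(\<Phi> \<circ> \<gamma>) ` {u..v} = half_circle k"
      using arcs[OF k] by blast
    define g where "g t = to_C (fst (\<Phi> (\<gamma> t))) - of_real (3 * real k)" for t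
    have on: "\<Phi> (\<gamma> t) \<in> range (unlink_circle k)" for t
    proof -
      have "\<Phi> (\<gamma> u) \<in> range (unlink_circle k)" using \<gamma>(3) by (metis rangeI)
      from one_circle[OF \<gamma>(1) this] show ?thesis by auto
    qed
    have recentre: "\<Phi> (\<gamma> t) = (of_C (of_real (3 * real k) + g t), 0)" and n: "norm (g t) = 1" for t
      using on[of t] unfolding range_unlink_circle by (auto simp: g_def)
    have "\<exists>\<phi>. continuous_on UNIV \<phi> \<and> strict_mono \<phi> \<and> (\<forall>t. \<phi> (t + 1) = \<phi> t + 1) \<and> (\<forall>t. cis (2 * pi * t) = g (\<phi> t))"
    proof (rule counterclockwise_circle_loop)
      show "continuous_on UNIV g" unfolding g_def by (intro continuous_intros Ccont \<gamma>)
      have "g s = g t \<longleftrightarrow> \<Phi> (\<gamma> s) = \<Phi> (\<gamma> t)" for s t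
      proof
        assume "g s = g t"
        then show "\<Phi> (\<gamma> s) = \<Phi> (\<gamma> t)" by (simp only: recentre)
      qed (simp add: g_def)
      then show "g s = g t \<longleftrightarrow> s - t \<in> \<int>" for s t using inj[OF \<gamma>(1)] by simp
      show "g u = 1" unfolding g_def \<gamma>(3) by (simp add: unlink_circle_eq)
      have "g ` {u..v} = (\<lambda>p. to_C (fst p) - of_real (3 * real k)) ` ((\<Phi> \<circ> \<gamma>) ` {u..v})"
        by (simp add: image_image g_def)
      also have "\<dots> = {z. norm z = 1 \<and> Im z \<ge> 0}"
        unfolding \<gamma>(4) half_circle_def by (simp add: image_image)
      finally show "g ` {u..v} = {z. norm z = 1 \<and> Im z \<ge> 0}" .
    qed (use n \<gamma> in auto)
    then obtain \<phi> where "continuous_on UNIV \<phi>" "strict_mono \<phi>" "\<And>t. \<phi> (t + 1) = \<phi> t + 1"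
      and \<phi>: "\<And>t. cis (2 * pi * t) = g (\<phi> t)" by blast
    moreover have "unlink_circle k = (\<Phi> \<circ> \<gamma>) \<circ> \<phi>"
      by (simp add: fun_eq_iff unlink_circle_eq \<phi> recentre)
    ultimately have "reparametrisation (\<Phi> \<circ> \<gamma>) (unlink_circle k)" unfolding reparametrisation_def by blast
    then show ?thesis using \<gamma>(1) by blast
  qed
  have rep: "\<exists>k<r. reparametrisation (\<Phi> \<circ> \<gamma>) (unlink_circle k)" if \<gamma>: "\<gamma> \<in> C" for \<gamma>
  proof -
    obtain k where k: "k < r" "\<Phi> (\<gamma> 0) \<in> range (unlink_circle k)" using sub[OF \<gamma>] by blast
    obtain \<delta> where \<delta>: "\<delta> \<in> C" "reparametrisation (\<Phi> \<circ> \<delta>) (unlink_circle k)" using loop[OF k(1)] by blast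
    then obtain \<phi> where "unlink_circle k = (\<Phi> \<circ> \<delta>) \<circ> \<phi>" unfolding reparametrisation_def by blast
    then obtain t where "\<Phi> (\<gamma> 0) = \<Phi> (\<delta> t)" using k(2) by (auto simp: image_iff)
    then have "\<gamma> 0 = \<delta> t" using isotopic_to_identity_bij[OF \<Phi>] by (simp add: bij_is_inj[THEN inj_eq])
    then have "\<gamma> = \<delta>" using C \<gamma> \<delta>(1) unfolding disjoint_loops_def disjoint_family_on_def
      by (metis IntI empty_iff rangeI)
    then show ?thesis using \<delta> k by blast
  qed
  define M where "M = (\<lambda>\<gamma>. to_S3 \<circ> (\<Phi> \<circ> \<gamma>)) ` C"
  define U where "U = (\<lambda>k. to_S3 \<circ> unlink_circle k) ` {..<r}"
  have "same_oriented M U"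
    unfolding same_oriented_def M_def U_def
  proof (intro conjI ballI)
    fix \<gamma>' assume "\<gamma>' \<in> (\<lambda>\<gamma>. to_S3 \<circ> (\<Phi> \<circ> \<gamma>)) ` C"
    then obtain \<gamma> where \<gamma>: "\<gamma> \<in> C" "\<gamma>' = to_S3 \<circ> (\<Phi> \<circ> \<gamma>)" by blast
    obtain k where "k < r" "reparametrisation (\<Phi> \<circ> \<gamma>) (unlink_circle k)" using rep[OF \<gamma>(1)] by blast
    then show "\<exists>\<delta>\<in>(\<lambda>k. to_S3 \<circ> unlink_circle k) ` {..<r}. reparametrisation \<gamma>' \<delta>"
      unfolding \<gamma>(2) using reparametrisation_comp by blast
  next
    fix \<delta> assume "\<delta> \<in> (\<lambda>k. to_S3 \<circ> unlink_circle k) ` {..<r}"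
    then obtain k where k: "k < r" "\<delta> = to_S3 \<circ> unlink_circle k" by blast
    obtain \<gamma> where "\<gamma> \<in> C" "reparametrisation (\<Phi> \<circ> \<gamma>) (unlink_circle k)" using loop[OF k(1)] by blast
    then show "\<exists>\<gamma>\<in>(\<lambda>\<gamma>. to_S3 \<circ> (\<Phi> \<circ> \<gamma>)) ` C. reparametrisation \<gamma> \<delta>"
      unfolding k(2) using reparametrisation_comp by blast
  qed
  then have "isotopic M U"
    using isotopic_refl[of M] same_oriented_trans unfolding isotopic_def by blast
  then have "isotopic L U"
    using iso isotopic_of_isotopic_to_identity[OF \<Phi>, of C] isotopic_trans unfolding M_def by blast
  then show ?thesis using link r unfolding unlink_def U_def by blast
qed

section \<open>Parametrisation of polygonal links\<close>

definition polyline :: "(int \<Rightarrow> 'a::real_normed_vector) \<Rightarrow> real \<Rightarrow> 'a" where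
  "polyline c t = (1 - frac t) *\<^sub>R c \<lfloor>t\<rfloor> + frac t *\<^sub>R c (\<lfloor>t\<rfloor> + 1)"

lemma polyline_between:
  assumes "of_int j \<le> t" "t \<le> of_int j + 1"
  shows "polyline c t = (1 - (t - of_int j)) *\<^sub>R c j + (t - of_int j) *\<^sub>R c (j + 1)"
proof (cases "t = of_int j + 1")
  case True
  then have "\<lfloor>t\<rfloor> = j + 1" by simp
  then show ?thesis using True by (simp add: polyline_def frac_def)
next
  case False
  then have "\<lfloor>t\<rfloor> = j" using assms by (intro floor_unique) auto
  then show ?thesis by (simp add: polyline_def frac_def)
qed

lemma polyline_of_int [simp]: "polyline c (of_int j) = c j"
  by (simp add: polyline_def)

lemma continuous_on_polyline: "continuous_on A (polyline c)"
proof -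
  have seg: "continuous_on {of_int j..of_int j + 1} (polyline c)" for j
    by (rule continuous_on_eq[where f = "\<lambda>t. (1 - (t - of_int j)) *\<^sub>R c j + (t - of_int j) *\<^sub>R c (j + 1)"])
      (auto intro!: continuous_intros simp: polyline_between)
  have "isCont (polyline c) t" for t
  proof -
    define j where "j = \<lfloor>t\<rfloor>"
    have j: "of_int j \<le> t" "t < of_int j + 1" unfolding j_def by linarith+
    have "continuous_on ({of_int (j - 1)..of_int (j - 1) + 1} \<union> {of_int j..of_int j + 1}) (polyline c)"
      by (intro continuous_on_closed_Un seg) auto
    moreover have "{of_int (j - 1)..of_int (j - 1) + 1} \<union> {of_int j..of_int j + 1} = {of_int j - 1..of_int j + (1::real)}"
      by auto
    ultimately have "continuous_on {of_int j - 1..of_int j + 1} (polyline c)" by simp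
    then show ?thesis by (rule continuous_on_interior) (use j in simp)
  qed
  then show ?thesis by (simp add: continuous_at_imp_continuous_on)
qed

lemma polyline_image_segment: "polyline c ` {of_int j..of_int j + 1} = closed_segment (c j) (c (j + 1))"
proof -
  have "polyline c ` {of_int j..of_int j + 1} = (\<lambda>u. (1 - u) *\<^sub>R c j + u *\<^sub>R c (j + 1)) ` ((\<lambda>t. t - of_int j) ` {of_int j..of_int j + 1})"
    unfolding image_image by (rule image_cong) (auto simp: polyline_between)
  also have "(\<lambda>t::real. t - of_int j) ` {of_int j..of_int j + 1} = {0..1}"
    by (rule bij_betw_imp_surj_on, rule bij_betw_byWitness[where f' = "\<lambda>u. u + of_int j"]) auto
  finally show ?thesis by (simp add: closed_segment_image_interval)
qed

lemma bij_betw_cycle: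
  assumes fin: "finite V" and bij: "bij_betw f V V" and P: "P \<in> V"
  obtains m where "m > 0" "(f ^^ m) P = P" "inj_on (\<lambda>i. (f ^^ i) P) {..<m}"
proof -
  have V: "(f ^^ i) x \<in> V" if "x \<in> V" for i x
    by (induction i) (use that bij_betwE[OF bij] in auto)
  have cancel: "(f ^^ (j - i)) P = P" if "i \<le> j" "(f ^^ i) P = (f ^^ j) P" for i j
    using that
  proof (induction i arbitrary: j)
    case (Suc i)
    obtain j' where j': "j = Suc j'" using Suc.prems(1) by (cases j) auto
    have "(f ^^ i) P = (f ^^ j') P"
      using Suc.prems(2) inj_onD[OF bij_betw_imp_inj_on[OF bij]] V[OF P] unfolding j' by simp
    then show ?case using Suc.IH[of j'] Suc.prems(1) j' by simp
  qed simp
  have "range (\<lambda>i. (f ^^ i) P) \<subseteq> V" using V[OF P] by auto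
  then have "finite (range (\<lambda>i. (f ^^ i) P))" using fin by (rule finite_subset)
  then have "\<not> inj_on (\<lambda>i. (f ^^ i) P) (UNIV :: nat set)"
    using finite_imageD[of "\<lambda>i. (f ^^ i) P" UNIV] infinite_UNIV_nat by blast
  then obtain i j where ij: "i < j" "(f ^^ i) P = (f ^^ j) P"
    unfolding inj_on_def by (metis linorder_neqE_nat)
  then have ex: "\<exists>m. 0 < m \<and> (f ^^ m) P = P" using cancel[of i j] by (intro exI[of _ "j - i"]) auto
  define m where "m = (LEAST m. 0 < m \<and> (f ^^ m) P = P)"
  have m: "0 < m" "(f ^^ m) P = P" using LeastI_ex[OF ex] unfolding m_def by auto
  have "inj_on (\<lambda>i. (f ^^ i) P) {..<m}"
  proof (rule linorder_inj_onI)
    fix i j assume ij: "i < j" "i \<in> {..<m}" "j \<in> {..<m}"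
    show "(f ^^ i) P \<noteq> (f ^^ j) P"
    proof
      assume "(f ^^ i) P = (f ^^ j) P"
      then have "0 < j - i \<and> (f ^^ (j - i)) P = P" using cancel[of i j] ij by auto
      then have "m \<le> j - i" unfolding m_def by (rule Least_le)
      then show False using ij by auto
    qed
  qed auto
  then show thesis using that m by blast
qed

text \<open>The successor map permutes the vertices. Each of its cycles is traced by a piecewise linear
loop at constant speed per edge, and one vertex is chosen from each cycle.\<close>

lemma polygonal_link_parametrisable:
  assumes E: "polygonal_link E"
  shows "\<exists>C. parametrises C E"
proof -
  define V where "V = fst ` E"
  have E1: "finite E" "E \<noteq> {}" "inj_on fst E" "inj_on snd E" "snd ` E = V"
    and neq: "\<And>p q. (p, q) \<in> E \<Longrightarrow> p \<noteq> q"
    and meet: "\<And>p q p' q'. (p, q) \<in> E \<Longrightarrow> (p', q') \<in> E \<Longrightarrow> (p, q) \<noteq> (p', q') \<Longrightarrow>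
        closed_segment p q \<inter> closed_segment p' q' \<subseteq> {p, q} \<inter> {p', q'}"
    using E unfolding polygonal_link_def V_def by blast+
  define nxt where "nxt P = snd (inv_into E fst P)" for P
  have nxt: "(P, nxt P) \<in> E" if "P \<in> V" for P
    using that unfolding V_def nxt_def by (metis f_inv_into_f inv_into_into prod.collapse)
  have nxt_eq: "nxt p = q" if "(p, q) \<in> E" for p q
    using that E1(3) unfolding nxt_def by (metis fst_conv inv_into_f_f snd_conv)
  have EV: "p \<in> V" "q \<in> V" if "(p, q) \<in> E" for p q
    using that E1(5) unfolding V_def by force+
  have finV: "finite V" unfolding V_def using E1(1) by simp
  have bij: "bij_betw nxt V V"
    unfolding bij_betw_def
  proof
    show "inj_on nxt V"
    proof (rule inj_onI)
      fix P Q assume "P \<in> V" "Q \<in> V" "nxt P = nxt Q"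
      then show "P = Q" using nxt E1(4) by (metis fst_conv inj_on_eq_iff snd_conv)
    qed
    show "nxt ` V = V"
    proof
      show "nxt ` V \<subseteq> V" using nxt EV by blast
      show "V \<subseteq> nxt ` V"
      proof
        fix q assume "q \<in> V"
        then obtain p where "(p, q) \<in> E" unfolding E1(5)[symmetric] by auto
        then show "q \<in> nxt ` V" using nxt_eq EV by blast
      qed
    qed
  qed
  have "\<exists>m>0. (nxt ^^ m) P = P \<and> inj_on (\<lambda>i. (nxt ^^ i) P) {..<m}" if "P \<in> V" for P
    using bij_betw_cycle[OF finV bij that] by blast
  then obtain m where m: "\<And>P. P \<in> V \<Longrightarrow> m P > (0::nat)" "\<And>P. P \<in> V \<Longrightarrow> (nxt ^^ m P) P = P"
    "\<And>P. P \<in> V \<Longrightarrow> inj_on (\<lambda>i. (nxt ^^ i) P) {..<m P}" by metis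
  have iterV: "(nxt ^^ i) P \<in> V" if "P \<in> V" for i P
    by (induction i) (use that bij_betwE[OF bij] in auto)
  define c where "c P j = (nxt ^^ (nat (j mod int (m P)))) P" for P j
  have cV: "c P j \<in> V" if "P \<in> V" for P j unfolding c_def using iterV[OF that] .
  have c_nat: "c P (int i) = (nxt ^^ i) P" if "P \<in> V" for P i
  proof -
    have "nat (int i mod int (m P)) = i mod m P" by (metis nat_int of_nat_mod)
    then show ?thesis unfolding c_def using funpow_mod_eq[OF m(2)[OF that]] by simp
  qed
  have c_mod: "c P (j mod int (m P)) = c P j" for P j by (simp add: c_def)
  have c_Suc: "c P (j + 1) = nxt (c P j)" if P: "P \<in> V" for P j
  proof -
    define i where "i = nat (j mod int (m P))"
    have i: "j mod int (m P) = int i" using m(1)[OF P] by (simp add: i_def)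
    have "c P (j + 1) = c P ((j mod int (m P) + 1) mod int (m P))" by (simp add: c_mod mod_add_left_eq)
    also have "\<dots> = c P (int (Suc i))" unfolding c_mod i by (simp add: algebra_simps)
    also have "\<dots> = nxt (c P (int i))" unfolding c_nat[OF P] by simp
    also have "c P (int i) = c P j" using c_mod[of P j] unfolding i .
    finally show ?thesis .
  qed
  have c_inj: "i mod int (m P) = j mod int (m P)" if P: "P \<in> V" and eq: "c P i = c P j" for P i j
  proof -
    have "nat (i mod int (m P)) = nat (j mod int (m P))"
      by (rule inj_onD[OF m(3)[OF P]]) (use m(1)[OF P] eq in \<open>auto simp: nat_less_iff c_def\<close>)
    then show ?thesis using m(1)[OF P] by (metis eq_nat_nat_iff of_nat_0_less_iff pos_mod_sign)
  qed
  define pt where "pt P u = (1 - u) *\<^sub>R P + u *\<^sub>R nxt P" for P and u :: real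
  have pt_seg: "pt P u \<in> closed_segment P (nxt P)" if "0 \<le> u" "u < 1" for P u
    using that unfolding pt_def closed_segment_def by auto
  have pt_ends: "pt P u = P \<longleftrightarrow> u = 0" "pt P u = nxt P \<longleftrightarrow> u = 1" if "P \<in> V" for P u
  proof -
    have "pt P u - P = u *\<^sub>R (nxt P - P)" "pt P u - nxt P = (u - 1) *\<^sub>R (nxt P - P)"
      by (simp_all add: pt_def algebra_simps)
    then show "pt P u = P \<longleftrightarrow> u = 0" "pt P u = nxt P \<longleftrightarrow> u = 1"
      using neq[OF nxt[OF that]] eq_iff_diff_eq_0[of "pt P u" P] eq_iff_diff_eq_0[of "pt P u" "nxt P"] by auto
  qed
  have pt_inj: "P = Q \<and> u = v"
    if P: "P \<in> V" "Q \<in> V" and uv: "0 \<le> u" "u < 1" "0 \<le> v" "v < 1" and eq: "pt P u = pt Q v" for P Q u v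
  proof (cases "P = Q")
    case True
    have "(u - v) *\<^sub>R (nxt P - P) = pt P u - pt P v" by (simp add: pt_def algebra_simps)
    then have "(u - v) *\<^sub>R (nxt P - P) = 0" using eq True by simp
    then show ?thesis using True neq[OF nxt[OF P(1)]] by simp
  next
    case False
    have "pt P u \<in> {P, nxt P} \<inter> {Q, nxt Q}"
      using meet[OF nxt[OF P(1)] nxt[OF P(2)]] pt_seg[of u P] pt_seg[of v Q] uv eq False by auto
    then have "pt P u = P" "pt Q v = Q" using pt_ends(2)[OF P(1), of u] pt_ends(2)[OF P(2), of v] uv eq by auto
    then show ?thesis using eq False by simp
  qed
  define \<gamma> where "\<gamma> P t = polyline (c P) (real (m P) * t)" for P t
  have \<gamma>_pt: "\<gamma> P t = pt (c P \<lfloor>real (m P) * t\<rfloor>) (frac (real (m P) * t))" if "P \<in> V" for P t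
    unfolding \<gamma>_def polyline_def pt_def c_Suc[OF that] ..
  have cont: "continuous_on UNIV (\<gamma> P)" for P
    unfolding \<gamma>_def by (intro continuous_on_compose2[OF continuous_on_polyline[of UNIV]] continuous_intros) auto
  have simple: "\<gamma> P s = \<gamma> P t \<longleftrightarrow> s - t \<in> \<int>" if P: "P \<in> V" for P s t
  proof
    have mP: "real (m P) > 0" using m(1)[OF P] by simp
    assume "\<gamma> P s = \<gamma> P t"
    then have *: "c P \<lfloor>real (m P) * s\<rfloor> = c P \<lfloor>real (m P) * t\<rfloor> \<and> frac (real (m P) * s) = frac (real (m P) * t)"
      unfolding \<gamma>_pt[OF P] by (intro pt_inj cV[OF P]) (auto simp: frac_lt_1)
    then have "\<lfloor>real (m P) * s\<rfloor> mod int (m P) = \<lfloor>real (m P) * t\<rfloor> mod int (m P)" using c_inj[OF P] by blast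
    then have "int (m P) dvd \<lfloor>real (m P) * s\<rfloor> - \<lfloor>real (m P) * t\<rfloor>" by (simp add: mod_eq_dvd_iff)
    then obtain k where k: "\<lfloor>real (m P) * s\<rfloor> - \<lfloor>real (m P) * t\<rfloor> = int (m P) * k" by blast
    have "real (m P) * (s - t) = of_int (\<lfloor>real (m P) * s\<rfloor> - \<lfloor>real (m P) * t\<rfloor>)"
      using * by (simp add: frac_def algebra_simps)
    also have "\<dots> = real (m P) * of_int k" unfolding k by simp
    finally have "s - t = of_int k" using mP by simp
    then show "s - t \<in> \<int>" by simp
  next
    assume "s - t \<in> \<int>"
    then obtain k where "s - t = of_int k" by (auto elim: Ints_cases)
    then have "real (m P) * s = real (m P) * t + of_int (int (m P) * k)" by (simp add: algebra_simps)
    then have "\<lfloor>real (m P) * s\<rfloor> = \<lfloor>real (m P) * t\<rfloor> + int (m P) * k" "frac (real (m P) * s) = frac (real (m P) * t)"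
      by (simp_all only: floor_add_int frac_def of_int_add) auto
    then show "\<gamma> P s = \<gamma> P t"
      unfolding \<gamma>_pt[OF P] using c_mod[of P "\<lfloor>real (m P) * s\<rfloor>"] c_mod[of P "\<lfloor>real (m P) * t\<rfloor>"] by simp
  qed
  define orb where "orb P = range (\<lambda>i. (nxt ^^ i) P)" for P
  have orb_step: "orb ((nxt ^^ i) P) = orb P" if P: "P \<in> V" for P i
  proof -
    have sub: "orb ((nxt ^^ i) P) \<subseteq> orb P" for P i
    proof
      fix x assume "x \<in> orb ((nxt ^^ i) P)"
      then obtain j where "x = (nxt ^^ j) ((nxt ^^ i) P)" unfolding orb_def by blast
      then have "x = (nxt ^^ (j + i)) P" by (simp add: funpow_add)
      then show "x \<in> orb P" unfolding orb_def by blast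
    qed
    have "P = (nxt ^^ (m P * i - i + i)) P"
      using m(1,2)[OF P] funpow_mod_eq[OF m(2)[OF P], of "m P * i"] by simp
    then have "P = (nxt ^^ (m P * i - i)) ((nxt ^^ i) P)" by (metis comp_apply funpow_add)
    then have "orb P \<subseteq> orb ((nxt ^^ i) P)" using sub by metis
    then show ?thesis using sub by blast
  qed
  define rep where "rep P = (SOME Q. Q \<in> orb P)" for P
  have rep_orb: "rep P \<in> orb P" for P
    unfolding rep_def by (rule someI_ex) (auto simp: orb_def)
  have rep: "rep P \<in> V" "orb (rep P) = orb P" if "P \<in> V" for P
    using rep_orb[of P] orb_step[OF that] iterV[OF that] unfolding orb_def[of P] by auto
  define C where "C = \<gamma> ` rep ` V"
  show ?thesis
  proof (intro exI[of _ C])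
    have E_traced: "\<exists>\<gamma>\<in>C. \<exists>u v. u \<le> v \<and> \<gamma> u = p \<and> \<gamma> v = q \<and> \<gamma> ` {u..v} = closed_segment p q"
      if pq: "(p, q) \<in> E" for p q
    proof -
      define P where "P = rep p"
      have p: "p \<in> V" using EV pq by blast
      have P: "P \<in> V" "orb P = orb p" using rep[OF p] by (auto simp: P_def)
      have "p \<in> orb p" unfolding orb_def by (rule range_eqI[of _ _ 0]) simp
      then obtain i where i: "p = (nxt ^^ i) P" using P(2) unfolding orb_def by auto
      have mP: "real (m P) > 0" using m(1)[OF P(1)] by simp
      have cp: "c P (int i) = p" "c P (int i + 1) = q"
        using c_nat[OF P(1), of i] c_Suc[OF P(1)] nxt_eq[OF pq] i by auto
      have im: "(\<lambda>t. real (m P) * t) ` {real i / real (m P)..(real i + 1) / real (m P)} = {of_int (int i)..of_int (int i) + 1}"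
        using mP by (simp add: divide_right_mono)
      show ?thesis
      proof (intro bexI[of _ "\<gamma> P"] exI conjI)
        show "real i / real (m P) \<le> (real i + 1) / real (m P)" using mP by (simp add: divide_right_mono)
        show "\<gamma> P (real i / real (m P)) = p" using mP cp polyline_of_int[of "c P" "int i"] by (simp add: \<gamma>_def)
        show "\<gamma> P ((real i + 1) / real (m P)) = q" using mP cp polyline_of_int[of "c P" "int i + 1"] by (simp add: \<gamma>_def)
        have "\<gamma> P ` {real i / real (m P)..(real i + 1) / real (m P)} = polyline (c P) ` {of_int (int i)..of_int (int i) + 1}"
          unfolding im[symmetric] image_image \<gamma>_def ..
        then show "\<gamma> P ` {real i / real (m P)..(real i + 1) / real (m P)} = closed_segment p q"
          unfolding polyline_image_segment cp .
        show "\<gamma> P \<in> C" using p by (simp add: C_def P_def)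
      qed
    qed
    have on_edges: "\<gamma> P t \<in> (\<Union>(p, q)\<in>E. closed_segment p q)" if P: "P \<in> V" for P t
    proof -
      have "\<gamma> P t \<in> closed_segment (c P \<lfloor>real (m P) * t\<rfloor>) (nxt (c P \<lfloor>real (m P) * t\<rfloor>))"
        unfolding \<gamma>_pt[OF P] by (rule pt_seg) (simp_all add: frac_lt_1)
      then show ?thesis using nxt[OF cV[OF P]] by blast
    qed
    have "disjoint_family_on range C"
      unfolding disjoint_family_on_def
    proof (intro ballI impI)
      fix \<gamma>1 \<gamma>2 assume C12: "\<gamma>1 \<in> C" "\<gamma>2 \<in> C" "\<gamma>1 \<noteq> \<gamma>2"
      then obtain P Q where PQ: "P \<in> V" "\<gamma>1 = \<gamma> (rep P)" "Q \<in> V" "\<gamma>2 = \<gamma> (rep Q)" unfolding C_def by auto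
      show "range \<gamma>1 \<inter> range \<gamma>2 = {}"
      proof (rule ccontr)
        assume "range \<gamma>1 \<inter> range \<gamma>2 \<noteq> {}"
        then obtain s t where "\<gamma> (rep P) s = \<gamma> (rep Q) t" unfolding PQ by (metis disjoint_iff rangeE)
        then have "c (rep P) \<lfloor>real (m (rep P)) * s\<rfloor> = c (rep Q) \<lfloor>real (m (rep Q)) * t\<rfloor>"
          unfolding \<gamma>_pt[OF rep(1)[OF PQ(1)]] \<gamma>_pt[OF rep(1)[OF PQ(3)]]
          using pt_inj[OF cV[OF rep(1)[OF PQ(1)]] cV[OF rep(1)[OF PQ(3)]]] frac_ge_0 frac_lt_1 by blast
        then have "orb (rep P) = orb (rep Q)"
          unfolding c_def using orb_step[OF rep(1)[OF PQ(1)]] orb_step[OF rep(1)[OF PQ(3)]] by metis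
        then have "rep P = rep Q" using rep PQ unfolding rep_def by metis
        then show False using C12(3) PQ by simp
      qed
    qed
    moreover have "V \<noteq> {}" using E1(2) by (simp add: V_def)
    ultimately have "disjoint_loops C"
      unfolding disjoint_loops_def C_def using finV simple[OF rep(1)] cont by (auto simp: simple_loop_def)
    moreover have "(\<Union>\<gamma>\<in>C. range \<gamma>) = (\<Union>(p, q)\<in>E. closed_segment p q)"
    proof
      show "(\<Union>\<gamma>\<in>C. range \<gamma>) \<subseteq> (\<Union>(p, q)\<in>E. closed_segment p q)"
        using on_edges[OF rep(1)] unfolding C_def by (intro UN_least) auto
      show "(\<Union>(p, q)\<in>E. closed_segment p q) \<subseteq> (\<Union>\<gamma>\<in>C. range \<gamma>)"
      proof
        fix x assume "x \<in> (\<Union>(p, q)\<in>E. closed_segment p q)"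
        then obtain p q where pq: "(p, q) \<in> E" "x \<in> closed_segment p q" by blast
        then obtain \<gamma>' u v where \<gamma>': "\<gamma>' \<in> C" "\<gamma>' ` {u..v} = closed_segment p q" using E_traced by metis
        then have "x \<in> range \<gamma>'" using pq(2) by blast
        then show "x \<in> (\<Union>\<gamma>\<in>C. range \<gamma>)" using \<gamma>'(1) by blast
      qed
    qed
    ultimately show "parametrises C E" unfolding parametrises_def using E_traced by blast
  qed
qed

section \<open>Straightening a stack of loops\<close>

text \<open>As \<open>z\<close> runs through $[-1, 1]$, the points with height \<open>circle_height
z\<close> and abscissa $\pm (1 - z^2)$ run through the unit circle. The width is polynomial, vanishing to
first order at the ends, so that its ratio to the width of a polygonal loop stays bounded.\<close>

definition circle_height :: "real \<Rightarrow> real" where "circle_height z = z * sqrt (2 - z\<^sup>2)"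

text \<open>The height of the circle number \<open>k\<close> of a vertical stack, and half its width, at
the fraction \<open>s\<close> of the way from its top to its bottom.\<close>

definition stack_height :: "nat \<Rightarrow> real \<Rightarrow> real" where "stack_height k s = circle_height (1 - 2 * s) - 3 * real k"
definition stack_width :: "real \<Rightarrow> real" where "stack_width s = 4 * s * (1 - s)"

lemma circle_height_minus: "circle_height (- z) = - circle_height z" by (simp add: circle_height_def)

lemma circle_height_ends [simp]: "circle_height 1 = 1" "circle_height (-1) = -1" by (simp_all add: circle_height_def)

lemma continuous_on_circle_height: "continuous_on A circle_height"
  unfolding circle_height_def by (intro continuous_intros)

lemma circle_height_square: "\<bar>z\<bar> \<le> 1 \<Longrightarrow> (circle_height z)\<^sup>2 = 1 - (1 - z\<^sup>2)\<^sup>2"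
proof -
  assume "\<bar>z\<bar> \<le> 1"
  then have "z\<^sup>2 \<le> 1" by (simp add: abs_square_le_1)
  then have "(circle_height z)\<^sup>2 = z\<^sup>2 * (2 - z\<^sup>2)" by (simp add: circle_height_def power_mult_distrib)
  then show ?thesis by (simp add: power2_eq_square algebra_simps)
qed

lemma circle_height_strict_mono:
  assumes "-1 \<le> a" "a < b" "b \<le> 1"
  shows "circle_height a < circle_height b"
proof -
  have sq: "x\<^sup>2 \<le> 1" if "-1 \<le> x" "x \<le> 1" for x :: real using that by (simp add: abs_square_le_1 abs_le_iff)
  have pos: "circle_height a < circle_height b" if ab: "0 \<le> a" "a < b" "b \<le> 1" for a b
  proof (rule power2_less_imp_less)
    have 1: "a\<^sup>2 < b\<^sup>2" "b\<^sup>2 \<le> 1" using ab sq[of b] by (auto intro: power_strict_mono)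
    then have "(1 - b\<^sup>2)\<^sup>2 < (1 - a\<^sup>2)\<^sup>2" by (intro power_strict_mono) auto
    then show "(circle_height a)\<^sup>2 < (circle_height b)\<^sup>2" using ab by (simp add: circle_height_square)
    show "0 \<le> circle_height b" unfolding circle_height_def using ab 1 by simp
  qed
  have sgn: "circle_height x < 0" if "-1 \<le> x" "x < 0" for x using pos[of 0 "- x"] that by (simp add: circle_height_minus) (simp add: circle_height_def)
  show ?thesis
  proof (cases "0 \<le> a")
    case True then show ?thesis using pos assms by simp
  next
    case False
    show ?thesis
    proof (cases "b \<le> 0")
      case True
      show ?thesis using pos[of "- b" "- a"] assms True by (simp add: circle_height_minus)
    next
      case b: False
      have "0 < circle_height b" using pos[of 0 b] b assms by (simp add: circle_height_def)
      then show ?thesis using sgn[of a] assms False by simp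
    qed
  qed
qed

lemma circle_height_bounds:
  assumes "-1 \<le> z" "z \<le> 1"
  shows "-1 \<le> circle_height z" "circle_height z \<le> 1"
proof -
  show "-1 \<le> circle_height z" using circle_height_strict_mono[of "-1" z] assms by (cases "z = -1") auto
  show "circle_height z \<le> 1" using circle_height_strict_mono[of z 1] assms by (cases "z = 1") auto
qed

lemma stack_height_strict_antimono: "0 \<le> a \<Longrightarrow> a < b \<Longrightarrow> b \<le> 1 \<Longrightarrow> stack_height k b < stack_height k a"
  using circle_height_strict_mono[of "1 - 2 * b" "1 - 2 * a"] by (simp add: stack_height_def)

lemma stack_height_bounds: "0 \<le> s \<Longrightarrow> s \<le> 1 \<Longrightarrow> - 1 \<le> stack_height k s + 3 * real k \<and> stack_height k s + 3 * real k \<le> 1"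
  using circle_height_bounds[of "1 - 2 * s"] by (simp add: stack_height_def)

lemma stack_circle: "0 \<le> s \<Longrightarrow> s \<le> 1 \<Longrightarrow> (stack_height k s + 3 * real k)\<^sup>2 + (stack_width s)\<^sup>2 = 1"
proof -
  assume "0 \<le> s" "s \<le> 1"
  then have "(circle_height (1 - 2 * s))\<^sup>2 = 1 - (1 - (1 - 2 * s)\<^sup>2)\<^sup>2" by (intro circle_height_square) (simp add: abs_le_iff)
  moreover have "1 - (1 - 2 * s)\<^sup>2 = stack_width s" by (simp add: stack_width_def power2_eq_square algebra_simps)
  ultimately show ?thesis by (simp add: stack_height_def)
qed

lemma continuous_on_stack_height: "continuous_on A (stack_height k)"
  unfolding stack_height_def by (intro continuous_intros continuous_on_compose2[OF continuous_on_circle_height[of UNIV]]) auto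

lemma stack_height_surj:
  assumes "-1 \<le> y" "y \<le> 1"
  obtains s where "0 \<le> s" "s \<le> 1" "stack_height k s = y - 3 * real k"
proof -
  have "\<exists>s\<ge>0. s \<le> 1 \<and> stack_height k s = y - 3 * real k"
    using assms by (intro IVT2' continuous_on_stack_height) (auto simp: stack_height_def)
  then show thesis using that by blast
qed

text \<open>The circles of the stack occupy disjoint compact intervals of heights, so functions given on
each of them form one continuous function on a compact set, to which Tietze's theorem applies.\<close>

lemma slab_functions_extend:
  fixes G :: "nat \<Rightarrow> real \<Rightarrow> complex"
  assumes G: "\<And>k. k < r \<Longrightarrow> continuous_on {0..1} (G k)"
  shows "\<exists>g K. continuous_on UNIV g \<and> (\<forall>h. norm (g h) \<le> K) \<and> (\<forall>k<r. \<forall>s\<in>{0..1}. g (stack_height k s) = G k s)"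
proof -
  define S where "S k = stack_height k ` {0..1}" for k
  have S_sub: "- 1 \<le> h + 3 * real k \<and> h + 3 * real k \<le> 1" if "h \<in> S k" for h k
    using that stack_height_bounds unfolding S_def by auto
  have compS: "compact (S k)" for k
    unfolding S_def by (rule compact_continuous_image[OF continuous_on_stack_height compact_Icc])
  define inv where "inv k = inv_into {0..1} (stack_height k)" for k
  have inj: "inj_on (stack_height k) {0..1}" for k
  proof (rule linorder_inj_onI)
    fix x y :: real assume "x < y" "x \<in> {0..1}" "y \<in> {0..1}"
    then show "stack_height k x \<noteq> stack_height k y" using stack_height_strict_antimono[of x y k] by auto
  qed auto
  have inv: "inv k (stack_height k s) = s" if "s \<in> {0..1}" for k s
    unfolding inv_def using that by (rule inv_into_f_f[OF inj])
  have cinv: "continuous_on (S k) (inv k)" for k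
    unfolding S_def by (rule continuous_on_inv[OF continuous_on_stack_height compact_Icc]) (use inv in auto)
  define sel where "sel h = nat \<lfloor>(1 - h) / 3\<rfloor>" for h :: real
  have sel: "sel h = k" if "h \<in> S k" for h k
  proof -
    have "\<lfloor>(1 - h) / 3\<rfloor> = int k" by (rule floor_unique) (use S_sub[OF that] in auto)
    then show ?thesis by (simp add: sel_def)
  qed
  define f where "f h = G (sel h) (inv (sel h) h)" for h
  define T where "T = (\<Union>k\<in>{..<r}. S k)"
  have "continuous_on T f"
    unfolding T_def
  proof (rule continuous_on_closed_Union)
    fix k assume k: "k \<in> {..<r}"
    have "continuous_on (S k) (\<lambda>h. G k (inv k h))"
      by (rule continuous_on_compose2[OF G cinv]) (use k inv in \<open>auto simp: S_def\<close>)
    then show "continuous_on (S k) f"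
      by (rule continuous_on_eq) (simp add: f_def sel)
  qed (use compS compact_imp_closed in auto)
  moreover have compT: "compact T" unfolding T_def using compS by auto
  ultimately have "bounded (f ` T)" using compact_continuous_image compact_imp_bounded by blast
  then obtain K where K: "\<And>h. h \<in> T \<Longrightarrow> norm (f h) \<le> K" unfolding bounded_iff by blast
  define K' where "K' = max K 0"
  have "closedin (top_of_set UNIV) T" using compT compact_imp_closed by simp
  then obtain g where g: "continuous_on UNIV g" "\<And>h. h \<in> T \<Longrightarrow> g h = f h" "\<And>h. h \<in> UNIV \<Longrightarrow> norm (g h) \<le> K'"
    using Tietze[OF \<open>continuous_on T f\<close>, of UNIV K'] K unfolding K'_def by (metis max.coboundedI1 max.cobounded2)
  have "g (stack_height k s) = G k s" if "k < r" "s \<in> {0..1}" for k s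
  proof -
    have hS: "stack_height k s \<in> S k" using that by (simp add: S_def)
    then have "stack_height k s \<in> T" using that by (auto simp: T_def)
    then show ?thesis using g(2) sel[OF hS] inv[OF that(2)] by (simp add: f_def)
  qed
  then show ?thesis using g by blast
qed

text \<open>At height \<open>stack_height k s\<close> the map $z \mapsto a z + b$ with $a (p - q) = - 2
w$ and $b = w - a q$ takes \<open>p\<close> and \<open>q\<close> to the two points of the circle, where
$w$ is half the width. On an interval the factor $a$, which does not vanish, has a continuous logarithm,
however often \<open>p\<close> winds around \<open>q\<close>.\<close>

lemma straighten_stack:
  fixes p q :: "nat \<Rightarrow> real \<Rightarrow> complex"
  assumes p: "\<And>k. k < r \<Longrightarrow> continuous_on {0..1} (p k)" and q: "\<And>k. k < r \<Longrightarrow> continuous_on {0..1} (q k)"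
    and \<alpha>: "\<And>k. k < r \<Longrightarrow> \<exists>\<alpha>. continuous_on {0..1} \<alpha> \<and> (\<forall>s\<in>{0..1}. \<alpha> s \<noteq> 0 \<and> \<alpha> s * (p k s - q k s) = of_real (s * (1 - s)))"
  shows "\<exists>\<Psi>. isotopic_to_identity \<Psi> \<and> (\<forall>k<r. \<forall>s\<in>{0..1}. 
     \<Psi> (of_C (p k s), stack_height k s) = (of_C (- of_real (stack_width s)), stack_height k s) \<and>
     \<Psi> (of_C (q k s), stack_height k s) = (of_C (of_real (stack_width s)), stack_height k s))"
proof -
  have "\<exists>G. continuous_on {0..1} G \<and> (\<forall>s\<in>{0..1}. exp (G s) * (p k s - q k s) = - 2 * of_real (stack_width s))" if k: "k < r" for k
  proof -
    obtain \<alpha> where \<alpha>: "continuous_on {0..1} \<alpha>" "\<And>s. s \<in> {0..1} \<Longrightarrow> \<alpha> s \<noteq> 0"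
      "\<And>s. s \<in> {0..1} \<Longrightarrow> \<alpha> s * (p k s - q k s) = of_real (s * (1 - s))" using \<alpha>[OF k] by blast
    have "continuous_on {0..1} (\<lambda>s. - 8 * \<alpha> s)" by (intro continuous_intros \<alpha>)
    moreover have "contractible {0..1::real}" by (rule convex_imp_contractible) simp
    ultimately obtain G where G: "continuous_on {0..1} G" "\<And>s. s \<in> {0..1} \<Longrightarrow> - 8 * \<alpha> s = exp (G s)"
      using continuous_logarithm_on_contractible[of "{0..1}" "\<lambda>s. - 8 * \<alpha> s"] \<alpha>(2) by auto
    have "exp (G s) * (p k s - q k s) = - 2 * of_real (stack_width s)" if s: "s \<in> {0..1}" for s
      using G(2)[OF s, symmetric] \<alpha>(3)[OF s] by (simp add: stack_width_def mult.assoc)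
    then show ?thesis using G(1) by blast
  qed
  then obtain G where G: "\<And>k. k < r \<Longrightarrow> continuous_on {0..1} (G k)"
    and Ge: "\<And>k s. k < r \<Longrightarrow> s \<in> {0..1} \<Longrightarrow> exp (G k s) * (p k s - q k s) = - 2 * of_real (stack_width s)" by metis
  obtain A K where A: "continuous_on UNIV A" "\<And>h. norm (A h) \<le> K" "\<And>k s. k < r \<Longrightarrow> s \<in> {0..1} \<Longrightarrow> A (stack_height k s) = G k s"
    using slab_functions_extend[of r G] G by blast
  define B' where "B' k s = of_real (stack_width s) - exp (G k s) * q k s" for k s
  have "continuous_on {0..1} (B' k)" if "k < r" for k
    unfolding B'_def stack_width_def by (intro continuous_intros G q that)
  then obtain B K' where B: "continuous_on UNIV B" "\<And>h. norm (B h) \<le> K'" "\<And>k s. k < r \<Longrightarrow> s \<in> {0..1} \<Longrightarrow> B (stack_height k s) = B' k s"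
    using slab_functions_extend[of r B'] by blast
  define \<Psi> :: "space \<Rightarrow> space" where "\<Psi> P = (of_C (exp (A (snd P)) * to_C (fst P) + B (snd P)), snd P)" for P
  have "isotopic_to_identity \<Psi>"
    unfolding \<Psi>_def using isotopic_to_identity_horizontal[OF A(1) _ B(1), of "max K K'"] A(2) B(2)
    by (metis max.coboundedI1 max.coboundedI2)
  moreover have "\<Psi> (of_C (q k s), stack_height k s) = (of_C (of_real (stack_width s)), stack_height k s)" if "k < r" "s \<in> {0..1}" for k s
    using A(3)[OF that] B(3)[OF that] by (simp add: \<Psi>_def B'_def)
  moreover have "\<Psi> (of_C (p k s), stack_height k s) = (of_C (- of_real (stack_width s)), stack_height k s)" if "k < r" "s \<in> {0..1}" for k s
  proof -
    have "exp (G k s) * p k s + B' k s = exp (G k s) * (p k s - q k s) + of_real (stack_width s)"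
      by (simp add: B'_def algebra_simps)
    also have "\<dots> = - of_real (stack_width s)" using Ge[OF that] by simp
    finally show ?thesis using A(3)[OF that] B(3)[OF that] by (simp add: \<Psi>_def)
  qed
  ultimately show ?thesis by blast
qed

text \<open>Near the ends \<open>d\<close> is linear, so the singularities of \<open>s * (1 - s) / d
s\<close> are removable.\<close>

lemma quotient_of_width:
  fixes d :: "real \<Rightarrow> complex"
  assumes d: "continuous_on {0..1} d" and nz: "\<And>s. 0 < s \<Longrightarrow> s < 1 \<Longrightarrow> d s \<noteq> 0"
    and \<delta>: "0 < \<delta>" "\<delta> \<le> 1/2"
    and l: "\<And>s. 0 \<le> s \<Longrightarrow> s \<le> \<delta> \<Longrightarrow> d s = of_real s * w0" and u: "\<And>s. 1 - \<delta> \<le> s \<Longrightarrow> s \<le> 1 \<Longrightarrow> d s = of_real (1 - s) * w1"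
  shows "\<exists>\<alpha>. continuous_on {0..1} \<alpha> \<and> (\<forall>s\<in>{0..1}. \<alpha> s \<noteq> 0 \<and> \<alpha> s * d s = of_real (s * (1 - s)))"
proof -
  have w: "w0 \<noteq> 0" "w1 \<noteq> 0" using nz[of \<delta>] nz[of "1 - \<delta>"] l[of \<delta>] u[of "1 - \<delta>"] \<delta> by auto
  define m where "m s = of_real (s * (1 - s)) / d s" for s
  define \<alpha> where "\<alpha> s = (if s \<le> \<delta> then of_real (1 - s) / w0 else if s \<le> 1 - \<delta> then m s else of_real s / w1)" for s
  have cm: "continuous_on {\<delta>..1 - \<delta>} m"
    unfolding m_def by (intro continuous_intros continuous_on_subset[OF d]) (use nz \<delta> in auto)
  have "continuous_on ({\<delta>..1 - \<delta>} \<union> {1 - \<delta>..1}) (\<lambda>s. if s \<le> 1 - \<delta> then m s else of_real s / w1)"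
    by (rule continuous_on_If[OF _ _ cm]) (use \<delta> w u[of "1 - \<delta>"] in \<open>auto intro!: continuous_intros simp: m_def\<close>)
  moreover have "{\<delta>..1 - \<delta>} \<union> {1 - \<delta>..1} = {\<delta>..1}" using \<delta> by auto
  ultimately have "continuous_on {\<delta>..1} (\<lambda>s. if s \<le> 1 - \<delta> then m s else of_real s / w1)" by simp
  then have "continuous_on ({0..\<delta>} \<union> {\<delta>..1}) \<alpha>"
    unfolding \<alpha>_def
    by (intro continuous_on_If) (use \<delta> w l[of \<delta>] in \<open>auto intro!: continuous_intros simp: m_def\<close>)
  moreover have "{0..\<delta>} \<union> {\<delta>..1} = {0..1}" using \<delta> by auto
  ultimately have "continuous_on {0..1} \<alpha>" by simp
  moreover have "\<alpha> s \<noteq> 0 \<and> \<alpha> s * d s = of_real (s * (1 - s))" if s: "s \<in> {0..1}" for s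
  proof -
    consider "s \<le> \<delta>" | "\<delta> < s" "s \<le> 1 - \<delta>" | "1 - \<delta> < s" by linarith
    then show ?thesis
    proof cases
      case 1 then show ?thesis using s l[of s] w \<delta> by (simp add: \<alpha>_def)
    next
      case 2 then show ?thesis using s nz[of s] \<delta> by (simp add: \<alpha>_def m_def)
    next
      case 3 
      then have "\<not> s \<le> \<delta>" using \<delta> by linarith
      then show ?thesis using s 3 u[of s] w \<delta> by (simp add: \<alpha>_def)
    qed
  qed
  ultimately show ?thesis by blast
qed

section \<open>Descending diagrams\<close>

lemma block_exists:
  fixes A :: "nat \<Rightarrow> nat"
  assumes "A 0 = 0" "N < A R"
  shows "\<exists>k<R. A k \<le> N \<and> N < A (Suc k)"
  using assms(2)
proof (induction R)
  case (Suc R)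
  show ?case
  proof (cases "N < A R")
    case True then show ?thesis using Suc.IH less_SucI by blast
  next
    case False then show ?thesis using Suc.prems by (intro exI[of _ R]) auto
  qed
qed (use assms in simp)

text \<open>The vertices of the diagram are numbered in the order of a journey; block \<open>k\<close> of
the numbers is one component, and \<open>nx\<close> leads from the last vertex of a block back to its
first one. Each crossing is between edges within the journey and not between consecutive ones; the
closing edges of the blocks are not involved. With \<open>f\<close> the earlier edge is always the
over-passing one, otherwise always the under-passing one. In the latter case the link is turned upside
down after the vertical isotopy, so that again the height falls along the journey.\<close>

lemma descending_diagram_unlink:
  fixes v :: "nat \<Rightarrow> plane" and A :: "nat \<Rightarrow> nat" and nx :: "nat \<Rightarrow> nat"
  assumes link: "oriented_link L" and dia: "has_diagram L (Edg, X)"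
    and R: "R \<ge> 1" and A0: "A 0 = 0" and len: "\<And>k. k < R \<Longrightarrow> A k + 3 \<le> A (Suc k)"
    and nx: "\<And>k N. k < R \<Longrightarrow> A k \<le> N \<Longrightarrow> N < A (Suc k) \<Longrightarrow> nx N = (if Suc N < A (Suc k) then Suc N else A k)"
    and inj: "inj_on v {..<A R}"
    and Edg: "Edg = (\<lambda>N. (v N, v (nx N))) ` {..<A R}"
    and X: "\<And>e e'. (e, e') \<in> X \<Longrightarrow> \<exists>N N'. Suc N < N' \<and> N' < A R \<and> nx N = Suc N \<and> nx N' = Suc N' \<and>
        (if f then (e, e') else (e', e)) = ((v N, v (Suc N)), (v N', v (Suc N')))"
  shows "unlink L"
proof -
  obtain E where E: "isotopic_to_polygonal L E" "regular_projection E" "diagram_of E = (Edg, X)"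
    using dia unfolding has_diagram_def by blast
  then obtain C where pol: "polygonal_link E" and C: "parametrises C E" "isotopic L ((\<lambda>\<gamma>. to_S3 \<circ> \<gamma>) ` C)"
    unfolding isotopic_to_polygonal_def by blast
  have fs: "fst ` E = snd ` E" and neq: "\<And>p q. (p, q) \<in> E \<Longrightarrow> p \<noteq> q"
    and meet: "\<And>p q p' q'. (p, q) \<in> E \<Longrightarrow> (p', q') \<in> E \<Longrightarrow> (p, q) \<noteq> (p', q') \<Longrightarrow>
        closed_segment p q \<inter> closed_segment p' q' \<subseteq> {p, q} \<inter> {p', q'}"
    using pol unfolding polygonal_link_def by blast+
  have reg1: "\<And>p q. (p, q) \<in> E \<Longrightarrow> fst p \<noteq> fst q"
    and reg2: "\<And>w p q. w \<in> fst ` E \<Longrightarrow> (p, q) \<in> E \<Longrightarrow> fst w \<in> closed_segment (fst p) (fst q) \<Longrightarrow> w = p \<or> w = q"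
    using E(2) unfolding regular_projection_def by blast+
  have EdgD: "Edg = {(fst p, fst q) | p q. (p, q) \<in> E}"
    and XD: "X = {((fst p, fst q), (fst p', fst q')) | p q p' q'. (p, q) \<in> E \<and> (p', q') \<in> E \<and>
         (\<exists>x h h'. (x, h) \<in> closed_segment p q \<and> (x, h') \<in> closed_segment p' q' \<and> h' < h)}"
    using E(3) unfolding diagram_of_def by auto

  have A_mono: "A j \<le> A k" if "j \<le> k" "k \<le> R" for j k
    using that
  proof (induction k)
    case (Suc k)
    show ?case
    proof (cases "j = Suc k")
      case False
      then have "A j \<le> A k" using Suc by simp
      also have "A k \<le> A (Suc k)" using len[of k] Suc.prems by simp
      finally show ?thesis .
    qed simp
  qed simp
  define blk where "blk N = (LEAST k. N < A (Suc k))" for N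
  have blk_eq: "blk N = k" if "k < R" "A k \<le> N" "N < A (Suc k)" for N k
    unfolding blk_def
  proof (rule Least_equality)
    fix j assume "N < A (Suc j)"
    show "k \<le> j"
    proof (rule ccontr)
      assume "\<not> k \<le> j"
      then have "A (Suc j) \<le> A k" using that by (intro A_mono) auto
      then show False using \<open>N < A (Suc j)\<close> that by simp
    qed
  qed (rule that)
  have blk: "blk N < R" "A (blk N) \<le> N" "N < A (Suc (blk N))" if N: "N < A R" for N
    using block_exists[where A = A, OF A0 N] blk_eq by auto
  define B where "B k = A (Suc k) - 1" for k
  have B: "A k + 2 \<le> B k" "A (Suc k) = Suc (B k)" if "k < R" for k
    using len[OF that] by (auto simp: B_def)
  have BR: "B k < A R" if "k < R" for k
    using A_mono[of "Suc k" R] B[OF that] that by simp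
  have AR: "A k < A R" if "k < R" for k using BR[OF that] B[OF that] by simp
  have blkB: "blk (B k) = k" and blkA: "blk (A k) = k" if "k < R" for k
    using blk_eq[OF that] B[OF that] by auto
  have nx_chain: "nx N = Suc N" "Suc N < A R" "blk (Suc N) = blk N" if "N < A R" "N \<noteq> B (blk N)" for N
  proof -
    have 1: "Suc N < A (Suc (blk N))" using blk[OF that(1)] that(2) B(2)[OF blk(1)[OF that(1)]] by linarith
    then show "nx N = Suc N" using nx[OF blk[OF that(1)]] by simp
    show "Suc N < A R" using 1 A_mono[of "Suc (blk N)" R] blk(1)[OF that(1)] by simp
    show "blk (Suc N) = blk N" using 1 blk[OF that(1)] by (intro blk_eq) auto
  qed
  have nx_B: "nx (B k) = A k" if "k < R" for k
    using nx[OF that, of "B k"] B[OF that] by simp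
  have nxR: "nx N < A R" and blk_nx: "blk (nx N) = blk N" if "N < A R" for N
  proof -
    show "nx N < A R" using nx_chain[OF that] nx_B blk[OF that] AR by (cases "N = B (blk N)") (metis, simp)
    show "blk (nx N) = blk N" using nx_chain[OF that] nx_B blk[OF that] blkA by (cases "N = B (blk N)") (metis, simp)
  qed
  have blk_mono: "blk N \<le> blk N'" if "N < N'" "N' < A R" for N N'
  proof (rule ccontr)
    assume "\<not> blk N \<le> blk N'"
    then have "A (Suc (blk N')) \<le> A (blk N)" using blk(1)[of N] that by (intro A_mono) auto
    then show False using blk(2)[of N] blk(3)[of N'] that by simp
  qed

  \<comment> \<open>The height depends on the fraction of the block that has been travelled. On the closing edge the
     number of the vertex decreases from the end to the start of the block, so one formula for \<open>Y\<close> serves both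
     kinds of edges.\<close>
  define len' where "len' k = real (B k) - real (A k)" for k
  have len': "len' k \<ge> 2" if "k < R" for k using B(1)[OF that] by (simp add: len'_def)
  define hN where "hN N = stack_height (blk N) ((real N - real (A (blk N))) / len' (blk N))" for N
  define Y where "Y N l = stack_height (blk N) (((1 - l) * real N + l * real (nx N) - real (A (blk N))) / len' (blk N))" for N l
  have frac01: "0 \<le> (real N - real (A (blk N))) / len' (blk N)" "(real N - real (A (blk N))) / len' (blk N) \<le> 1"
    if "N < A R" for N
    using blk[OF that] len'[OF blk(1)[OF that]] B(2)[OF blk(1)[OF that]] by (auto simp: len'_def)
  have hN_less: "hN N' < hN N" if NN: "N < N'" "N' < A R" for N N'
  proof -
    have N: "N < A R" using NN by simp
    show ?thesis
    proof (cases "blk N = blk N'")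
      case True
      have "(real N - real (A (blk N))) / len' (blk N) < (real N' - real (A (blk N))) / len' (blk N)"
        using NN len'[OF blk(1)[OF N]] by (intro divide_strict_right_mono) auto
      then show ?thesis
        unfolding hN_def using True frac01[OF N] frac01[OF NN(2)] by (auto intro!: stack_height_strict_antimono)
    next
      case False
      then have "blk N + 1 \<le> blk N'" using blk_mono[OF NN] by simp
      then have "real (blk N) + 1 \<le> real (blk N')" by linarith
      then show ?thesis
        using stack_height_bounds[OF frac01[OF N], of "blk N"] stack_height_bounds[OF frac01[OF NN(2)], of "blk N'"]
        unfolding hN_def by linarith
    qed
  qed
  have Y_ends: "Y N 0 = hN N" "Y N 1 = hN (nx N)" if "N < A R" for N
    using blk_nx[OF that] by (simp_all add: Y_def hN_def)
  have Y_between: "hN (Suc N) \<le> Y N l" "Y N l \<le> hN N" if N: "N < A R" "nx N = Suc N" and l: "0 \<le> l" "l \<le> 1" for N l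
  proof -
    have weak: "stack_height k b \<le> stack_height k a" if "0 \<le> a" "a \<le> b" "b \<le> 1" for k a b
      using stack_height_strict_antimono[of a b k] that by (cases "a = b") auto
    have NB: "Suc N < A R" "blk (Suc N) = blk N"
      using nxR[OF N(1)] blk_nx[OF N(1)] N(2) by simp_all
    have e: "(1 - l) * real N + l * real (nx N) = real N + l" using N(2) by (simp add: algebra_simps)
    have pos: "len' (blk N) > 0" using len'[OF blk(1)[OF N(1)]] by simp
    have 1: "(real N - real (A (blk N))) / len' (blk N) \<le> (real N + l - real (A (blk N))) / len' (blk N)"
      "(real N + l - real (A (blk N))) / len' (blk N) \<le> (real (Suc N) - real (A (blk N))) / len' (blk N)"
      using l pos by (auto intro!: divide_right_mono)
    have f1: "0 \<le> (real N - real (A (blk N))) / len' (blk N)" using frac01[OF N(1)] by simp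
    have f2: "(real (Suc N) - real (A (blk N))) / len' (blk N) \<le> 1" using frac01[OF NB(1)] unfolding NB(2) by simp
    show "Y N l \<le> hN N" unfolding Y_def hN_def e by (rule weak[OF f1 1(1) order_trans[OF 1(2) f2]])
    show "hN (Suc N) \<le> Y N l" unfolding Y_def hN_def e NB(2) by (rule weak[OF order_trans[OF f1 1(1)] 1(2) f2])
  qed
  obtain \<epsilon> where \<epsilon>: "\<epsilon> > 0" "\<And>N N'. N < N' \<Longrightarrow> N' < A R \<Longrightarrow> \<epsilon> \<le> hN N - hN N'"
  proof -
    define S where "S = (\<lambda>(N, N'). hN N - hN N') ` {(N, N'). N < N' \<and> N' < A R}"
    have "finite {(N, N'). N < N' \<and> N' < A R}"
      by (rule finite_subset[of _ "{..<A R} \<times> {..<A R}"]) auto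
    then have fin: "finite (insert 1 S)" by (simp add: S_def)
    have "Min (insert 1 S) \<in> insert 1 S" using fin by (rule Min_in) simp
    then have "Min (insert 1 S) > 0" using hN_less by (auto simp: S_def)
    moreover have "Min (insert 1 S) \<le> hN N - hN N'" if "N < N'" "N' < A R" for N N'
      using fin by (rule Min_le) (use that in \<open>auto simp: S_def\<close>)
    ultimately show thesis using that by blast
  qed

  \<comment> \<open>Vertices of a regular projection are determined by their images, which carries the numbering over
     from the diagram to the polygon.\<close>
  have uniq: "P = Q" if PQ: "P \<in> fst ` E" "Q \<in> fst ` E" "fst P = fst Q" for P Q
  proof -
    obtain q where q: "(Q, q) \<in> E" using PQ(2) by auto
    have "P = Q \<or> P = q" using reg2[OF PQ(1) q] PQ(3) by simp
    then show ?thesis using reg1[OF q] PQ(3) by auto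
  qed
  have "\<exists>P. P \<in> fst ` E \<and> fst P = v N" if "N < A R" for N
  proof -
    have "(v N, v (nx N)) \<in> Edg" using that unfolding Edg by blast
    then obtain p q where "(p, q) \<in> E" "fst p = v N" unfolding EdgD by auto
    then show ?thesis by (metis fst_conv image_eqI)
  qed
  then obtain V where V: "\<And>N. N < A R \<Longrightarrow> V N \<in> fst ` E" "\<And>N. N < A R \<Longrightarrow> fst (V N) = v N" by metis
  have V_inj: "N = N'" if "N < A R" "N' < A R" "V N = V N'" for N N'
    using that V inj by (metis inj_onD lessThan_iff)
  have V_eq: "P = V N" if "P \<in> fst ` E" "fst P = v N" "N < A R" for P N
    using uniq[OF that(1) V(1)[OF that(3)]] that V(2) by simp
  have edge: "(V N, V (nx N)) \<in> E" if N: "N < A R" for N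
  proof -
    have "(v N, v (nx N)) \<in> Edg" using N unfolding Edg by blast
    then obtain p q where pq: "(p, q) \<in> E" "fst p = v N" "fst q = v (nx N)" unfolding EdgD by auto
    have "p \<in> fst ` E" "q \<in> fst ` E" using pq(1) fs by force+
    then show ?thesis using pq V_eq[OF _ pq(2) N] V_eq[OF _ pq(3) nxR[OF N]] by simp
  qed
  have edge_cases: "\<exists>N<A R. p = V N \<and> q = V (nx N)" if pq: "(p, q) \<in> E" for p q
  proof -
    have "(fst p, fst q) \<in> Edg" unfolding EdgD using pq by blast
    then obtain N where N: "N < A R" "fst p = v N" "fst q = v (nx N)" unfolding Edg by auto
    have "p \<in> fst ` E" "q \<in> fst ` E" using pq fs by force+
    then show ?thesis using V_eq N nxR by blast
  qed
  define pt where "pt N l = (1 - l) *\<^sub>R V N + l *\<^sub>R V (nx N)" for N and l :: real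
  have seg: "closed_segment (V N) (V (nx N)) = pt N ` {0..1}" for N
    unfolding closed_segment_image_interval pt_def ..
  have pt_in: "pt N l \<in> closed_segment (V N) (V (nx N))" if "0 \<le> l" "l \<le> 1" for N l
    unfolding seg using that by simp
  have pt_V: "l = 0" if "N < A R" "pt N l = V N" for N l
  proof -
    have "l *\<^sub>R (V (nx N) - V N) = pt N l - V N" by (simp add: pt_def algebra_simps)
    then show ?thesis using neq[OF edge[OF that(1)]] that(2) by simp
  qed
  have pt_V': "l = 1" if "N < A R" "pt N l = V (nx N)" for N l
  proof -
    have "(1 - l) *\<^sub>R (V N - V (nx N)) = pt N l - V (nx N)" by (simp add: pt_def algebra_simps)
    then show ?thesis using neq[OF edge[OF that(1)]] that(2) by simp
  qed
  have pt_ends: "\<exists>M. pt N l = V M \<and> M < A R \<and> Y N l = hN M" if "N < A R" "pt N l \<in> {V N, V (nx N)}" for N l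
    using that(2) pt_V[OF that(1), of l] pt_V'[OF that(1), of l] Y_ends[OF that(1)] nxR[OF that(1)] that(1) by auto
  have pt_common: "pt N l \<in> {V N, V (nx N)} \<inter> {V N', V (nx N')}"
    if "N < A R" "N' < A R" "N \<noteq> N'" "0 \<le> l" "l \<le> 1" "0 \<le> l'" "l' \<le> 1" "pt N l = pt N' l'" for N N' l l'
  proof -
    have "(V N, V (nx N)) \<noteq> (V N', V (nx N'))" using V_inj that by blast
    then show ?thesis
      using meet[OF edge[OF that(1)] edge[OF that(2)]] pt_in[of l N] pt_in[of l' N'] that by auto
  qed
  have over: "((v N, v (nx N)), (v N', v (nx N'))) \<in> X"
    if "N < A R" "N' < A R" "0 \<le> l" "l \<le> 1" "0 \<le> l'" "l' \<le> 1"
      "fst (pt N l) = fst (pt N' l')" "snd (pt N' l') < snd (pt N l)" for N N' l l'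
  proof -
    have "(fst (pt N l), snd (pt N l)) \<in> closed_segment (V N) (V (nx N))"
      using pt_in[OF that(3,4)] by simp
    moreover have "(fst (pt N l), snd (pt N' l')) \<in> closed_segment (V N') (V (nx N'))"
      unfolding that(7) using pt_in[of l' N'] that by simp
    ultimately have "((fst (V N), fst (V (nx N))), (fst (V N'), fst (V (nx N')))) \<in> X"
      unfolding XD using edge[OF that(1)] edge[OF that(2)] that(8) by blast
    then show ?thesis using V(2) that nxR by simp
  qed
  have crossing: "(if f then Suc N < N' else Suc N' < N) \<and> nx N = Suc N \<and> nx N' = Suc N'"
    if asm: "N < A R" "N' < A R" "0 \<le> l" "l \<le> 1" "0 \<le> l'" "l' \<le> 1"
      "fst (pt N l) = fst (pt N' l')" "snd (pt N' l') < snd (pt N l)" for N N' l l'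
  proof -
    have v_eq: "N = M" if "v N = v M" "N < A R" "M < A R" for N M
      using inj_onD[OF inj that(1)] that by simp
    obtain M M' where M: "Suc M < M'" "M' < A R" "nx M = Suc M" "nx M' = Suc M'"
      "(if f then ((v N, v (nx N)), (v N', v (nx N'))) else ((v N', v (nx N')), (v N, v (nx N))))
        = ((v M, v (Suc M)), (v M', v (Suc M')))"
      using X[OF over[OF asm]] by blast
    have MR: "M < A R" using M by simp
    show ?thesis
    proof (cases f)
      case True
      then have "N = M" "N' = M'" using M(5) v_eq asm(1,2) M(2) MR by auto
      then show ?thesis using True M by simp
    next
      case False
      then have "N' = M" "N = M'" using M(5) v_eq asm(1,2) M(2) MR by auto
      then show ?thesis using False M by simp
    qed
  qed

  \<comment> \<open>The relation \<open>Z\<close> prescribes the new heights. Its slope \<open>c\<close> is the least difference \<open>\<epsilon>\<close> of new vertex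
     heights, divided by a bound for the differences of old heights.\<close>
  define sg where "sg = (if f then 1 else - 1 :: real)"
  define D where "D = (\<Sum>N<A R. \<bar>snd (V N)\<bar>)"
  have D0: "D \<ge> 0" unfolding D_def by (simp add: sum_nonneg)
  have VD: "\<bar>snd (V N)\<bar> \<le> D" if "N < A R" for N
    unfolding D_def by (rule member_le_sum) (use that in auto)
  have ptD: "\<bar>snd (pt N l)\<bar> \<le> D" if "N < A R" "0 \<le> l" "l \<le> 1" for N l
  proof -
    have "\<bar>snd (pt N l)\<bar> \<le> (1 - l) * \<bar>snd (V N)\<bar> + l * \<bar>snd (V (nx N))\<bar>"
      using that by (auto simp: pt_def abs_mult intro!: order_trans[OF abs_triangle_ineq])
    also have "\<dots> \<le> (1 - l) * D + l * D"
      using that VD nxR by (intro add_mono mult_left_mono) auto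
    finally show ?thesis by (simp add: algebra_simps)
  qed
  define c where "c = \<epsilon> / (2 * D + 1)"
  have c: "c > 0" using \<epsilon> D0 by (simp add: c_def)
  define Z where "Z = (\<Union>N\<in>{..<A R}. (\<lambda>l. (pt N l, sg * Y N l)) ` {0..1})"
  have compZ: "compact Z"
    unfolding Z_def
  proof (rule compact_UN)
    fix N assume "N \<in> {..<A R}"
    then have "len' (blk N) \<noteq> 0" using len'[OF blk(1), of N] by auto
    then have "continuous_on {0..1} (\<lambda>l. (pt N l, sg * Y N l))"
      unfolding pt_def Y_def
      by (intro continuous_intros continuous_on_compose2[OF continuous_on_stack_height[of UNIV]] ) auto
    then show "compact ((\<lambda>l. (pt N l, sg * Y N l)) ` {0..1})" by (rule compact_continuous_image) simp
  qed simp
  have monoZ: "c * (h - h') \<le> y - y'" if yy: "((x, h), y) \<in> Z" "((x, h'), y') \<in> Z" "h' \<le> h" for x h y h' y'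
  proof -
    obtain N l where N: "N < A R" "0 \<le> l" "l \<le> 1" "pt N l = (x, h)" "y = sg * Y N l"
      using yy(1) by (auto simp: Z_def)
    obtain N' l' where N': "N' < A R" "0 \<le> l'" "l' \<le> 1" "pt N' l' = (x, h')" "y' = sg * Y N' l'"
      using yy(2) by (auto simp: Z_def)
    show ?thesis
    proof (cases "h' = h")
      case True
      then have pe: "pt N l = pt N' l'" using N N' by simp
      have "Y N l = Y N' l'"
      proof (cases "N = N'")
        case eq: True
        have "(l - l') *\<^sub>R (V (nx N) - V N) = pt N l - pt N l'" by (simp add: pt_def algebra_simps)
        then have "l = l'" using neq[OF edge[OF N(1)]] pe eq by simp
        then show ?thesis using eq by simp
      next
        case False
        have com: "pt N l \<in> {V N, V (nx N)} \<inter> {V N', V (nx N')}"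
          using pt_common[OF N(1) N'(1) False N(2,3) N'(2,3) pe] .
        obtain M where M: "pt N l = V M" "M < A R" "Y N l = hN M" using pt_ends[OF N(1)] com by blast
        obtain M' where M': "pt N' l' = V M'" "M' < A R" "Y N' l' = hN M'" using pt_ends[OF N'(1), of l'] com pe by auto
        show ?thesis using V_inj[OF M(2) M'(2)] M M' pe by simp
      qed
      then show ?thesis using True N N' by simp
    next
      case False
      then have lt: "h' < h" using yy(3) by simp
      have cr: "(if f then Suc N < N' else Suc N' < N) \<and> nx N = Suc N \<and> nx N' = Suc N'"
        using crossing[OF N(1) N'(1) N(2,3) N'(2,3)] N(4) N'(4) lt by simp
      have "\<epsilon> \<le> y - y'"
      proof (cases f)
        case True
        then show ?thesis using cr \<epsilon>(2)[of "Suc N" N'] Y_between(1)[OF N(1) _ N(2,3)] Y_between(2)[OF N'(1) _ N'(2,3)]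
          N(5) N'(1,5) by (simp add: sg_def)
      next
        case F: False
        then show ?thesis using cr \<epsilon>(2)[of "Suc N'" N] Y_between(1)[OF N'(1) _ N'(2,3)] Y_between(2)[OF N(1) _ N(2,3)]
          N(1,5) N'(5) by (simp add: sg_def)
      qed
      moreover have "c * (h - h') \<le> \<epsilon>"
      proof -
        have "h - h' \<le> 2 * D + 1" using ptD[OF N(1-3)] ptD[OF N'(1-3)] N(4) N'(4) by simp
        then have "c * (h - h') \<le> c * (2 * D + 1)" using c by (intro mult_left_mono) auto
        also have "\<dots> = \<epsilon>" using D0 by (simp add: c_def)
        finally show ?thesis .
      qed
      ultimately show ?thesis by linarith
    qed
  qed
  have "\<exists>F. continuous_on UNIV F \<and> (\<forall>(P, y)\<in>Z. F P = y) \<and> (\<forall>x. strict_mono (\<lambda>h. F (x, h))) \<and>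
      (\<exists>Bd. \<forall>x h. \<bar>F (x, h) - c * h\<bar> \<le> Bd)"
    by (rule vertical_extension[OF compZ c]) (rule monoZ)
  then obtain F where F1: "continuous_on UNIV F" and F2: "\<forall>(P, y)\<in>Z. F P = y"
    and F3: "\<forall>x. strict_mono (\<lambda>h. F (x, h))" and F4: "\<exists>Bd. \<forall>x h. \<bar>F (x, h) - c * h\<bar> \<le> Bd"
    by (elim exE conjE) (rule that, assumption+, rule exI, assumption)
  from F4 obtain Bd where F4': "\<forall>x h. \<bar>F (x, h) - c * h\<bar> \<le> Bd" ..
  have F: "continuous_on UNIV F" "\<And>P y. (P, y) \<in> Z \<Longrightarrow> F P = y"
    "\<And>x. strict_mono (\<lambda>h. F (x, h))" "\<And>x h. \<bar>F (x, h) - c * h\<bar> \<le> Bd"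
    using F1 F2 F3 F4' by auto
  define \<Phi>V where "\<Phi>V p = (fst p, F p)" for p :: space
  have dV: "isotopic_to_identity \<Phi>V" unfolding \<Phi>V_def by (rule isotopic_to_identity_vertical[OF F(1,3) c F(4)])
  have \<Phi>V: "\<Phi>V (pt N l) = (fst (pt N l), sg * Y N l)" if "N < A R" "0 \<le> l" "l \<le> 1" for N l
  proof -
    have "(pt N l, sg * Y N l) \<in> Z" unfolding Z_def by (rule UN_I[of N]) (use that in auto)
    then show ?thesis using F(2) by (simp add: \<Phi>V_def)
  qed
  define u where "u N = (if f then to_C (v N) else cnj (to_C (v N)))" for N
  define ue where "ue N l = of_real (1 - l) * u N + of_real l * u (nx N)" for N and l :: real
  have ue_eq: "ue N l = (if f then to_C (fst (pt N l)) else cnj (to_C (fst (pt N l))))" if "N < A R" for N l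
    using V(2)[OF that] V(2)[OF nxR[OF that]]
    by (auto simp: ue_def u_def pt_def to_C_def complex_eq_iff)
  obtain \<Phi>1 where d1: "isotopic_to_identity \<Phi>1" and \<Phi>1: "\<And>N l. N < A R \<Longrightarrow> 0 \<le> l \<Longrightarrow> l \<le> 1 \<Longrightarrow> \<Phi>1 (pt N l) = (of_C (ue N l), Y N l)"
  proof (cases f)
    case True
    then show thesis using that[OF dV] \<Phi>V ue_eq by (simp add: sg_def)
  next
    case False
    define rx where "rx p = ((fst (fst p), snd p), - snd (fst p))" for p :: space
    have "isotopic_to_identity (rx \<circ> (rx \<circ> \<Phi>V))"
      using isotopic_to_identity_comp[OF isotopic_to_identity_comp[OF dV isotopic_to_identity_rotation_x] isotopic_to_identity_rotation_x]
      unfolding rx_def .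
    moreover have "(rx \<circ> (rx \<circ> \<Phi>V)) (pt N l) = (of_C (ue N l), Y N l)" if "N < A R" "0 \<le> l" "l \<le> 1" for N l
      using \<Phi>V[OF that] ue_eq[OF that(1)] False by (simp add: rx_def sg_def of_C_def to_C_def)
    ultimately show thesis by (rule that)
  qed

  \<comment> \<open>At each height a component now has a point \<open>p\<close> on its descending chain and a point \<open>q\<close> on its closing
     edge. They are different because the closing edge takes part in no crossing.\<close>
  define p where "p k s = polyline (\<lambda>j. u (nat j)) (real (A k) + s * len' k)" for k s
  define q where "q k s = of_real s * u (B k) + of_real (1 - s) * u (A k)" for k and s :: real
  have p_edge: "p k ((real N + l - real (A k)) / len' k) = of_real (1 - l) * u N + of_real l * u (Suc N)"
    if "k < R" "0 \<le> l" "l \<le> 1" for k N l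
  proof -
    have pos: "len' k > 0" using len'[OF that(1)] by simp
    have "real (A k) + (real N + l - real (A k)) / len' k * len' k = real N + l" using pos by simp
    then show ?thesis unfolding p_def using that polyline_between[of "int N" "real N + l" "\<lambda>j. u (nat j)"]
      by (simp add: scaleR_conv_of_real nat_add_distrib)
  qed
  have chain_le: "N < A R \<and> blk N = k \<and> nx N = Suc N \<and> N \<noteq> B k" if "k < R" "A k \<le> N" "N < B k" for k N
  proof -
    have "N < A (Suc k)" using B[OF that(1)] that by simp
    then have b: "blk N = k" using blk_eq[OF that(1,2)] by simp
    moreover have "N < A R" using that BR[OF that(1)] by simp
    ultimately show ?thesis using nx_chain[of N] that by simp
  qed
  have pq_neq: "p k s \<noteq> q k s" if k: "k < R" and s: "0 < s" "s < 1" for k s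
  proof
    assume eq: "p k s = q k s"
    define t where "t = real (A k) + s * len' k"
    have pos: "len' k > 0" using len'[OF k] by simp
    have t: "real (A k) \<le> t" "t < real (B k)"
    proof -
      show "real (A k) \<le> t" using s pos by (simp add: t_def)
      have "s * len' k < 1 * len' k" using s pos by (intro mult_strict_right_mono)
      then show "t < real (B k)" by (simp add: t_def len'_def)
    qed
    define N where "N = nat \<lfloor>t\<rfloor>"
    define l where "l = t - real N"
    have t0: "0 \<le> t" using t(1) by linarith
    have N: "real N \<le> t" "t < real N + 1" using t0 unfolding N_def by linarith+
    have "real (A k) < real N + 1" using t N by linarith
    moreover have "real N < real (B k)" using t N by linarith
    ultimately have "A k \<le> N" "N < B k" by linarith+
    note ch = chain_le[OF k this]
    have l: "0 \<le> l" "l \<le> 1" using N by (auto simp: l_def)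
    have "(real N + l - real (A k)) / len' k = s" using pos by (simp add: l_def t_def)
    then have "p k s = ue N l" using p_edge[OF k l, of N] ch by (simp add: ue_def)
    moreover have "q k s = ue (B k) (1 - s)" using nx_B[OF k] by (simp add: q_def ue_def)
    ultimately have "ue N l = ue (B k) (1 - s)" using eq by simp
    then have fe: "fst (pt N l) = fst (pt (B k) (1 - s))"
      unfolding ue_eq[OF BR[OF k]] using ue_eq[of N l] ch
      by (auto split: if_splits simp: to_C_def prod_eq_iff)
    have s': "0 \<le> 1 - s" "1 - s \<le> 1" using s by auto
    have nB: "nx (B k) \<noteq> Suc (B k)" using nx_B[OF k] B(1)[OF k] by simp
    consider "snd (pt N l) < snd (pt (B k) (1 - s))" | "snd (pt (B k) (1 - s)) < snd (pt N l)" | "snd (pt N l) = snd (pt (B k) (1 - s))"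
      by linarith
    then show False
    proof cases
      case 1
      then show False using crossing[OF BR[OF k] _ s' l fe[symmetric]] ch nB by blast
    next
      case 2
      then show False using crossing[OF _ BR[OF k] l s' fe] ch nB by blast
    next
      case 3
      then have "pt N l = pt (B k) (1 - s)" using fe by (simp add: prod_eq_iff)
      then have "pt (B k) (1 - s) \<in> {V (B k), V (nx (B k))}"
        using pt_common[OF _ BR[OF k] _ l s'] ch by auto
      then show False using pt_V[OF BR[OF k], of "1 - s"] pt_V'[OF BR[OF k], of "1 - s"] s by auto
    qed
  qed
  have "\<exists>\<Psi>. isotopic_to_identity \<Psi> \<and> (\<forall>k<R. \<forall>s\<in>{0..1}. 
     \<Psi> (of_C (p k s), stack_height k s) = (of_C (- of_real (stack_width s)), stack_height k s) \<and>
     \<Psi> (of_C (q k s), stack_height k s) = (of_C (of_real (stack_width s)), stack_height k s))"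
  proof (rule straighten_stack)
    fix k assume k: "k < R"
    have pos: "len' k > 0" using len'[OF k] by simp
    show cp: "continuous_on {0..1} (p k)"
      unfolding p_def by (intro continuous_on_compose2[OF continuous_on_polyline[of UNIV]] continuous_intros) auto
    show cq: "continuous_on {0..1} (q k)" unfolding q_def by (intro continuous_intros)
    show "\<exists>\<alpha>. continuous_on {0..1} \<alpha> \<and> (\<forall>s\<in>{0..1}. \<alpha> s \<noteq> 0 \<and> \<alpha> s * (p k s - q k s) = of_real (s * (1 - s)))"
    proof (rule quotient_of_width[where \<delta> = "1 / len' k"])
      show "continuous_on {0..1} (\<lambda>s. p k s - q k s)" by (intro continuous_intros cp cq)
      show "0 < 1 / len' k" "1 / len' k \<le> 1 / 2" using len'[OF k] by auto
      show "p k s - q k s = of_real s * (of_real (len' k) * (u (Suc (A k)) - u (A k)) - (u (B k) - u (A k)))"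
        if s: "0 \<le> s" "s \<le> 1 / len' k" for s
      proof -
        have "s * len' k \<le> 1" using s pos by (simp add: field_simps)
        then have "p k s = of_real (1 - s * len' k) * u (A k) + of_real (s * len' k) * u (Suc (A k))"
          using p_edge[OF k, of "s * len' k" "A k"] s pos by simp
        then show ?thesis by (simp add: q_def algebra_simps)
      qed
      show "p k s - q k s = of_real (1 - s) * (of_real (len' k) * (u (B k - 1) - u (B k)) - (u (A k) - u (B k)))"
        if s: "1 - 1 / len' k \<le> s" "s \<le> 1" for s
      proof -
        define l where "l = 1 - (1 - s) * len' k"
        have "(1 - s) * len' k \<le> 1" using s pos by (simp add: field_simps)
        then have l: "0 \<le> l" "l \<le> 1" using s pos by (auto simp: l_def)
        have B1: "real (B k - 1) = real (B k) - 1" "Suc (B k - 1) = B k" using B(1)[OF k] by auto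
        have "real (B k - 1) + l - real (A k) = s * len' k" unfolding B1 l_def by (simp add: len'_def algebra_simps)
        then have "p k s = of_real (1 - l) * u (B k - 1) + of_real l * u (B k)"
          using p_edge[OF k l, of "B k - 1"] pos B1 by simp
        then show ?thesis by (simp add: q_def l_def algebra_simps)
      qed
    qed (use pq_neq[OF k] in simp)
  qed
  then obtain \<Psi> where d\<Psi>: "isotopic_to_identity \<Psi>"
    and \<Psi>p: "\<And>k s. k < R \<Longrightarrow> 0 \<le> s \<Longrightarrow> s \<le> 1 \<Longrightarrow> \<Psi> (of_C (p k s), stack_height k s) = (of_C (- of_real (stack_width s)), stack_height k s)"
    and \<Psi>q: "\<And>k s. k < R \<Longrightarrow> 0 \<le> s \<Longrightarrow> s \<le> 1 \<Longrightarrow> \<Psi> (of_C (q k s), stack_height k s) = (of_C (of_real (stack_width s)), stack_height k s)"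
    by (metis atLeastAtMost_iff)

  \<comment> \<open>Two quarter turns lay the stack down along the first axis, with the closing edges on the upper half
     circles.\<close>
  define \<rho> where "\<rho> p = ((- snd p, fst (fst p)), - snd (fst p))" for p :: space
  have d\<rho>: "isotopic_to_identity \<rho>"
    using isotopic_to_identity_comp[OF isotopic_to_identity_rotation_y isotopic_to_identity_rotation_x] unfolding \<rho>_def comp_def by simp
  define \<Phi> where "\<Phi> = \<rho> \<circ> (\<Psi> \<circ> \<Phi>1)"
  have d\<Phi>: "isotopic_to_identity \<Phi>" unfolding \<Phi>_def by (intro isotopic_to_identity_comp d1 d\<Psi> d\<rho>)
  have \<rho>: "\<rho> (of_C (of_real a), stack_height k s) = (of_C (of_real (3 * real k) + Complex (- (stack_height k s + 3 * real k)) a), 0)" for a k s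
    by (simp add: \<rho>_def of_C_def)
  have \<Phi>_chain: "\<exists>s\<ge>0. s \<le> 1 \<and> \<Phi> (pt N l) = (of_C (of_real (3 * real (blk N)) + Complex (- (stack_height (blk N) s + 3 * real (blk N))) (- stack_width s)), 0)"
    if N: "N < A R" "N \<noteq> B (blk N)" and l: "0 \<le> l" "l \<le> 1" for N l
  proof -
    define k where "k = blk N"
    define s where "s = (real N + l - real (A k)) / len' k"
    have k: "k < R" using blk[OF N(1)] by (simp add: k_def)
    have pos: "len' k > 0" using len'[OF k] by simp
    have nN: "nx N = Suc N" "N < B k" "A k \<le> N"
      using nx_chain[OF N] blk[OF N(1)] B(2)[OF k] N(2) by (auto simp: k_def)
    have s: "0 \<le> s" "s \<le> 1" using nN l pos by (auto simp: s_def len'_def)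
    have "Y N l = stack_height k s" unfolding Y_def s_def k_def[symmetric] nN(1) by (simp add: algebra_simps)
    moreover have "ue N l = p k s" unfolding s_def using p_edge[OF k l, of N] nN(1) by (simp add: ue_def)
    ultimately have "\<Phi> (pt N l) = \<rho> (\<Psi> (of_C (p k s), stack_height k s))" using \<Phi>1[OF N(1) l] by (simp add: \<Phi>_def)
    also have "\<dots> = (of_C (of_real (3 * real k) + Complex (- (stack_height k s + 3 * real k)) (- stack_width s)), 0)"
      using \<rho>[of "- stack_width s" k s] \<Psi>p[OF k s] by simp
    finally show ?thesis using s unfolding k_def by blast
  qed
  have \<Phi>_closing: "\<Phi> (pt (B k) (1 - s)) = (of_C (of_real (3 * real k) + Complex (- (stack_height k s + 3 * real k)) (stack_width s)), 0)"
    if k: "k < R" and s: "0 \<le> s" "s \<le> 1" for k s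
  proof -
    have pos: "len' k > 0" using len'[OF k] by simp
    have "(1 - (1 - s)) * real (B k) + (1 - s) * real (A k) - real (A k) = s * len' k" by (simp add: len'_def algebra_simps)
    then have "Y (B k) (1 - s) = stack_height k s" unfolding Y_def blkB[OF k] nx_B[OF k] using pos by simp
    moreover have "ue (B k) (1 - s) = q k s" unfolding q_def ue_def nx_B[OF k] by simp
    ultimately have "\<Phi> (pt (B k) (1 - s)) = \<rho> (\<Psi> (of_C (q k s), stack_height k s))" using \<Phi>1[OF BR[OF k], of "1 - s"] s by (simp add: \<Phi>_def)
    then show ?thesis using \<rho>[of "stack_width s" k s] \<Psi>q[OF k s] by simp
  qed
  have unit: "norm (Complex (- (stack_height k s + 3 * real k)) a) = 1" if "0 \<le> s" "s \<le> 1" "a\<^sup>2 = (stack_width s)\<^sup>2" for k s a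
    using stack_circle[OF that(1,2), of k] that(3) by (simp add: cmod_def power2_minus[of "stack_height k s + 3 * real k", simplified])
  show ?thesis
  proof (rule unlink_of_circles[OF link C(2) _ d\<Phi> R])
    show "disjoint_loops C" using C(1) by (simp add: parametrises_def)
    note C1 = C(1)[unfolded parametrises_def, THEN conjunct2]
    have rng: "(\<Union>\<gamma>\<in>C. range \<gamma>) = (\<Union>(p, q)\<in>E. closed_segment p q)"
      by (rule conjunct1[OF C1])
    have tr: "\<forall>(p, q)\<in>E. \<exists>\<gamma>\<in>C. \<exists>u v. u \<le> v \<and> \<gamma> u = p \<and> \<gamma> v = q \<and> \<gamma> ` {u..v} = closed_segment p q"
      by (rule conjunct2[OF C1])
    have traced: "\<exists>\<gamma>\<in>C. \<exists>u v. u \<le> v \<and> \<gamma> u = p \<and> \<gamma> v = q \<and> \<gamma> ` {u..v} = closed_segment p q" if "(p, q) \<in> E" for p q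
      using bspec[OF tr that] by (simp only: prod.case)
    show "\<exists>k<R. \<Phi> (\<gamma> t) \<in> range (unlink_circle k)" if "\<gamma> \<in> C" for \<gamma> t
    proof -
      have "\<gamma> t \<in> (\<Union>(p, q)\<in>E. closed_segment p q)" unfolding rng[symmetric] using that by blast
      then obtain p q where "(p, q) \<in> E" "\<gamma> t \<in> closed_segment p q" by blast
      then obtain N where N: "N < A R" "\<gamma> t \<in> closed_segment (V N) (V (nx N))" using edge_cases by blast
      then obtain l where l: "0 \<le> l" "l \<le> 1" "\<gamma> t = pt N l" unfolding seg by auto
      have "\<Phi> (pt N l) \<in> range (unlink_circle (blk N))"
      proof (cases "N = B (blk N)")
        case True
        then show ?thesis
          using \<Phi>_closing[OF blk(1)[OF N(1)], of "1 - l"] l unit[of "1 - l" "stack_width (1 - l)"]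
          unfolding range_unlink_circle by auto
      next
        case False
        then obtain s where "0 \<le> s" "s \<le> 1" "\<Phi> (pt N l) = (of_C (of_real (3 * real (blk N)) + Complex (- (stack_height (blk N) s + 3 * real (blk N))) (- stack_width s)), 0)"
          using \<Phi>_chain[OF N(1) _ l(1,2)] by blast
        then show ?thesis using unit[of s "- stack_width s"] unfolding range_unlink_circle by auto
      qed
      then show ?thesis using blk(1)[OF N(1)] l(3) by auto
    qed
    fix k assume k: "k < R"
    obtain \<gamma> a b where \<gamma>: "\<gamma> \<in> C" "a \<le> b" "\<gamma> a = V (B k)" "\<gamma> ` {a..b} = closed_segment (V (B k)) (V (nx (B k)))"
      using traced[OF edge[OF BR[OF k]]] by blast
    have start: "\<Phi> (\<gamma> a) = unlink_circle k 0"
    proof -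
      have "\<gamma> a = pt (B k) (1 - 1)" using \<gamma>(3) by (simp add: pt_def)
      then show ?thesis using \<Phi>_closing[OF k, of 1] by (simp add: stack_width_def stack_height_def unlink_circle_def of_C_def)
    qed
    have "(\<Phi> \<circ> \<gamma>) ` {a..b} = (\<lambda>l. \<Phi> (pt (B k) l)) ` {0..1}"
      unfolding image_comp[symmetric] \<gamma>(4) seg image_image ..
    also have "\<dots> = half_circle k"
    proof
      show "(\<lambda>l. \<Phi> (pt (B k) l)) ` {0..1} \<subseteq> half_circle k"
      proof
        fix P assume "P \<in> (\<lambda>l. \<Phi> (pt (B k) l)) ` {0..1}"
        then obtain l where l: "0 \<le> l" "l \<le> 1" "P = \<Phi> (pt (B k) (1 - (1 - l)))" by auto
        have "stack_width (1 - l) \<ge> 0" using l by (simp add: stack_width_def)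
        then show "P \<in> half_circle k"
          unfolding l(3) half_circle_def using \<Phi>_closing[OF k, of "1 - l"] unit[of "1 - l" "stack_width (1 - l)" k] l by auto
      qed
      show "half_circle k \<subseteq> (\<lambda>l. \<Phi> (pt (B k) l)) ` {0..1}"
      proof
        fix P assume "P \<in> half_circle k"
        then obtain z where z: "norm z = 1" "Im z \<ge> 0" "P = (of_C (of_real (3 * real k) + z), 0)"
          unfolding half_circle_def by auto
        have "\<bar>Re z\<bar> \<le> 1" using abs_Re_le_cmod[of z] z(1) by simp
        then obtain s where s: "0 \<le> s" "s \<le> 1" "stack_height k s = - Re z - 3 * real k"
          using stack_height_surj[of "- Re z" k] by (auto simp: abs_le_iff)
        have "(Re z)\<^sup>2 + (Im z)\<^sup>2 = 1" using z(1) by (simp add: cmod_def)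
        then have "(stack_width s)\<^sup>2 = (Im z)\<^sup>2" using stack_circle[OF s(1,2), of k] s(3) by simp
        moreover have "stack_width s \<ge> 0" using s by (simp add: stack_width_def)
        ultimately have "stack_width s = Im z" using z(2) by (simp add: power2_eq_iff_nonneg)
        then have "Complex (- (stack_height k s + 3 * real k)) (stack_width s) = z" using s(3) by (simp add: complex_eq_iff)
        then have "P = \<Phi> (pt (B k) (1 - s))" using \<Phi>_closing[OF k s(1,2)] z(3) by simp
        then show "P \<in> (\<lambda>l. \<Phi> (pt (B k) l)) ` {0..1}" using s by auto
      qed
    qed
    finally show "\<exists>\<gamma>\<in>C. \<exists>u v. u \<le> v \<and> \<Phi> (\<gamma> u) = unlink_circle k 0 \<and> (\<Phi> \<circ> \<gamma>) ` {u..v} = half_circle k"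
      using \<gamma>(1,2) start by blast
  qed
qed

section \<open>Links with a given diagram\<close>

lemma polygonal_link_realised:
  assumes "polygonal_link E"
  shows "\<exists>L. oriented_link L \<and> isotopic_to_polygonal L E"
proof -
  obtain C where C: "parametrises C E" using polygonal_link_parametrisable[OF assms] by blast
  define L where "L = (\<lambda>\<gamma>. to_S3 \<circ> \<gamma>) ` C"
  have iso: "isotopic_to_polygonal L E"
    unfolding isotopic_to_polygonal_def using assms C isotopic_refl L_def by blast
  have dC: "disjoint_loops C" using C by (simp add: parametrises_def)
  have "disjoint_loops L"
    unfolding disjoint_loops_def
  proof (intro conjI ballI)
    show "finite L" "L \<noteq> {}" using dC by (auto simp: L_def disjoint_loops_def)
    show "simple_loop \<gamma>" if \<gamma>: "\<gamma> \<in> L" for \<gamma>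
    proof -
      obtain \<delta> where \<delta>: "\<delta> \<in> C" "\<gamma> = to_S3 \<circ> \<delta>" using \<gamma> unfolding L_def by blast
      then have sd: "continuous_on UNIV \<delta>" "\<And>s t. \<delta> s = \<delta> t \<longleftrightarrow> s - t \<in> \<int>"
        using dC by (auto simp: disjoint_loops_def simple_loop_def)
      have "continuous_on UNIV (to_S3 \<circ> \<delta>)"
        by (rule continuous_on_compose[OF sd(1) continuous_on_to_S3])
      then show ?thesis
        using sd(2) inj_to_S3 unfolding simple_loop_def \<delta>(2) by (simp add: inj_eq)
    qed
    show "disjoint_family_on range L"
      unfolding disjoint_family_on_def
    proof (intro ballI impI)
      fix \<gamma>1 \<gamma>2 assume a: "\<gamma>1 \<in> L" "\<gamma>2 \<in> L" "\<gamma>1 \<noteq> \<gamma>2"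
      then obtain \<delta>1 \<delta>2 where d: "\<delta>1 \<in> C" "\<delta>2 \<in> C" "\<gamma>1 = to_S3 \<circ> \<delta>1" "\<gamma>2 = to_S3 \<circ> \<delta>2" unfolding L_def by blast
      have "disjoint_family_on range C" using dC by (simp add: disjoint_loops_def)
      then have "range \<delta>1 \<inter> range \<delta>2 = {}"
        by (rule disjoint_family_onD[OF _ d(1,2)]) (use a(3) d in auto)
      then show "range \<gamma>1 \<inter> range \<gamma>2 = {}"
        unfolding d(3,4) image_comp[symmetric] using inj_to_S3 by (metis image_Int image_empty)
    qed
  qed
  moreover have "range \<gamma> \<subseteq> S3" if "\<gamma> \<in> L" for \<gamma>
  proof -
    from that obtain \<delta> where "\<gamma> = to_S3 \<circ> \<delta>" unfolding L_def by (rule imageE)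
    then show ?thesis using to_S3_in_S3 by (simp only: image_subset_iff comp_apply) blast
  qed
  ultimately have "oriented_link L"
    unfolding oriented_link_def using iso by blast
  then show ?thesis using iso by blast
qed

text \<open>Vertices are lifted by a height function \<open>\<eta>\<close> on the plane. It is enough to
know where edges meet in the plane, that crossing edges are lifted in the right order, and that each edge
crosses at most one other edge; the latter excludes triple points.\<close>

lemma diagram_lift:
  fixes D :: "plane_edge set" and \<eta> :: "plane \<Rightarrow> real"
  assumes fin: "finite D" "D \<noteq> {}" and neq: "\<And>p q. (p, q) \<in> D \<Longrightarrow> p \<noteq> q"
    and inj: "inj_on fst D" "inj_on snd D" and fs: "fst ` D = snd ` D"
    and meet: "\<And>p q p' q' P. (p, q) \<in> D \<Longrightarrow> (p', q') \<in> D \<Longrightarrow> (p, q) \<noteq> (p', q') \<Longrightarrow>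
        P \<in> closed_segment p q \<Longrightarrow> P \<in> closed_segment p' q' \<Longrightarrow>
        P \<in> {p, q} \<inter> {p', q'} \<or> 
        (P \<notin> {p, q} \<and> P \<notin> {p', q'} \<and> (((p, q), (p', q')) \<in> X \<or> ((p', q'), (p, q)) \<in> X))"
    and XD: "\<And>e e'. (e, e') \<in> X \<Longrightarrow> e \<in> D \<and> e' \<in> D"
    and Xl: "\<And>p q p' q'. ((p, q), (p', q')) \<in> X \<Longrightarrow>
        \<exists>l l'. 0 \<le> l \<and> l \<le> 1 \<and> 0 \<le> l' \<and> l' \<le> 1 \<and> (1 - l) *\<^sub>R p + l *\<^sub>R q = (1 - l') *\<^sub>R p' + l' *\<^sub>R q'"
    and Xh: "\<And>p q p' q' l l'. ((p, q), (p', q')) \<in> X \<Longrightarrow> 0 \<le> l \<Longrightarrow> l \<le> 1 \<Longrightarrow> 0 \<le> l' \<Longrightarrow> l' \<le> 1 \<Longrightarrow>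
        (1 - l) *\<^sub>R p + l *\<^sub>R q = (1 - l') *\<^sub>R p' + l' *\<^sub>R q' \<Longrightarrow>
        (1 - l') * \<eta> p' + l' * \<eta> q' < (1 - l) * \<eta> p + l * \<eta> q"
    and Xu: "\<And>e e' e''. (e, e') \<in> X \<or> (e', e) \<in> X \<Longrightarrow> (e, e'') \<in> X \<or> (e'', e) \<in> X \<Longrightarrow> e' = e''"
  shows "\<exists>E. polygonal_link E \<and> regular_projection E \<and> diagram_of E = (D, X)"
proof -
  define up where "up p = (p, \<eta> p)" for p :: plane
  define E where "E = (\<lambda>(p, q). (up p, up q)) ` D"
  have fst_up [simp]: "fst (up p) = p" for p by (simp add: up_def)
  have up_inj: "up p = up q \<longleftrightarrow> p = q" for p q by (auto simp: up_def)
  have E_iff: "(P, Q) \<in> E \<longleftrightarrow> (\<exists>p q. (p, q) \<in> D \<and> P = up p \<and> Q = up q)" for P Q by (auto simp: E_def)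
  have E_up: "(up p, up q) \<in> E \<longleftrightarrow> (p, q) \<in> D" for p q unfolding E_iff up_inj by blast
  have E_obt: "\<exists>p q. e = (up p, up q) \<and> (p, q) \<in> D" if "e \<in> E" for e
    using that E_iff[of "fst e" "snd e"] by (simp add: prod_eq_iff)
  have seg: "(x, h) \<in> closed_segment (up p) (up q) \<longleftrightarrow>
      (\<exists>l. 0 \<le> l \<and> l \<le> 1 \<and> x = (1 - l) *\<^sub>R p + l *\<^sub>R q \<and> h = (1 - l) * \<eta> p + l * \<eta> q)" for x h p q
    unfolding closed_segment_def up_def by auto
  have segp: "x \<in> closed_segment p q \<longleftrightarrow> (\<exists>l. 0 \<le> l \<and> l \<le> 1 \<and> x = (1 - l) *\<^sub>R p + l *\<^sub>R q)" for x and p q :: plane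
    unfolding closed_segment_def by auto
  have proj: "x \<in> closed_segment p q" if "(x, h) \<in> closed_segment (up p) (up q)" for x h p q
    using that unfolding seg segp by blast
  have vertex: "h = \<eta> x" if D: "(p, q) \<in> D" and xh: "(x, h) \<in> closed_segment (up p) (up q)" and x: "x \<in> {p, q}" for x h p q
  proof -
    obtain l where l: "x = (1 - l) *\<^sub>R p + l *\<^sub>R q" "h = (1 - l) * \<eta> p + l * \<eta> q" using xh unfolding seg by blast
    have "x - p = l *\<^sub>R (q - p)" "x - q = (1 - l) *\<^sub>R (p - q)" unfolding l by (simp_all add: algebra_simps)
    then have "(x = p \<and> l = 0) \<or> (x = q \<and> l = 1)" using x neq[OF D] by auto
    then show ?thesis using l by auto
  qed
  have cross: "h' < h" if X: "((p, q), (p', q')) \<in> X" and "(x, h) \<in> closed_segment (up p) (up q)" "(x, h') \<in> closed_segment (up p') (up q')"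
    for p q p' q' x h h'
    using that(2,3) Xh[OF X] unfolding seg by blast
  have "polygonal_link E"
    unfolding polygonal_link_def
  proof (intro conjI)
    show "finite E" "E \<noteq> {}" using fin by (auto simp: E_def)
    show "\<forall>(p, q)\<in>E. p \<noteq> q"
    proof (rule ballI)
      fix e assume "e \<in> E"
      then obtain p q where "e = (up p, up q)" "(p, q) \<in> D" using E_obt by blast
      then show "case e of (p, q) \<Rightarrow> p \<noteq> q" using neq by (simp add: up_inj)
    qed
    have f: "fst ` E = up ` fst ` D" "snd ` E = up ` snd ` D" by (force simp: E_def image_iff)+
    then show "fst ` E = snd ` E" using fs by simp
    show "inj_on fst E"
    proof (rule inj_onI)
      fix e e' assume "e \<in> E" "e' \<in> E" "fst e = fst e'"
      then show "e = e'" using E_obt[of e] E_obt[of e'] inj_onD[OF inj(1)] up_inj by (metis fst_conv snd_conv)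
    qed
    show "inj_on snd E"
    proof (rule inj_onI)
      fix e e' assume "e \<in> E" "e' \<in> E" "snd e = snd e'"
      then show "e = e'" using E_obt[of e] E_obt[of e'] inj_onD[OF inj(2)] up_inj by (metis fst_conv snd_conv)
    qed
    have key: "closed_segment (fst e) (snd e) \<inter> closed_segment (fst e') (snd e') \<subseteq> {fst e, snd e} \<inter> {fst e', snd e'}"
      if ee: "e \<in> E" "e' \<in> E" "e \<noteq> e'" for e e'
    proof
      obtain p q where e: "e = (up p, up q)" "(p, q) \<in> D" using E_obt[OF ee(1)] by blast
      obtain p' q' where e': "e' = (up p', up q')" "(p', q') \<in> D" using E_obt[OF ee(2)] by blast
      have ne: "(p, q) \<noteq> (p', q')" using ee(3) e(1) e'(1) by blast
      fix z assume "z \<in> closed_segment (fst e) (snd e) \<inter> closed_segment (fst e') (snd e')"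
      then have z: "z \<in> closed_segment (up p) (up q)" "z \<in> closed_segment (up p') (up q')" using e(1) e'(1) by auto
      obtain x h where zx: "z = (x, h)" by (cases z)
      have in1: "(x, h) \<in> closed_segment (up p) (up q)" and in2: "(x, h) \<in> closed_segment (up p') (up q')" using z zx by auto
      have "\<not> (((p, q), (p', q')) \<in> X \<or> ((p', q'), (p, q)) \<in> X)"
        using cross[OF _ in1 in2] cross[OF _ in2 in1] by blast
      then have x: "x \<in> {p, q} \<inter> {p', q'}" using meet[OF e(2) e'(2) ne proj[OF in1] proj[OF in2]] by blast
      then have "h = \<eta> x" using vertex[OF e(2) in1] by blast
      then have "z = up x" by (simp add: zx up_def)
      then show "z \<in> {fst e, snd e} \<inter> {fst e', snd e'}" using x e(1) e'(1) by auto
    qed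
    show "\<forall>(p, q)\<in>E. \<forall>(p', q')\<in>E. (p, q) \<noteq> (p', q') \<longrightarrow>
        closed_segment p q \<inter> closed_segment p' q' \<subseteq> {p, q} \<inter> {p', q'}"
      unfolding case_prod_beta prod.collapse using key by blast
  qed
  moreover have "regular_projection E"
    unfolding regular_projection_def
  proof (intro conjI ballI impI)
    show "case e of (p, q) \<Rightarrow> fst p \<noteq> fst q" if "e \<in> E" for e
      using E_obt[OF that] neq by (auto simp only: prod.case fst_up)
    show "case e of (p, q) \<Rightarrow> fst v \<in> closed_segment (fst p) (fst q) \<longrightarrow> v = p \<or> v = q"
      if asm: "v \<in> fst ` E" "e \<in> E" for v e
    proof -
      obtain p q where e: "e = (up p, up q)" "(p, q) \<in> D" using E_obt[OF asm(2)] by blast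
      obtain e' where "e' \<in> E" "v = fst e'" using asm(1) by blast
      then obtain p' q' where v: "v = up p'" "(p', q') \<in> D" using E_obt[of e'] by auto
      have "p' = p \<or> p' = q" if "p' \<in> closed_segment p q"
      proof (cases "(p, q) = (p', q')")
        case False
        show ?thesis using meet[OF e(2) v(2) False that] by auto
      qed simp
      then show ?thesis unfolding e v by (simp add: up_inj)
    qed
    fix e1 e2 e3 assume e: "e1 \<in> E" "e2 \<in> E" "e3 \<in> E" and d: "e1 \<noteq> e2 \<and> e1 \<noteq> e3 \<and> e2 \<noteq> e3"
    obtain p1 q1 where e1: "e1 = (up p1, up q1)" "(p1, q1) \<in> D" using E_obt[OF e(1)] by blast
    obtain p2 q2 where e2: "e2 = (up p2, up q2)" "(p2, q2) \<in> D" using E_obt[OF e(2)] by blast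
    obtain p3 q3 where e3: "e3 = (up p3, up q3)" "(p3, q3) \<in> D" using E_obt[OF e(3)] by blast
    have d12: "(p1, q1) \<noteq> (p2, q2)" and d13: "(p1, q1) \<noteq> (p3, q3)" and d23: "(p2, q2) \<noteq> (p3, q3)"
      using d e1 e2 e3 by auto
    have "False" if P: "P \<in> closed_segment p1 q1" "P \<in> closed_segment p2 q2" "P \<in> closed_segment p3 q3" for P
    proof -
      note m12 = meet[OF e1(2) e2(2) d12 P(1) P(2)] and m13 = meet[OF e1(2) e3(2) d13 P(1) P(3)]
        and m23 = meet[OF e2(2) e3(2) d23 P(2) P(3)]
      show False
      proof (cases "P \<in> {p1, q1}")
        case True
        then have "P \<in> {p2, q2}" "P \<in> {p3, q3}" using m12 m13 by blast+
        then have "(p1 = p2 \<or> p1 = p3 \<or> p2 = p3) \<or> (q1 = q2 \<or> q1 = q3 \<or> q2 = q3)" using True by auto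
        then show False
          using inj_onD[OF inj(1), of "(p1, q1)"] inj_onD[OF inj(1), of "(p2, q2)"]
            inj_onD[OF inj(2), of "(p1, q1)"] inj_onD[OF inj(2), of "(p2, q2)"] e1(2) e2(2) e3(2) d12 d13 d23
          by (metis fst_conv snd_conv)
      next
        case False
        then show False using m12 m13 Xu[of "(p1, q1)" "(p2, q2)" "(p3, q3)"] d23 by blast
      qed
    qed
    then show "closed_segment (fst (fst e1)) (fst (snd e1)) \<inter> closed_segment (fst (fst e2)) (fst (snd e2)) \<inter>
        closed_segment (fst (fst e3)) (fst (snd e3)) = {}"
      unfolding e1 e2 e3 by auto
  qed
  moreover have "diagram_of E = (D, X)"
  proof -
    have "{(fst p, fst q) | p q. (p, q) \<in> E} = D"
    proof
      show "{(fst p, fst q) | p q. (p, q) \<in> E} \<subseteq> D"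
      proof
        fix e assume "e \<in> {(fst p, fst q) | p q. (p, q) \<in> E}"
        then obtain P Q where PQ: "e = (fst P, fst Q)" "(P, Q) \<in> E" by blast
        then obtain p q where "(p, q) \<in> D" "P = up p" "Q = up q" unfolding E_iff by blast
        then show "e \<in> D" using PQ(1) by simp
      qed
      show "D \<subseteq> {(fst p, fst q) | p q. (p, q) \<in> E}"
      proof
        fix e assume "e \<in> D"
        then show "e \<in> {(fst p, fst q) | p q. (p, q) \<in> E}"
          using E_up[of "fst e" "snd e"] by (intro CollectI exI[of _ "up (fst e)"] exI[of _ "up (snd e)"]) simp
      qed
    qed
    moreover have "{((fst p, fst q), (fst p', fst q')) | p q p' q'. (p, q) \<in> E \<and> (p', q') \<in> E \<and>
         (\<exists>x h h'. (x, h) \<in> closed_segment p q \<and> (x, h') \<in> closed_segment p' q' \<and> h' < h)} = X" (is "?S = X")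
    proof
      show "?S \<subseteq> X"
      proof
        fix c assume "c \<in> ?S"
        then obtain P Q P' Q' x h h' where C: "c = ((fst P, fst Q), (fst P', fst Q'))" "(P, Q) \<in> E" "(P', Q') \<in> E"
          "(x, h) \<in> closed_segment P Q" "(x, h') \<in> closed_segment P' Q'" "h' < h" by blast
        obtain p q where pq: "(p, q) \<in> D" "P = up p" "Q = up q" using C(2) unfolding E_iff by blast
        obtain p' q' where pq': "(p', q') \<in> D" "P' = up p'" "Q' = up q'" using C(3) unfolding E_iff by blast
        have c: "c = ((p, q), (p', q'))" "(p, q) \<in> D" "(p', q') \<in> D"
          "(x, h) \<in> closed_segment (up p) (up q)" "(x, h') \<in> closed_segment (up p') (up q')" "h' < h"
          using C pq pq' by simp_all
        have ne: "(p, q) \<noteq> (p', q')"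
        proof
          assume eq: "(p, q) = (p', q')"
          obtain l where l: "x = (1 - l) *\<^sub>R p + l *\<^sub>R q" "h = (1 - l) * \<eta> p + l * \<eta> q" using c(4) unfolding seg by blast
          obtain l' where l': "x = (1 - l') *\<^sub>R p + l' *\<^sub>R q" "h' = (1 - l') * \<eta> p + l' * \<eta> q"
            using c(5) eq unfolding seg by auto
          have "(l - l') *\<^sub>R (q - p) = x - x" unfolding l(1) by (subst (2) l(1)[symmetric], subst l'(1)) (simp add: algebra_simps)
          then have "l = l'" using neq[OF c(2)] by simp
          then show False using l l' c(6) by simp
        qed
        have "\<not> x \<in> {p, q} \<inter> {p', q'}" using vertex[OF c(2,4)] vertex[OF c(3,5)] c(6) by auto
        moreover have "((p', q'), (p, q)) \<notin> X" using cross[OF _ c(5,4)] c(6) by (meson less_asym)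
        ultimately have "((p, q), (p', q')) \<in> X" using meet[OF c(2,3) ne proj[OF c(4)] proj[OF c(5)]] by blast
        then show "c \<in> X" using c(1) by simp
      qed
      show "X \<subseteq> ?S"
      proof
        fix c assume cX: "c \<in> X"
        obtain p q p' q' where c: "c = ((p, q), (p', q'))" by (metis surj_pair)
        have X: "((p, q), (p', q')) \<in> X" using cX c by simp
        obtain l l' where l: "0 \<le> l" "l \<le> 1" "0 \<le> l'" "l' \<le> 1" "(1 - l) *\<^sub>R p + l *\<^sub>R q = (1 - l') *\<^sub>R p' + l' *\<^sub>R q'"
          using Xl[OF X] by blast
        have "((1 - l) *\<^sub>R p + l *\<^sub>R q, (1 - l) * \<eta> p + l * \<eta> q) \<in> closed_segment (up p) (up q)"
          "((1 - l) *\<^sub>R p + l *\<^sub>R q, (1 - l') * \<eta> p' + l' * \<eta> q') \<in> closed_segment (up p') (up q')"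
          unfolding seg using l by blast+
        moreover have "(1 - l') * \<eta> p' + l' * \<eta> q' < (1 - l) * \<eta> p + l * \<eta> q" by (rule Xh[OF X l])
        moreover have "(up p, up q) \<in> E" "(up p', up q') \<in> E" using XD[OF X] E_up by auto
        ultimately have "(up p, up q) \<in> E \<and> (up p', up q') \<in> E \<and>
            (\<exists>x h h'. (x, h) \<in> closed_segment (up p) (up q) \<and> (x, h') \<in> closed_segment (up p') (up q') \<and> h' < h)"
          by blast
        then show "c \<in> ?S"
          unfolding c mem_Collect_eq
          by - (rule exI[of _ "up p"], rule exI[of _ "up q"], rule exI[of _ "up p'"], rule exI[of _ "up q'"],
              simp only: fst_up simp_thms)
      qed
    qed
    ultimately show ?thesis unfolding diagram_of_def by simp
  qed
  ultimately show ?thesis by blast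
qed

section \<open>Diagrams of partial braid words\<close>

text \<open>Smoothing a crossing leaves a level without any crossing, which is
\<open>None\<close>.\<close>

type_synonym partial_word = "(nat \<times> bool) option list"

definition strand_step :: "(nat \<times> bool) option \<Rightarrow> nat \<Rightarrow> nat" where
  "strand_step x j = (case x of None \<Rightarrow> j | Some (i, \<epsilon>) \<Rightarrow> if j = i then i + 1 else if j = i + 1 then i else j)"

definition partial_word_on :: "nat \<Rightarrow> partial_word \<Rightarrow> bool" where
  "partial_word_on s W \<longleftrightarrow> s \<ge> 1 \<and> (\<forall>i \<epsilon>. Some (i, \<epsilon>) \<in> set W \<longrightarrow> 1 \<le> i \<and> i < s)"

definition strand_edge :: "partial_word \<Rightarrow> nat \<Rightarrow> nat \<Rightarrow> plane_edge" where
  "strand_edge W k j = (grid j k, grid (strand_step (W ! k) j) (k + 1))"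

text \<open>The closing arc of position \<open>j\<close> has the vertices number 0 to 5, of which the
first and the last one lie on the braid, at its top and its bottom.\<close>

definition closing_vertex :: "nat \<Rightarrow> nat \<Rightarrow> nat \<Rightarrow> nat \<Rightarrow> plane" where
  "closing_vertex s n j a =
     (let x = real j; x' = 2 * real s + 1 - real j; m = real s + 1 - real j; y = real n in
      if a = 0 then (x, y) else if a = 1 then (x, y + m) else if a = 2 then (x', y + m)
      else if a = 3 then (x', - m) else if a = 4 then (x, - m) else (x, 0))"

definition braid_edges :: "nat \<Rightarrow> partial_word \<Rightarrow> plane_edge set" where
  "braid_edges s W = {strand_edge W k j | k j. k < length W \<and> 1 \<le> j \<and> j \<le> s} \<union>
     {(closing_vertex s (length W) j a, closing_vertex s (length W) j (Suc a)) | j a. 1 \<le> j \<and> j \<le> s \<and> a < 5}"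

definition braid_crossings :: "partial_word \<Rightarrow> (plane_edge \<times> plane_edge) set" where
  "braid_crossings W = {if \<epsilon> then (strand_edge W k i, strand_edge W k (i + 1)) else (strand_edge W k (i + 1), strand_edge W k i)
     | k i \<epsilon>. k < length W \<and> W ! k = Some (i, \<epsilon>)}"

definition braid_diagram :: "nat \<Rightarrow> partial_word \<Rightarrow> diagram" where
  "braid_diagram s W = (braid_edges s W, braid_crossings W)"

lemma partial_word_onD:
  "partial_word_on s W \<Longrightarrow> k < length W \<Longrightarrow> W ! k = Some (i, \<epsilon>) \<Longrightarrow> 1 \<le> i \<and> i < s"
  unfolding partial_word_on_def by (metis nth_mem)

lemma strand_step_range:
  assumes "partial_word_on s W" "k < length W" "1 \<le> j" "j \<le> s"
  shows "1 \<le> strand_step (W ! k) j \<and> strand_step (W ! k) j \<le> s"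
  using partial_word_onD[OF assms(1,2)] assms(3,4) by (auto simp: strand_step_def split: option.splits)

lemma strand_step_involution: "strand_step x (strand_step x j) = j"
  by (auto simp: strand_step_def split: option.splits)

lemma strand_step_less:
  assumes "j < j'" "\<not> (\<exists>\<epsilon>. x = Some (j, \<epsilon>) \<and> j' = j + 1)"
  shows "strand_step x j < strand_step x j'"
  using assms by (auto simp: strand_step_def split: option.splits)

lemma strand_edge_crossing:
  assumes "W ! k = Some (i, \<epsilon>)"
  shows "strand_edge W k i = rising_edge k i" "strand_edge W k (i + 1) = falling_edge k i"
  using assms by (simp_all add: strand_edge_def strand_step_def rising_edge_def falling_edge_def)

lemma strand_edge_inj: "strand_edge W k j = strand_edge W k' j' \<longleftrightarrow> k = k' \<and> j = j'"
  by (auto simp: strand_edge_def)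

lemma closing_edges_eq:
  "closing_edges s n j = {(closing_vertex s n j a, closing_vertex s n j (Suc a)) | a. a < 5}"
proof -
  have "{..<5} = {0, 1, 2, 3, 4::nat}" by auto
  moreover have "{(closing_vertex s n j a, closing_vertex s n j (Suc a)) | a. a < 5} =
      (\<lambda>a. (closing_vertex s n j a, closing_vertex s n j (Suc a))) ` {..<5}" by auto
  ultimately show ?thesis by (simp add: closing_edges_def closing_vertex_def Let_def)
qed

lemma closed_braid_diagram_eq:
  assumes "braid_word_on s w"
  shows "closed_braid_diagram s w = braid_diagram s (map Some w)"
proof -
  have lev: "level_edges s k (fst (w ! k)) = {strand_edge (map Some w) k j | j. 1 \<le> j \<and> j \<le> s}" if k: "k < length w" for k
  proof -
    obtain i \<epsilon> where i: "w ! k = (i, \<epsilon>)" by (cases "w ! k")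
    then have W: "map Some w ! k = Some (i, \<epsilon>)" using k by simp
    have "1 \<le> i \<and> i < s" using assms nth_mem[OF k] unfolding i braid_word_on_def by auto
    moreover have "strand_edge (map Some w) k j = (grid j k, grid j (k + 1))" if "j \<noteq> i" "j \<noteq> i + 1" for j
      using that W by (simp add: strand_edge_def strand_step_def)
    ultimately show ?thesis
      using strand_edge_crossing[OF W] unfolding level_edges_def i fst_conv
      by (auto; metis Suc_eq_plus1 Suc_leI le_SucI less_imp_le_nat)
  qed
  have "(\<Union>k<length w. level_edges s k (fst (w ! k))) = {strand_edge (map Some w) k j | k j. k < length (map Some w) \<and> 1 \<le> j \<and> j \<le> s}"
    using lev by auto
  moreover have "(\<Union>j\<in>{1..s}. closing_edges s (length w) j) =
      {(closing_vertex s (length (map Some w)) j a, closing_vertex s (length (map Some w)) j (Suc a)) | j a. 1 \<le> j \<and> j \<le> s \<and> a < 5}"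
    unfolding closing_edges_eq by (rule set_eqI, unfold mem_Collect_eq UN_iff Bex_def atLeastAtMost_iff length_map, blast)
  moreover have "{if snd (w ! k) then (rising_edge k (fst (w ! k)), falling_edge k (fst (w ! k)))
       else (falling_edge k (fst (w ! k)), rising_edge k (fst (w ! k))) | k. k < length w} = braid_crossings (map Some w)"
  proof -
    have "(if snd (w ! k) then (rising_edge k (fst (w ! k)), falling_edge k (fst (w ! k)))
       else (falling_edge k (fst (w ! k)), rising_edge k (fst (w ! k)))) =
       (if snd (w ! k) then (strand_edge (map Some w) k (fst (w ! k)), strand_edge (map Some w) k (fst (w ! k) + 1))
       else (strand_edge (map Some w) k (fst (w ! k) + 1), strand_edge (map Some w) k (fst (w ! k))))" if "k < length w" for k
      using strand_edge_crossing[of "map Some w" k "fst (w ! k)" "snd (w ! k)"] that by simp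
    note eq = this
    show ?thesis
    proof (rule set_eqI, rule iffI)
      fix c assume "c \<in> {if snd (w ! k) then (rising_edge k (fst (w ! k)), falling_edge k (fst (w ! k)))
       else (falling_edge k (fst (w ! k)), rising_edge k (fst (w ! k))) | k. k < length w}"
      then obtain k where k: "k < length w" "c = (if snd (w ! k) then (rising_edge k (fst (w ! k)), falling_edge k (fst (w ! k)))
       else (falling_edge k (fst (w ! k)), rising_edge k (fst (w ! k))))" by blast
      then have "map Some w ! k = Some (fst (w ! k), snd (w ! k))" "k < length (map Some w)" by simp_all
      then show "c \<in> braid_crossings (map Some w)"
        unfolding braid_crossings_def k(2) eq[OF k(1)] by blast
    next
      fix c assume "c \<in> braid_crossings (map Some w)"
      then obtain k i \<epsilon> where k: "k < length w" "w ! k = (i, \<epsilon>)" 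
        "c = (if \<epsilon> then (strand_edge (map Some w) k i, strand_edge (map Some w) k (i + 1)) else (strand_edge (map Some w) k (i + 1), strand_edge (map Some w) k i))"
        unfolding braid_crossings_def by auto
      then have "c = (if snd (w ! k) then (rising_edge k (fst (w ! k)), falling_edge k (fst (w ! k)))
       else (falling_edge k (fst (w ! k)), rising_edge k (fst (w ! k))))" using eq[OF k(1)] by simp
      then show "c \<in> {if snd (w ! k) then (rising_edge k (fst (w ! k)), falling_edge k (fst (w ! k)))
       else (falling_edge k (fst (w ! k)), rising_edge k (fst (w ! k))) | k. k < length w}" using k(1) by blast
    qed
  qed
  ultimately show ?thesis
    unfolding closed_braid_diagram_def braid_diagram_def braid_edges_def by simp
qed

section \<open>Position of the edges\<close>

lemma strand_edge_segment:
  assumes "P \<in> closed_segment (fst (strand_edge W k j)) (snd (strand_edge W k j))"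
  obtains l where "0 \<le> l" "l \<le> 1" "fst P = (1 - l) * real j + l * real (strand_step (W ! k) j)" "snd P = real k + l"
proof -
  obtain l where l: "0 \<le> l" "l \<le> 1" "P = (1 - l) *\<^sub>R grid j k + l *\<^sub>R grid (strand_step (W ! k) j) (k + 1)"
    using assms unfolding closed_segment_def strand_edge_def by auto
  have "snd P = real k + l" unfolding l(3) by (simp add: algebra_simps)
  then show thesis using that[of l] l by simp
qed

lemma strand_edge_segment_bounds:
  assumes W: "partial_word_on s W" "k < length W" and j: "1 \<le> j" "j \<le> s"
    and P: "P \<in> closed_segment (fst (strand_edge W k j)) (snd (strand_edge W k j))"
  shows "1 \<le> fst P" "fst P \<le> real s" "real k \<le> snd P" "snd P \<le> real k + 1"
    "snd P = real k \<Longrightarrow> P = fst (strand_edge W k j)" "snd P = real k + 1 \<Longrightarrow> P = snd (strand_edge W k j)"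
proof -
  obtain l where l: "0 \<le> l" "l \<le> 1" "fst P = (1 - l) * real j + l * real (strand_step (W ! k) j)" "snd P = real k + l"
    using strand_edge_segment[OF P] .
  have st: "1 \<le> real (strand_step (W ! k) j)" "real (strand_step (W ! k) j) \<le> real s"
    using strand_step_range[OF W j] by simp_all
  have "(1 - l) * 1 + l * 1 \<le> (1 - l) * real j + l * real (strand_step (W ! k) j)"
    using l st j by (intro add_mono mult_left_mono) auto
  then show "1 \<le> fst P" unfolding l(3) by simp
  have "(1 - l) * real j + l * real (strand_step (W ! k) j) \<le> (1 - l) * real s + l * real s"
    using l st j by (intro add_mono mult_left_mono) auto
  then show "fst P \<le> real s" unfolding l(3) by (simp add: algebra_simps)
  show "real k \<le> snd P" "snd P \<le> real k + 1" using l by simp_all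
  show "P = fst (strand_edge W k j)" if "snd P = real k"
    using l that by (simp add: strand_edge_def prod_eq_iff)
  show "P = snd (strand_edge W k j)" if "snd P = real k + 1"
    using l that by (simp add: strand_edge_def prod_eq_iff)
qed

lemma closed_segment_plane_vertical:
  fixes x y y' :: real
  assumes "P \<in> closed_segment (x, y) (x, y')"
  shows "fst P = x" "min y y' \<le> snd P" "snd P \<le> max y y'"
proof -
  obtain l where l: "0 \<le> l" "l \<le> 1" "P = (1 - l) *\<^sub>R (x, y) + l *\<^sub>R (x, y')"
    using assms unfolding closed_segment_def by auto
  show "fst P = x" unfolding l(3) by (simp add: algebra_simps)
  have "snd P \<in> closed_segment y y'" unfolding closed_segment_def using l by auto
  then show "min y y' \<le> snd P" "snd P \<le> max y y'" by (auto simp: closed_segment_eq_real_ivl split: if_splits)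
qed

lemma closed_segment_plane_horizontal:
  fixes x x' y :: real
  assumes "P \<in> closed_segment (x, y) (x', y)"
  shows "snd P = y" "min x x' \<le> fst P" "fst P \<le> max x x'"
proof -
  obtain l where l: "0 \<le> l" "l \<le> 1" "P = (1 - l) *\<^sub>R (x, y) + l *\<^sub>R (x', y)"
    using assms unfolding closed_segment_def by auto
  show "snd P = y" unfolding l(3) by (simp add: algebra_simps)
  have "fst P \<in> closed_segment x x'" unfolding closed_segment_def using l by auto
  then show "min x x' \<le> fst P" "fst P \<le> max x x'" by (auto simp: closed_segment_eq_real_ivl split: if_splits)
qed

lemma closing_edge_cases:
  assumes j: "1 \<le> j" "j \<le> s" and a: "a < 5"
    and P: "P \<in> closed_segment (closing_vertex s n j a) (closing_vertex s n j (Suc a))"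
  obtains "a = 0" "fst P = real j" "real n \<le> snd P" "snd P \<le> real n + (real s + 1 - real j)"
  | "a = 1" "snd P = real n + (real s + 1 - real j)" "real j \<le> fst P" "fst P \<le> 2 * real s + 1 - real j"
  | "a = 2" "fst P = 2 * real s + 1 - real j" "- (real s + 1 - real j) \<le> snd P" "snd P \<le> real n + (real s + 1 - real j)"
  | "a = 3" "snd P = - (real s + 1 - real j)" "real j \<le> fst P" "fst P \<le> 2 * real s + 1 - real j"
  | "a = 4" "fst P = real j" "- (real s + 1 - real j) \<le> snd P" "snd P \<le> 0"
proof -
  have js: "real j \<le> real s" using j by simp
  consider "a = 0" | "a = 1" | "a = 2" | "a = 3" | "a = 4" using a by linarith
  then show thesis
  proof cases
    case 1
    then have "P \<in> closed_segment (real j, real n) (real j, real n + (real s + 1 - real j))"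
      using P by (simp add: closing_vertex_def Let_def)
    from closed_segment_plane_vertical[OF this] show thesis using that(1) 1 js by simp
  next
    case 2
    then have "P \<in> closed_segment (real j, real n + (real s + 1 - real j)) (2 * real s + 1 - real j, real n + (real s + 1 - real j))"
      using P by (simp add: closing_vertex_def Let_def)
    from closed_segment_plane_horizontal[OF this] show thesis using that(2) 2 js by simp
  next
    case 3
    then have "P \<in> closed_segment (2 * real s + 1 - real j, real n + (real s + 1 - real j)) (2 * real s + 1 - real j, - (real s + 1 - real j))"
      using P by (simp add: closing_vertex_def Let_def)
    from closed_segment_plane_vertical[OF this] show thesis using that(3) 3 js by simp
  next
    case 4
    then have "P \<in> closed_segment (2 * real s + 1 - real j, - (real s + 1 - real j)) (real j, - (real s + 1 - real j))"
      using P by (simp add: closing_vertex_def Let_def)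
    from closed_segment_plane_horizontal[OF this] show thesis using that(4) 4 js by simp
  next
    case 5
    then have "P \<in> closed_segment (real j, - (real s + 1 - real j)) (real j, 0)"
      using P by (simp add: closing_vertex_def Let_def)
    from closed_segment_plane_vertical[OF this] show thesis using that(5) 5 js by simp
  qed
qed

lemma closing_edge_position:
  assumes j: "1 \<le> j" "j \<le> s" and a: "a < 5"
    and P: "P \<in> closed_segment (closing_vertex s n j a) (closing_vertex s n j (Suc a))"
  shows "a = 0 \<Longrightarrow> fst P = real j \<and> real n \<le> snd P \<and> snd P \<le> real n + (real s + 1 - real j)"
    "a = 1 \<Longrightarrow> snd P = real n + (real s + 1 - real j) \<and> real j \<le> fst P \<and> fst P \<le> 2 * real s + 1 - real j"
    "a = 2 \<Longrightarrow> fst P = 2 * real s + 1 - real j \<and> - (real s + 1 - real j) \<le> snd P \<and> snd P \<le> real n + (real s + 1 - real j)"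
    "a = 3 \<Longrightarrow> snd P = - (real s + 1 - real j) \<and> real j \<le> fst P \<and> fst P \<le> 2 * real s + 1 - real j"
    "a = 4 \<Longrightarrow> fst P = real j \<and> - (real s + 1 - real j) \<le> snd P \<and> snd P \<le> 0"
  by (rule closing_edge_cases[OF assms]; simp)+

text \<open>Two strands within the same level keep their order unless they are exchanged by the letter of
this level, and then they meet at half the height of the level.\<close>

lemma strand_edges_meet:
  assumes W: "partial_word_on s W" and k: "k < length W" "k' < length W" and j: "1 \<le> j" "j \<le> s" "1 \<le> j'" "j' \<le> s"
    and ne: "k \<noteq> k' \<or> j \<noteq> j'"
    and P: "P \<in> closed_segment (fst (strand_edge W k j)) (snd (strand_edge W k j))"
    and P': "P \<in> closed_segment (fst (strand_edge W k' j')) (snd (strand_edge W k' j'))"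
  shows "P \<in> {fst (strand_edge W k j), snd (strand_edge W k j)} \<inter> {fst (strand_edge W k' j'), snd (strand_edge W k' j')} \<or>
    (snd P = real k + 1/2 \<and> k' = k \<and> (\<exists>i \<epsilon>. W ! k = Some (i, \<epsilon>) \<and> ((j = i \<and> j' = i + 1) \<or> (j = i + 1 \<and> j' = i))))"
proof -
  have same: "snd P = real k + 1/2 \<and> (\<exists>\<epsilon>. W ! k = Some (j, \<epsilon>)) \<and> j' = j + 1"
    if P: "P \<in> closed_segment (fst (strand_edge W k j)) (snd (strand_edge W k j))"
      and P': "P \<in> closed_segment (fst (strand_edge W k j')) (snd (strand_edge W k j'))" and jj: "j < j'" for j j'
  proof -
    obtain l where l: "0 \<le> l" "l \<le> 1" "fst P = (1 - l) * real j + l * real (strand_step (W ! k) j)" "snd P = real k + l"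
      using strand_edge_segment[OF P] .
    obtain l' where l': "fst P = (1 - l') * real j' + l' * real (strand_step (W ! k) j')" "snd P = real k + l'"
      using strand_edge_segment[OF P'] .
    have ll: "l' = l" using l l' by simp
    show ?thesis
    proof (cases "(\<exists>\<epsilon>. W ! k = Some (j, \<epsilon>)) \<and> j' = j + 1")
      case True
      then obtain \<epsilon> where "W ! k = Some (j, \<epsilon>)" "j' = j + 1" by blast
      then have "(1 - l) * real j + l * (real j + 1) = (1 - l) * (real j + 1) + l * real j"
        using l(3) l'(1) unfolding ll by (simp add: strand_step_def add.commute)
      then have "l = 1/2" by (simp add: algebra_simps)
      then show ?thesis using True l(4) by simp
    next
      case False
      then have "strand_step (W ! k) j < strand_step (W ! k) j'" using strand_step_less[OF jj] by blast
      then have "real j + 1 \<le> real j'" "real (strand_step (W ! k) j) + 1 \<le> real (strand_step (W ! k) j')" using jj by linarith+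
      then have "(1 - l) * (real j + 1) + l * (real (strand_step (W ! k) j) + 1) \<le> (1 - l) * real j' + l * real (strand_step (W ! k) j')"
        using l by (intro add_mono mult_left_mono) auto
      then have False using l(3) l'(1) unfolding ll by (simp add: algebra_simps)
      then show ?thesis ..
    qed
  qed
  note b = strand_edge_segment_bounds[OF W k(1) j(1,2) P] and b' = strand_edge_segment_bounds[OF W k(2) j(3,4) P']
  consider "k = k'" "j < j'" | "k = k'" "j' < j" | "k < k'" | "k' < k" using ne by linarith
  then show ?thesis
  proof cases
    case 1
    then show ?thesis using same[OF P] P' by blast
  next
    case 2
    then show ?thesis using same[of j' j] P P' by blast
  next
    case 3
    then have "real k + 1 \<le> real k'" by linarith
    then have "snd P = real k + 1" "snd P = real k'" using b b' by linarith+
    then show ?thesis using b(6) b'(5) by blast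
  next
    case 4
    then have "real k' + 1 \<le> real k" by linarith
    then have "snd P = real k' + 1" "snd P = real k" using b b' by linarith+
    then show ?thesis using b(5) b'(6) by blast
  qed
qed

lemma strand_closing_meet:
  assumes W: "partial_word_on s W" and k: "k < length W" and j: "1 \<le> j" "j \<le> s" "1 \<le> j'" "j' \<le> s" and a: "a < 5"
    and P: "P \<in> closed_segment (fst (strand_edge W k j)) (snd (strand_edge W k j))"
    and P': "P \<in> closed_segment (closing_vertex s (length W) j' a) (closing_vertex s (length W) j' (Suc a))"
  shows "P \<in> {fst (strand_edge W k j), snd (strand_edge W k j)} \<inter>
     {closing_vertex s (length W) j' a, closing_vertex s (length W) j' (Suc a)}"
proof -
  note b = strand_edge_segment_bounds[OF W k j(1,2) P]
  have js: "real j' \<le> real s" "real k + 1 \<le> real (length W)" using j k by simp_all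
  show ?thesis
  proof (rule closing_edge_cases[OF j(3,4) a P'])
    assume c: "a = 0" "fst P = real j'" "real (length W) \<le> snd P"
    then have "snd P = real k + 1" "snd P = real (length W)" using b js by linarith+
    then show ?thesis using b(6) c by (simp add: closing_vertex_def Let_def prod_eq_iff)
  next
    assume c: "a = 4" "fst P = real j'" "snd P \<le> 0"
    then have "snd P = 0" "real k = 0" using b js by linarith+
    then show ?thesis using b(5) c by (simp add: closing_vertex_def Let_def prod_eq_iff)
  qed (use b js in linarith)+
qed

lemma closing_edges_meet:
  assumes j: "1 \<le> j" "j \<le> s" "1 \<le> j'" "j' \<le> s" and a: "a < 5" "a' < 5" and ne: "j \<noteq> j' \<or> a \<noteq> a'"
    and P: "P \<in> closed_segment (closing_vertex s n j a) (closing_vertex s n j (Suc a))"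
    and P': "P \<in> closed_segment (closing_vertex s n j' a') (closing_vertex s n j' (Suc a'))"
  shows "P \<in> {closing_vertex s n j a, closing_vertex s n j (Suc a)} \<inter> {closing_vertex s n j' a', closing_vertex s n j' (Suc a')}"
proof -
  have different: False if jj: "i < i'" "1 \<le> i" "i' \<le> s" and bb: "b < 5" "b' < 5"
    and Q: "P \<in> closed_segment (closing_vertex s n i b) (closing_vertex s n i (Suc b))"
      "P \<in> closed_segment (closing_vertex s n i' b') (closing_vertex s n i' (Suc b'))" for i i' b b'
  proof -
    have i: "1 \<le> i" "i \<le> s" "1 \<le> i'" "i' \<le> s" using jj by simp_all
    have r: "real i + 1 \<le> real i'" "real i' \<le> real s" "0 \<le> real n" using jj by simp_all
    show False
      by (rule closing_edge_cases[OF i(1,2) bb(1) Q(1)]; rule closing_edge_cases[OF i(3,4) bb(2) Q(2)]; use r in linarith)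
  qed
  have same: "P \<in> {closing_vertex s n i b, closing_vertex s n i (Suc b)} \<inter> {closing_vertex s n i b', closing_vertex s n i (Suc b')}"
    if i: "1 \<le> i" "i \<le> s" and bb: "b < b'" "b' < 5"
      and Q: "P \<in> closed_segment (closing_vertex s n i b) (closing_vertex s n i (Suc b))"
      "P \<in> closed_segment (closing_vertex s n i b') (closing_vertex s n i (Suc b'))" for i b b'
  proof -
    have b5: "b < 5" using bb by simp
    have r: "real i \<le> real s" "0 \<le> real n" using i by simp_all
    note f = closing_edge_position[OF i b5 Q(1)] and f' = closing_edge_position[OF i bb(2) Q(2)]
    consider "b = 0" "b' = 1" | "b = 1" "b' = 2" | "b = 2" "b' = 3" | "b = 3" "b' = 4" | "b = 0" "b' = 4"
      | "b = 0" "b' = 2" | "b = 0" "b' = 3" | "b = 1" "b' = 3" | "b = 1" "b' = 4" | "b = 2" "b' = 4"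
    proof -
      assume a: "b = 0 \<Longrightarrow> b' = 1 \<Longrightarrow> thesis" "b = 1 \<Longrightarrow> b' = 2 \<Longrightarrow> thesis" "b = 2 \<Longrightarrow> b' = 3 \<Longrightarrow> thesis"
        "b = 3 \<Longrightarrow> b' = 4 \<Longrightarrow> thesis" "b = 0 \<Longrightarrow> b' = 4 \<Longrightarrow> thesis" "b = 0 \<Longrightarrow> b' = 2 \<Longrightarrow> thesis"
        "b = 0 \<Longrightarrow> b' = 3 \<Longrightarrow> thesis" "b = 1 \<Longrightarrow> b' = 3 \<Longrightarrow> thesis" "b = 1 \<Longrightarrow> b' = 4 \<Longrightarrow> thesis"
        "b = 2 \<Longrightarrow> b' = 4 \<Longrightarrow> thesis"
      have "b = 0 \<or> b = 1 \<or> b = 2 \<or> b = 3" "b' = 1 \<or> b' = 2 \<or> b' = 3 \<or> b' = 4" using bb by linarith+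
      then show thesis using a bb(1) by (elim disjE) simp_all
    qed
    then show ?thesis
    proof cases
      case 1
      then have "P = closing_vertex s n i 1" using f(1) f'(2) by (simp add: closing_vertex_def Let_def prod_eq_iff)
      then show ?thesis using 1 by simp
    next
      case 2
      then have "P = closing_vertex s n i 2" using f(2) f'(3) by (simp add: closing_vertex_def Let_def prod_eq_iff)
      then show ?thesis using 2 by (simp add: numeral_2_eq_2)
    next
      case 3
      then have "P = closing_vertex s n i 3" using f(3) f'(4) by (simp add: closing_vertex_def Let_def prod_eq_iff)
      then show ?thesis using 3 by simp
    next
      case 4
      then have "P = closing_vertex s n i 4" using f(4) f'(5) by (simp add: closing_vertex_def Let_def prod_eq_iff)
      then show ?thesis using 4 by simp
    next
      case 5
      then have "snd P = 0" "real n = 0" "fst P = real i" using f(1) f'(5) r by linarith+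
      then have "P = closing_vertex s n i 0" "P = closing_vertex s n i 5" by (simp_all add: closing_vertex_def Let_def prod_eq_iff)
      then show ?thesis using 5 by simp
    next
      case 6 then show ?thesis using f(1) f'(3) r by linarith
    next
      case 7 then show ?thesis using f(1) f'(4) r by linarith
    next
      case 8 then show ?thesis using f(2) f'(4) r by linarith
    next
      case 9 then show ?thesis using f(2) f'(5) r by linarith
    next
      case 10 then show ?thesis using f(3) f'(5) r by linarith
    qed
  qed
  consider "j < j'" | "j' < j" | "j = j'" "a < a'" | "j = j'" "a' < a" using ne by linarith
  then show ?thesis
  proof cases
    case 1 then show ?thesis using different[OF 1 j(1,4) a P P'] by simp
  next
    case 2 then show ?thesis using different[OF 2 j(3,2) a(2,1) P' P] by simp
  next
    case 3 then show ?thesis using same[OF j(1,2) 3(2) a(2) P] P' by simp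
  next
    case 4 then show ?thesis using same[OF j(3,4) 4(2) a(1) P'] P by auto
  qed
qed

lemma braid_edges_cases:
  assumes "e \<in> braid_edges s W"
  obtains k j where "k < length W" "1 \<le> j" "j \<le> s" "e = strand_edge W k j"
  | j a where "1 \<le> j" "j \<le> s" "a < 5" "e = (closing_vertex s (length W) j a, closing_vertex s (length W) j (Suc a))"
  using assms unfolding braid_edges_def by blast

lemma le5_cases: "(a::nat) \<le> 5 \<Longrightarrow> a = 0 \<or> a = 1 \<or> a = 2 \<or> a = 3 \<or> a = 4 \<or> a = 5"
  by linarith

lemma closing_vertex_inj:
  assumes "1 \<le> j" "j \<le> s" "1 \<le> j'" "j' \<le> s" "a \<le> 5" "a' \<le> 5"
    and "closing_vertex s n j a = closing_vertex s n j' a'"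
  shows "j = j' \<and> (a = a' \<or> (a = 0 \<and> a' = 5) \<or> (a = 5 \<and> a' = 0))"
proof -
  have r: "1 \<le> real j" "real j \<le> real s" "1 \<le> real j'" "real j' \<le> real s" using assms by simp_all
  show ?thesis
    using le5_cases[OF assms(5)] le5_cases[OF assms(6)] assms(7) r
    by (elim disjE) (simp_all add: closing_vertex_def Let_def)
qed

lemma closing_vertex_not_start:
  assumes "1 \<le> j" "j \<le> s" "1 \<le> j'" "j' \<le> s" "a < 5" "k < n"
  shows "closing_vertex s n j a \<noteq> grid j' k"
proof -
  have r: "1 \<le> real j" "real j \<le> real s" "1 \<le> real j'" "real j' \<le> real s" "0 \<le> real k" "real k < real n" using assms by simp_all
  have "a = 0 \<or> a = 1 \<or> a = 2 \<or> a = 3 \<or> a = 4" using assms(5) by linarith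
  then show ?thesis
    using r by (elim disjE) (auto simp: closing_vertex_def Let_def)
qed

lemma closing_vertex_not_end:
  assumes "1 \<le> j" "j \<le> s" "1 \<le> j'" "j' \<le> s" "a < 5" "k < n"
  shows "closing_vertex s n j (Suc a) \<noteq> grid j' (k + 1)"
proof -
  have r: "1 \<le> real j" "real j \<le> real s" "1 \<le> real j'" "real j' \<le> real s" "0 \<le> real k" "real k + 1 \<le> real n" using assms by simp_all
  show ?thesis
  proof -
    have "a = 0 \<or> a = 1 \<or> a = 2 \<or> a = 3 \<or> a = 4" using assms(5) by linarith
    then show ?thesis
      using r by (elim disjE) (auto simp: closing_vertex_def Let_def)
  qed
qed

text \<open>Heights are attached to the strand positions. A letter of index \<open>i\<close> lowers or
raises position \<open>i\<close> by 1 from its level on; whatever the heights were before, this makes the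
middle of one of the two crossing strands higher than the middle of the other by 1/2, as the sign of the
letter demands.\<close>

definition level_height :: "partial_word \<Rightarrow> nat \<Rightarrow> nat \<Rightarrow> real" where
  "level_height W j k = (\<Sum>l<k. case W ! l of None \<Rightarrow> 0 | Some (i, \<epsilon>) \<Rightarrow> if j = i then (if \<epsilon> then -1 else 1) else 0)"

lemma braid_diagram_realised:
  assumes W: "partial_word_on s W"
  shows "\<exists>L. oriented_link L \<and> has_diagram L (braid_diagram s W)"
proof -
  define n where "n = length W"
  define D where "D = braid_edges s W"
  define X where "X = braid_crossings W"
  define cl where "cl j a = closing_vertex s n j a" for j a
  have s1: "1 \<le> s" using W by (simp add: partial_word_on_def)
  have strandD: "strand_edge W k j \<in> D" if "k < n" "1 \<le> j" "j \<le> s" for k j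
    using that unfolding D_def braid_edges_def n_def by blast
  have closD: "(cl j a, cl j (Suc a)) \<in> D" if "1 \<le> j" "j \<le> s" "a < 5" for j a
    using that unfolding D_def braid_edges_def n_def cl_def by blast
  have Dc: thesis if "e \<in> D" "\<And>k j. k < n \<Longrightarrow> 1 \<le> j \<Longrightarrow> j \<le> s \<Longrightarrow> e = strand_edge W k j \<Longrightarrow> thesis"
    "\<And>j a. 1 \<le> j \<Longrightarrow> j \<le> s \<Longrightarrow> a < 5 \<Longrightarrow> e = (cl j a, cl j (Suc a)) \<Longrightarrow> thesis" for e thesis
    using that(1) unfolding D_def by (rule braid_edges_cases) (use that in \<open>auto simp: n_def cl_def\<close>)
  have fin: "finite D"
  proof -
    have "D \<subseteq> (\<lambda>(k, j). strand_edge W k j) ` ({..<n} \<times> {..s}) \<union> (\<lambda>(j, a). (cl j a, cl j (Suc a))) ` ({..s} \<times> {..<5})"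
    proof
      fix e assume "e \<in> D"
      then show "e \<in> (\<lambda>(k, j). strand_edge W k j) ` ({..<n} \<times> {..s}) \<union> (\<lambda>(j, a). (cl j a, cl j (Suc a))) ` ({..s} \<times> {..<5})"
        by (rule Dc) auto
    qed
    then show ?thesis by (rule finite_subset) simp
  qed
  have ne: "D \<noteq> {}" using closD[of 1 0] s1 by auto
  have step: "1 \<le> strand_step (W ! k) j \<and> strand_step (W ! k) j \<le> s" if "k < n" "1 \<le> j" "j \<le> s" for k j
    using strand_step_range[OF W] that by (simp add: n_def)
  have neq: "p \<noteq> q" if "(p, q) \<in> D" for p q
    using that
  proof (rule Dc)
    fix k j assume "(p, q) = strand_edge W k j"
    then show "p \<noteq> q" by (auto simp: strand_edge_def)
  next
    fix j a assume c: "1 \<le> j" "j \<le> s" "a < 5" "(p, q) = (cl j a, cl j (Suc a))"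
    then show "p \<noteq> q" using closing_vertex_inj[of j s j a "Suc a" n] by (auto simp: cl_def)
  qed
  have inj1: "inj_on fst D"
  proof (rule inj_onI)
    fix e e' assume e: "e \<in> D" and e': "e' \<in> D" and eq: "fst e = fst e'"
    show "e = e'"
    proof (rule Dc[OF e]; rule Dc[OF e'])
      fix k j k' j' assume "e = strand_edge W k j" "e' = strand_edge W k' j'"
      then show ?thesis using eq by (auto simp: strand_edge_def)
    next
      fix k j j' a assume "k < n" "1 \<le> j" "j \<le> s" "e = strand_edge W k j" "1 \<le> j'" "j' \<le> s" "a < 5" "e' = (cl j' a, cl j' (Suc a))"
      then show ?thesis using eq closing_vertex_not_start[of j' s j a k n] by (auto simp: strand_edge_def cl_def)
    next
      fix k j j' a assume "k < n" "1 \<le> j" "j \<le> s" "e' = strand_edge W k j" "1 \<le> j'" "j' \<le> s" "a < 5" "e = (cl j' a, cl j' (Suc a))"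
      then show ?thesis using eq closing_vertex_not_start[of j' s j a k n] by (auto simp: strand_edge_def cl_def)
    next
      fix j a j' a' assume "1 \<le> j" "j \<le> s" "a < 5" "e = (cl j a, cl j (Suc a))" "1 \<le> j'" "j' \<le> s" "a' < 5" "e' = (cl j' a', cl j' (Suc a'))"
      then show ?thesis using eq closing_vertex_inj[of j s j' a a' n] by (auto simp: cl_def)
    qed
  qed
  have inj2: "inj_on snd D"
  proof (rule inj_onI)
    fix e e' assume e: "e \<in> D" and e': "e' \<in> D" and eq: "snd e = snd e'"
    show "e = e'"
    proof (rule Dc[OF e]; rule Dc[OF e'])
      fix k j k' j' assume "e = strand_edge W k j" "e' = strand_edge W k' j'"
      then have "k = k'" "strand_step (W ! k) j = strand_step (W ! k) j'" "e = strand_edge W k j" "e' = strand_edge W k' j'"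
        using eq by (auto simp: strand_edge_def)
      then show ?thesis using strand_step_involution by metis
    next
      fix k j j' a assume "k < n" "1 \<le> j" "j \<le> s" "e = strand_edge W k j" "1 \<le> j'" "j' \<le> s" "a < 5" "e' = (cl j' a, cl j' (Suc a))"
      then show ?thesis using eq step[of k j] closing_vertex_not_end[of j' s "strand_step (W ! k) j" a k n] by (auto simp: strand_edge_def cl_def)
    next
      fix k j j' a assume "k < n" "1 \<le> j" "j \<le> s" "e' = strand_edge W k j" "1 \<le> j'" "j' \<le> s" "a < 5" "e = (cl j' a, cl j' (Suc a))"
      then show ?thesis using eq step[of k j] closing_vertex_not_end[of j' s "strand_step (W ! k) j" a k n] by (auto simp: strand_edge_def cl_def)
    next
      fix j a j' a' assume "1 \<le> j" "j \<le> s" "a < 5" "e = (cl j a, cl j (Suc a))" "1 \<le> j'" "j' \<le> s" "a' < 5" "e' = (cl j' a', cl j' (Suc a'))"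
      then show ?thesis using eq closing_vertex_inj[of j s j' "Suc a" "Suc a'" n] by (auto simp: cl_def)
    qed
  qed
  have cl0: "cl j 0 = grid j n" and cl5: "cl j 5 = grid j 0" for j by (simp_all add: cl_def closing_vertex_def Let_def)
  have start: "grid j k \<in> fst ` D" if "k \<le> n" "1 \<le> j" "j \<le> s" for j k
  proof (cases "k = n")
    case True
    then show ?thesis using closD[of j 0] that cl0 by force
  next
    case False
    then show ?thesis using strandD[of k j] that by (force simp: strand_edge_def)
  qed
  have end': "grid j k \<in> snd ` D" if "k \<le> n" "1 \<le> j" "j \<le> s" for j k
  proof (cases k)
    case 0
    then show ?thesis using closD[of j 4] that cl5 by (force simp: eval_nat_numeral)
  next
    case (Suc l)
    then have "snd (strand_edge W l (strand_step (W ! l) j)) = grid j k"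
      by (simp add: strand_edge_def strand_step_involution)
    moreover have "strand_edge W l (strand_step (W ! l) j) \<in> D" using strandD step[of l j] that Suc by simp
    ultimately show ?thesis by force
  qed
  have fs: "fst ` D = snd ` D"
  proof
    show "fst ` D \<subseteq> snd ` D"
    proof
      fix P assume "P \<in> fst ` D"
      then obtain e where e: "e \<in> D" "P = fst e" by blast
      show "P \<in> snd ` D"
      proof (rule Dc[OF e(1)])
        fix k j assume "k < n" "1 \<le> j" "j \<le> s" "e = strand_edge W k j"
        then show ?thesis using end'[of k j] e(2) by (simp add: strand_edge_def)
      next
        fix j a assume c: "1 \<le> j" "j \<le> s" "a < 5" "e = (cl j a, cl j (Suc a))"
        show ?thesis
        proof (cases a)
          case 0
          then show ?thesis using end'[of n j] c e(2) cl0 by simp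
        next
          case (Suc b)
          then have "(cl j b, cl j a) \<in> D" using closD[of j b] c by simp
          then show ?thesis using c e(2) by force
        qed
      qed
    qed
    show "snd ` D \<subseteq> fst ` D"
    proof
      fix P assume "P \<in> snd ` D"
      then obtain e where e: "e \<in> D" "P = snd e" by blast
      show "P \<in> fst ` D"
      proof (rule Dc[OF e(1)])
        fix k j assume "k < n" "1 \<le> j" "j \<le> s" "e = strand_edge W k j"
        then show ?thesis using start[of "k + 1" "strand_step (W ! k) j"] step[of k j] e(2) by (simp add: strand_edge_def)
      next
        fix j a assume c: "1 \<le> j" "j \<le> s" "a < 5" "e = (cl j a, cl j (Suc a))"
        show ?thesis
        proof (cases "a = 4")
          case True
          then show ?thesis using start[of 0 j] c e(2) cl5 by (simp add: eval_nat_numeral)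
        next
          case False
          then have "(cl j (Suc a), cl j (Suc (Suc a))) \<in> D" using closD[of j "Suc a"] c by simp
          then show ?thesis using c e(2) by force
        qed
      qed
    qed
  qed
  have Xc: thesis if eX: "(e, e') \<in> X" and th: "\<And>k i \<epsilon>. k < n \<Longrightarrow> W ! k = Some (i, \<epsilon>) \<Longrightarrow> 1 \<le> i \<Longrightarrow> i < s \<Longrightarrow>
      (e = strand_edge W k i \<and> e' = strand_edge W k (i + 1) \<and> \<epsilon>) \<or> (e = strand_edge W k (i + 1) \<and> e' = strand_edge W k i \<and> \<not> \<epsilon>) \<Longrightarrow> thesis"
    for e e' thesis
  proof -
    obtain k i \<epsilon> where k: "k < n" "W ! k = Some (i, \<epsilon>)"
      "(e, e') = (if \<epsilon> then (strand_edge W k i, strand_edge W k (i + 1)) else (strand_edge W k (i + 1), strand_edge W k i))"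
      using eX unfolding X_def braid_crossings_def n_def by blast
    have "1 \<le> i \<and> i < s" using partial_word_onD[OF W] k by (simp add: n_def)
    then show thesis using th[OF k(1,2)] k(3) by (auto split: if_splits)
  qed
  have Xi: "(strand_edge W k i, strand_edge W k (i + 1)) \<in> X \<or> (strand_edge W k (i + 1), strand_edge W k i) \<in> X"
    if "k < n" "W ! k = Some (i, \<epsilon>)" for k i \<epsilon>
    using that unfolding X_def braid_crossings_def n_def by (cases \<epsilon>) (simp, blast)+
  have meet: "P \<in> {fst e, snd e} \<inter> {fst e', snd e'} \<or>
        (P \<notin> {fst e, snd e} \<and> P \<notin> {fst e', snd e'} \<and> ((e, e') \<in> X \<or> (e', e) \<in> X))"
    if e: "e \<in> D" "e' \<in> D" "e \<noteq> e'" and P: "P \<in> closed_segment (fst e) (snd e)" "P \<in> closed_segment (fst e') (snd e')" for e e' P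
  proof (rule Dc[OF e(1)]; rule Dc[OF e(2)])
    fix k j k' j' assume a: "k < n" "1 \<le> j" "j \<le> s" "e = strand_edge W k j" "k' < n" "1 \<le> j'" "j' \<le> s" "e' = strand_edge W k' j'"
    have ne: "k \<noteq> k' \<or> j \<noteq> j'" using e(3) a by auto
    have kW: "k < length W" "k' < length W" using a by (simp_all add: n_def)
    have Ps: "P \<in> closed_segment (fst (strand_edge W k j)) (snd (strand_edge W k j))"
      "P \<in> closed_segment (fst (strand_edge W k' j')) (snd (strand_edge W k' j'))" using P a by simp_all
    from strand_edges_meet[OF W kW a(2,3,6,7) ne Ps] show ?thesis
    proof
      assume c: "snd P = real k + 1/2 \<and> k' = k \<and> (\<exists>i \<epsilon>. W ! k = Some (i, \<epsilon>) \<and> ((j = i \<and> j' = i + 1) \<or> (j = i + 1 \<and> j' = i)))"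
      have "P \<notin> {fst e, snd e} \<and> P \<notin> {fst e', snd e'}" using c a by (auto simp: strand_edge_def)
      moreover have "(e, e') \<in> X \<or> (e', e) \<in> X" using c a Xi by blast
      ultimately show ?thesis by blast
    qed (use a in blast)
  next
    fix k j j' a assume a: "k < n" "1 \<le> j" "j \<le> s" "e = strand_edge W k j" "1 \<le> j'" "j' \<le> s" "a < 5" "e' = (cl j' a, cl j' (Suc a))"
    show ?thesis using strand_closing_meet[OF W _ a(2,3,5,6,7), of k P] a P by (simp add: n_def cl_def)
  next
    fix k j j' a assume a: "1 \<le> j'" "j' \<le> s" "a < 5" "e = (cl j' a, cl j' (Suc a))" "k < n" "1 \<le> j" "j \<le> s" "e' = strand_edge W k j"
    show ?thesis using strand_closing_meet[OF W _ a(6,7,1,2,3), of k P] a P by (simp add: n_def cl_def)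
  next
    fix j a j' a' assume a: "1 \<le> j" "j \<le> s" "a < 5" "e = (cl j a, cl j (Suc a))" "1 \<le> j'" "j' \<le> s" "a' < 5" "e' = (cl j' a', cl j' (Suc a'))"
    have ne: "j \<noteq> j' \<or> a \<noteq> a'" using e(3) a by auto
    show ?thesis using closing_edges_meet[OF a(1,2,5,6,3,7) ne, of P n] a P by (simp add: cl_def)
  qed
  define \<eta> where "\<eta> P = level_height W (nat \<lfloor>fst P\<rfloor>) (nat \<lfloor>snd P\<rfloor>)" for P :: plane
  have \<eta>_grid: "\<eta> (grid j k) = level_height W j k" for j k by (simp add: \<eta>_def)
  have cross_param: "l = 1/2 \<and> l' = 1/2"
    if k: "W ! k = Some (i, \<epsilon>)" and eq: "(1 - l) *\<^sub>R fst (strand_edge W k i) + l *\<^sub>R snd (strand_edge W k i) =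
      (1 - l') *\<^sub>R fst (strand_edge W k (i + 1)) + l' *\<^sub>R snd (strand_edge W k (i + 1))" for k i \<epsilon> l l'
  proof -
    have "(1 - l) * real i + l * (real i + 1) = (1 - l') * (real i + 1) + l' * real i"
      "(1 - l) * real k + l * (real k + 1) = (1 - l') * real k + l' * (real k + 1)"
      using eq k by (simp_all add: strand_edge_def strand_step_def add.commute)
    then have "l = 1 - l'" "l = l'" by (simp_all add: algebra_simps)
    then show ?thesis by simp
  qed
  have cross_height: "(1/2) * \<eta> (fst (strand_edge W k i)) + (1/2) * \<eta> (snd (strand_edge W k i)) -
      ((1/2) * \<eta> (fst (strand_edge W k (i + 1))) + (1/2) * \<eta> (snd (strand_edge W k (i + 1)))) = (if \<epsilon> then 1/2 else - (1/2))"
    if k: "W ! k = Some (i, \<epsilon>)" for k i \<epsilon>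
  proof -
    have h: "level_height W (i + 1) (k + 1) = level_height W (i + 1) k"
      "level_height W i (k + 1) = level_height W i k + (if \<epsilon> then -1 else 1)"
      using k by (simp_all add: level_height_def)
    have e: "fst (strand_edge W k i) = grid i k" "snd (strand_edge W k i) = grid (i + 1) (k + 1)"
      "fst (strand_edge W k (i + 1)) = grid (i + 1) k" "snd (strand_edge W k (i + 1)) = grid i (k + 1)"
      using k by (simp_all add: strand_edge_def strand_step_def)
    show ?thesis unfolding e \<eta>_grid h by (cases \<epsilon>) (simp_all add: field_simps)
  qed
  have cross_mid: "(1 - 1/2) *\<^sub>R fst (strand_edge W k i) + (1/2) *\<^sub>R snd (strand_edge W k i) =
      (1 - 1/2) *\<^sub>R fst (strand_edge W k (i + 1)) + (1/2::real) *\<^sub>R snd (strand_edge W k (i + 1))"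
    if k: "W ! k = Some (i, \<epsilon>)" for k i \<epsilon>
    using k by (simp add: strand_edge_def strand_step_def field_simps)
  have "\<exists>E. polygonal_link E \<and> regular_projection E \<and> diagram_of E = (D, X)"
  proof (rule diagram_lift[where \<eta> = \<eta>, OF fin ne neq inj1 inj2 fs])
    show "P \<in> {p, q} \<inter> {p', q'} \<or> (P \<notin> {p, q} \<and> P \<notin> {p', q'} \<and> (((p, q), (p', q')) \<in> X \<or> ((p', q'), (p, q)) \<in> X))"
      if "(p, q) \<in> D" "(p', q') \<in> D" "(p, q) \<noteq> (p', q')" "P \<in> closed_segment p q" "P \<in> closed_segment p' q'" for p q p' q' P
      using meet[OF that(1,2,3), of P] that(4,5) by simp
    show "e \<in> D \<and> e' \<in> D" if "(e, e') \<in> X" for e e'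
      using that by (rule Xc) (use strandD in auto)
    show "\<exists>l l'. 0 \<le> l \<and> l \<le> 1 \<and> 0 \<le> l' \<and> l' \<le> 1 \<and> (1 - l) *\<^sub>R p + l *\<^sub>R q = (1 - l') *\<^sub>R p' + l' *\<^sub>R q'"
      if "((p, q), (p', q')) \<in> X" for p q p' q'
    proof (rule Xc[OF that])
      fix k i \<epsilon> assume k: "W ! k = Some (i, \<epsilon>)" and
        c: "((p, q) = strand_edge W k i \<and> (p', q') = strand_edge W k (i + 1) \<and> \<epsilon>) \<or> ((p, q) = strand_edge W k (i + 1) \<and> (p', q') = strand_edge W k i \<and> \<not> \<epsilon>)"
      have "(1 - 1/2) *\<^sub>R p + (1/2) *\<^sub>R q = (1 - 1/2) *\<^sub>R p' + (1/2::real) *\<^sub>R q'"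
        using cross_mid[OF k] c by (metis fst_conv snd_conv)
      then show ?thesis by (intro exI[of _ "1/2"]) simp
    qed
    show "(1 - l') * \<eta> p' + l' * \<eta> q' < (1 - l) * \<eta> p + l * \<eta> q"
      if "((p, q), (p', q')) \<in> X" "0 \<le> l" "l \<le> 1" "0 \<le> l'" "l' \<le> 1" "(1 - l) *\<^sub>R p + l *\<^sub>R q = (1 - l') *\<^sub>R p' + l' *\<^sub>R q'" for p q p' q' l l'
    proof (rule Xc[OF that(1)])
      fix k i \<epsilon> assume k: "W ! k = Some (i, \<epsilon>)" and
        c: "((p, q) = strand_edge W k i \<and> (p', q') = strand_edge W k (i + 1) \<and> \<epsilon>) \<or> ((p, q) = strand_edge W k (i + 1) \<and> (p', q') = strand_edge W k i \<and> \<not> \<epsilon>)"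
      from c show ?thesis
      proof (elim disjE conjE)
        assume a: "(p, q) = strand_edge W k i" "(p', q') = strand_edge W k (i + 1)" \<epsilon>
        have pq: "p = fst (strand_edge W k i)" "q = snd (strand_edge W k i)" "p' = fst (strand_edge W k (i + 1))" "q' = snd (strand_edge W k (i + 1))"
          using a(1,2) by (metis fst_conv snd_conv)+
        have l: "l = 1/2" "l' = 1/2" using cross_param[OF k] that(6) unfolding pq by blast+
        show ?thesis using cross_height[OF k] a(3) unfolding pq l by simp
      next
        assume a: "(p, q) = strand_edge W k (i + 1)" "(p', q') = strand_edge W k i" "\<not> \<epsilon>"
        have pq: "p = fst (strand_edge W k (i + 1))" "q = snd (strand_edge W k (i + 1))" "p' = fst (strand_edge W k i)" "q' = snd (strand_edge W k i)"
          using a(1,2) by (metis fst_conv snd_conv)+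
        have l: "l' = 1/2" "l = 1/2" using cross_param[OF k] that(6)[symmetric] unfolding pq by blast+
        show ?thesis using cross_height[OF k] a(3) unfolding pq l by simp
      qed
    qed
    have partner: "\<exists>k i \<epsilon>. W ! k = Some (i, \<epsilon>) \<and> ((e = strand_edge W k i \<and> e' = strand_edge W k (i + 1)) \<or> (e = strand_edge W k (i + 1) \<and> e' = strand_edge W k i))"
      if "(e, e') \<in> X \<or> (e', e) \<in> X" for e e'
      using that by (elim disjE) (erule Xc; blast)+
    show "e' = e''" if "(e, e') \<in> X \<or> (e', e) \<in> X" "(e, e'') \<in> X \<or> (e'', e) \<in> X" for e e' e''
      using partner[OF that(1)] partner[OF that(2)] by (auto simp: strand_edge_inj)
  qed
  then obtain E where E: "polygonal_link E" "regular_projection E" "diagram_of E = (D, X)" by blast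
  obtain L where "oriented_link L" "isotopic_to_polygonal L E" using polygonal_link_realised[OF E(1)] by blast
  then show ?thesis
    using E unfolding has_diagram_def braid_diagram_def D_def X_def by blast
qed

text \<open>The disc of the skein triple is the unit square that contains the crossing, and the vertical
sides of this square are the smoothed strands.\<close>

lemma skein_triple_braid:
  assumes W: "partial_word_on s W" and k: "k < length W" and i: "1 \<le> i" "i < s"
  shows "skein_triple (braid_diagram s (W[k := Some (i, True)])) (braid_diagram s (W[k := Some (i, False)]))
    (braid_diagram s (W[k := None]))"
proof -
  define n where "n = length W"
  define V where "V = W[k := None]"
  have V: "partial_word_on s V" "length V = n" "V ! k = None"
    using W k set_update_subset_insert[of W k None] by (auto simp: V_def partial_word_on_def n_def)
  define R where "R = {strand_edge V k' j | k' j. k' < n \<and> 1 \<le> j \<and> j \<le> s \<and> \<not> (k' = k \<and> (j = i \<or> j = i + 1))} \<union>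
     {(closing_vertex s n j a, closing_vertex s n j (Suc a)) | j a. 1 \<le> j \<and> j \<le> s \<and> a < 5}"
  define X where "X = braid_crossings V"
  have kn: "k < n" using k by (simp add: n_def)
  have other: "strand_edge (W[k := y]) k' j = strand_edge V k' j"
    if "k' \<noteq> k \<or> (y = None \<or> (\<exists>\<epsilon>. y = Some (i, \<epsilon>))) \<and> j \<noteq> i \<and> j \<noteq> i + 1" for y k' j
    using that kn by (cases "k' = k") (auto simp: strand_edge_def V_def strand_step_def n_def)
  have strand_in: "strand_edge U k j \<in> braid_edges s U" if "k < length U" "1 \<le> j" "j \<le> s" for k U j
    using that unfolding braid_edges_def by blast
  have edges: "braid_edges s (W[k := y]) = R \<union> {strand_edge (W[k := y]) k i, strand_edge (W[k := y]) k (i + 1)}"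
    if y: "y = None \<or> (\<exists>\<epsilon>. y = Some (i, \<epsilon>))" for y
  proof
    show "braid_edges s (W[k := y]) \<subseteq> R \<union> {strand_edge (W[k := y]) k i, strand_edge (W[k := y]) k (i + 1)}"
    proof
      fix e assume "e \<in> braid_edges s (W[k := y])"
      then show "e \<in> R \<union> {strand_edge (W[k := y]) k i, strand_edge (W[k := y]) k (i + 1)}"
      proof (rule braid_edges_cases)
        fix k' j assume a: "k' < length (W[k := y])" "1 \<le> j" "j \<le> s" "e = strand_edge (W[k := y]) k' j"
        show ?thesis
        proof (cases "k' = k \<and> (j = i \<or> j = i + 1)")
          case False
          then have "e = strand_edge V k' j" using other[of k' y j] y a(4) by blast
          moreover have "k' < n" using a(1) by (simp add: n_def)
          ultimately show ?thesis using a(2,3) False unfolding R_def by blast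
        qed (use a in auto)
      next
        fix j a assume "1 \<le> j" "j \<le> s" "a < 5" "e = (closing_vertex s (length (W[k := y])) j a, closing_vertex s (length (W[k := y])) j (Suc a))"
        then show ?thesis unfolding R_def n_def by auto
      qed
    qed
    show "R \<union> {strand_edge (W[k := y]) k i, strand_edge (W[k := y]) k (i + 1)} \<subseteq> braid_edges s (W[k := y])"
    proof
      fix e assume "e \<in> R \<union> {strand_edge (W[k := y]) k i, strand_edge (W[k := y]) k (i + 1)}"
      then consider k' j where "k' < n" "1 \<le> j" "j \<le> s" "\<not> (k' = k \<and> (j = i \<or> j = i + 1))" "e = strand_edge V k' j"
        | j a where "1 \<le> j" "j \<le> s" "a < 5" "e = (closing_vertex s n j a, closing_vertex s n j (Suc a))"
        | "e = strand_edge (W[k := y]) k i" | "e = strand_edge (W[k := y]) k (i + 1)"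
        unfolding R_def by blast
      then show "e \<in> braid_edges s (W[k := y])"
      proof cases
        case 1
        then have "e = strand_edge (W[k := y]) k' j" using other[of k' y j] y by simp
        then show ?thesis using 1 unfolding braid_edges_def n_def by auto
      next
        case 2
        then show ?thesis unfolding braid_edges_def n_def by auto
      next
        case 3
        then show ?thesis using i kn strand_in[of k "W[k := y]" i] by (simp add: n_def)
      next
        case 4
        then show ?thesis using i kn strand_in[of k "W[k := y]" "i + 1"] by (simp add: n_def)
      qed
    qed
  qed
  have crossings: "braid_crossings (W[k := Some (i, \<epsilon>)]) = X \<union> {if \<epsilon> then (rising_edge k i, falling_edge k i) else (falling_edge k i, rising_edge k i)}" for \<epsilon>
  proof -
    define U where "U = W[k := Some (i, \<epsilon>)]"
    have U: "U ! k = Some (i, \<epsilon>)" "length U = n" "\<And>k'. k' \<noteq> k \<Longrightarrow> U ! k' = V ! k'"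
      "\<And>k' j. k' \<noteq> k \<Longrightarrow> strand_edge U k' j = strand_edge V k' j"
      using kn other[of _ "Some (i, \<epsilon>)"] by (simp_all add: U_def V_def n_def)
    define c where "c T k i \<epsilon> = (if \<epsilon> then (strand_edge T k i, strand_edge T k (i + 1)) else (strand_edge T k (i + 1), strand_edge T k i))"
      for T k i and \<epsilon> :: bool
    have cr: "braid_crossings T = {c T k i \<epsilon> | k i \<epsilon>. k < length T \<and> T ! k = Some (i, \<epsilon>)}" for T
      unfolding braid_crossings_def c_def ..
    have ck: "c U k' = c V k'" if "k' \<noteq> k" for k' using U(4)[OF that] by (auto simp: c_def fun_eq_iff)
    have "braid_crossings U = X \<union> {c U k i \<epsilon>}"
    proof
      show "braid_crossings U \<subseteq> X \<union> {c U k i \<epsilon>}"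
      proof
        fix z assume "z \<in> braid_crossings U"
        then obtain k' i' \<epsilon>' where z: "z = c U k' i' \<epsilon>'" "k' < n" "U ! k' = Some (i', \<epsilon>')" unfolding cr U(2) by blast
        show "z \<in> X \<union> {c U k i \<epsilon>}"
        proof (cases "k' = k")
          case True then show ?thesis using z U(1) by simp
        next
          case False
          then have "z = c V k' i' \<epsilon>'" "V ! k' = Some (i', \<epsilon>')" using z ck U(3) by simp_all
          then show ?thesis using z(2) V(2) unfolding X_def cr by blast
        qed
      qed
      show "X \<union> {c U k i \<epsilon>} \<subseteq> braid_crossings U"
      proof
        fix z assume "z \<in> X \<union> {c U k i \<epsilon>}"
        then show "z \<in> braid_crossings U"
        proof
          assume "z \<in> X"
          then obtain k' i' \<epsilon>' where z: "z = c V k' i' \<epsilon>'" "k' < n" "V ! k' = Some (i', \<epsilon>')" unfolding X_def cr V(2) by blast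
          then have "k' \<noteq> k" using V(3) by auto
          then have "z = c U k' i' \<epsilon>'" "U ! k' = Some (i', \<epsilon>')" using z ck U(3) by simp_all
          then show ?thesis using z(2) U(2) unfolding cr by blast
        next
          assume "z \<in> {c U k i \<epsilon>}"
          then show ?thesis using U(1,2) kn unfolding cr by blast
        qed
      qed
    qed
    moreover have "c U k i \<epsilon> = (if \<epsilon> then (rising_edge k i, falling_edge k i) else (falling_edge k i, rising_edge k i))"
      unfolding c_def strand_edge_crossing[OF U(1)] ..
    ultimately show ?thesis unfolding U_def by simp
  qed
  define a b c d where "a = grid i k" and "b = grid (i + 1) (k + 1)" and "c = grid (i + 1) k" and "d = grid i (k + 1)"
  have re: "rising_edge k i = (a, b)" "falling_edge k i = (c, d)"
    by (simp_all add: rising_edge_def falling_edge_def a_def b_def c_def d_def)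
  have ver: "strand_edge V k i = (a, d)" "strand_edge V k (i + 1) = (c, b)"
    using V(3) by (simp_all add: strand_edge_def strand_step_def a_def b_def c_def d_def)
  have hull: "real i \<le> fst P \<and> fst P \<le> real i + 1 \<and> real k \<le> snd P \<and> snd P \<le> real k + 1"
    if "P \<in> convex hull {a, b, c, d}" for P
  proof -
    have "convex hull {a, b, c, d} \<subseteq> {real i..real i + 1} \<times> {real k..real k + 1}"
      by (rule hull_minimal) (auto simp: a_def b_def c_def d_def intro!: convex_Times)
    then show ?thesis using that by (cases P) auto
  qed
  have corner: "grid j k \<in> {a, b, c, d}" "grid j (k + 1) \<in> {a, b, c, d}"
    if "real i \<le> real j" "real j \<le> real i + 1" for j
  proof -
    have "j = i \<or> j = i + 1" using that by linarith
    then show "grid j k \<in> {a, b, c, d}" "grid j (k + 1) \<in> {a, b, c, d}" by (auto simp: a_def b_def c_def d_def)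
  qed
  have away: "closed_segment (fst e) (snd e) \<inter> convex hull {a, b, c, d} \<subseteq> {a, b, c, d}" if e: "e \<in> R" for e
  proof
    fix P assume "P \<in> closed_segment (fst e) (snd e) \<inter> convex hull {a, b, c, d}"
    then have P: "P \<in> closed_segment (fst e) (snd e)" and h: "real i \<le> fst P" "fst P \<le> real i + 1" "real k \<le> snd P" "snd P \<le> real k + 1"
      using hull by blast+
    from e consider k' j where "k' < n" "1 \<le> j" "j \<le> s" "\<not> (k' = k \<and> (j = i \<or> j = i + 1))" "e = strand_edge V k' j"
      | j a where "1 \<le> j" "j \<le> s" "a < 5" "e = (closing_vertex s n j a, closing_vertex s n j (Suc a))"
      unfolding R_def by blast
    then show "P \<in> {a, b, c, d}"
    proof cases
      case 1
      have kl: "k' < length V" using 1 V by simp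
      note bd = strand_edge_segment_bounds[OF V(1) kl 1(2,3) P[unfolded 1(5)]]
      consider "k' = k" | "k' < k" | "k < k'" by linarith
      then show ?thesis
      proof cases
        assume kk: "k' = k"
        obtain l where "fst P = (1 - l) * real j + l * real (strand_step (V ! k') j)"
          using strand_edge_segment[OF P[unfolded 1(5)]] by blast
        then have "fst P = real j" using kk V(3) by (simp add: strand_step_def algebra_simps)
        then have "j = i \<or> j = i + 1" using h by linarith
        then show ?thesis using 1(4) kk by simp
      next
        assume "k' < k"
        then have "real k' + 1 \<le> real k" by linarith
        then have y: "snd P = real k' + 1" "real k = real k' + 1" using bd h by linarith+
        then have Pe: "P = grid (strand_step (V ! k') j) (k' + 1)" "k' + 1 = k" using bd(6) by (simp_all add: strand_edge_def)
        then show ?thesis using corner(1)[of "strand_step (V ! k') j"] h unfolding Pe by simp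
      next
        assume "k < k'"
        then have "real k + 1 \<le> real k'" by linarith
        then have y: "snd P = real k'" "real k' = real k + 1" using bd h by linarith+
        then have Pe: "P = grid j k'" "k' = k + 1" using bd(5) by (simp_all add: strand_edge_def)
        then show ?thesis using corner(2)[of j] h unfolding Pe by simp
      qed
    next
      case 2
      have js: "real j \<le> real s" "real i + 1 \<le> real s" "real k + 1 \<le> real n" using 2 i kn by simp_all
      have P': "P \<in> closed_segment (closing_vertex s n j a) (closing_vertex s n j (Suc a))" using P 2 by simp
      show ?thesis
      proof (rule closing_edge_cases[OF 2(1-3) P'])
        assume q: "a = 0" "fst P = real j" "real n \<le> snd P"
        then have "snd P = real k + 1" using h js by linarith
        then have "P = grid j (k + 1)" using q by (simp add: prod_eq_iff)
        then show ?thesis using corner(2)[of j] h q by simp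
      next
        assume q: "a = 4" "fst P = real j" "snd P \<le> 0"
        then have "snd P = real k" using h js by linarith
        then have "P = grid j k" using q by (simp add: prod_eq_iff)
        then show ?thesis using corner(1)[of j] h q by simp
      qed (use h js in linarith)+
    qed
  qed
  have XR: "X \<subseteq> R \<times> R"
  proof
    fix z assume "z \<in> X"
    then obtain k' i' \<epsilon> where z: "z = (if \<epsilon> then (strand_edge V k' i', strand_edge V k' (i' + 1)) else (strand_edge V k' (i' + 1), strand_edge V k' i'))"
      "k' < n" "V ! k' = Some (i', \<epsilon>)" unfolding X_def braid_crossings_def V(2) by blast
    have "k' \<noteq> k" using z(3) V(3) by auto
    moreover have "1 \<le> i' \<and> i' < s" using partial_word_onD[OF V(1) _ z(3)] z(2) V(2) by simp
    moreover have "strand_edge V k' j \<in> R" if "k' \<noteq> k" "1 \<le> j" "j \<le> s" for j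
      using that z(2) unfolding R_def by blast
    ultimately have "strand_edge V k' i' \<in> R" "strand_edge V k' (i' + 1) \<in> R" by simp_all
    then show "z \<in> R \<times> R" using z(1) by simp
  qed
  have "(1/2) *\<^sub>R a + (1/2) *\<^sub>R b \<in> open_segment a b \<inter> open_segment c d"
  proof -
    have "a \<noteq> b" "c \<noteq> d" by (auto simp: a_def b_def c_def d_def)
    moreover have "(1/2) *\<^sub>R a + (1/2) *\<^sub>R b = (1/2) *\<^sub>R c + (1/2::real) *\<^sub>R d"
      by (simp add: a_def b_def c_def d_def field_simps)
    moreover have "(1/2) *\<^sub>R p + (1/2) *\<^sub>R q \<in> open_segment p q" if "p \<noteq> q" for p q :: plane
      unfolding in_segment using that by (intro conjI exI[of _ "1/2"]) auto
    ultimately show ?thesis by (metis IntI)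
  qed
  then have opn: "open_segment a b \<inter> open_segment c d \<noteq> {}" by blast
  show ?thesis
    unfolding skein_triple_def
  proof (rule exI[of _ a], rule exI[of _ b], rule exI[of _ c], rule exI[of _ d], rule exI[of _ R], rule exI[of _ X], intro conjI)
    show "open_segment a b \<inter> open_segment c d \<noteq> {}" by (rule opn)
    show "fst (b - a) * snd (d - c) - snd (b - a) * fst (d - c) > 0" by (simp add: a_def b_def c_def d_def)
    show "\<forall>(p, q)\<in>R. closed_segment p q \<inter> convex hull {a, b, c, d} \<subseteq> {a, b, c, d}"
      unfolding case_prod_beta using away by blast
    show "X \<subseteq> R \<times> R" by (rule XR)
    have le: "strand_edge (W[k := Some (i, \<epsilon>)]) k i = (a, b)" "strand_edge (W[k := Some (i, \<epsilon>)]) k (i + 1) = (c, d)" for \<epsilon>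
      using strand_edge_crossing[of "W[k := Some (i, \<epsilon>)]" k i \<epsilon>] k re by simp_all
    have eS: "braid_edges s (W[k := Some (i, \<epsilon>)]) = R \<union> {(a, b), (c, d)}" for \<epsilon>
      using edges[of "Some (i, \<epsilon>)"] unfolding le by blast
    show "braid_diagram s (W[k := Some (i, True)]) = (R \<union> {(a, b), (c, d)}, X \<union> {((a, b), (c, d))})"
      unfolding braid_diagram_def eS crossings re by simp
    show "braid_diagram s (W[k := Some (i, False)]) = (R \<union> {(a, b), (c, d)}, X \<union> {((c, d), (a, b))})"
      unfolding braid_diagram_def eS crossings re by simp
    show "braid_diagram s (W[k := None]) = (R \<union> {(a, d), (c, b)}, X)"
      unfolding braid_diagram_def using edges[of None] ver by (simp add: V_def[symmetric] X_def)
  qed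
qed

section \<open>Travelling through a closed braid\<close>

primrec strand_pos :: "partial_word \<Rightarrow> nat \<Rightarrow> nat \<Rightarrow> nat" where
  "strand_pos W j 0 = j"
| "strand_pos W j (Suc k) = strand_step (W ! k) (strand_pos W j k)"

text \<open>The bottom positions in the order of the journey: the top of the last strand is continued by
the strand below, unless this closes a component; then the least new position is the next base
point.\<close>

primrec visited :: "nat \<Rightarrow> partial_word \<Rightarrow> nat \<Rightarrow> nat list" where
  "visited s W 0 = [1]"
| "visited s W (Suc r) = (let x = strand_pos W (last (visited s W r)) (length W) in
     visited s W r @ [if x \<in> set (visited s W r) then Min ({1..s} - set (visited s W r)) else x])"

definition base_point :: "nat \<Rightarrow> partial_word \<Rightarrow> nat \<Rightarrow> nat" where
  "base_point s W r = last (visited s W r)"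

definition journey :: "nat \<Rightarrow> partial_word \<Rightarrow> nat \<Rightarrow> nat \<Rightarrow> nat" where
  "journey s W r k = strand_pos W (base_point s W r) k"

lemma set_visited: "set (visited s W r) = base_point s W ` {..r}"
proof (induction r)
  case (Suc r)
  have "set (visited s W (Suc r)) = insert (base_point s W (Suc r)) (set (visited s W r))"
    by (simp add: base_point_def Let_def)
  then show ?case unfolding Suc by (simp add: atMost_Suc)
qed (simp add: base_point_def)

lemma base_point_0: "base_point s W 0 = 1" by (simp add: base_point_def)

lemma base_point_Suc: "base_point s W (Suc r) = (if journey s W r (length W) \<in> base_point s W ` {..r}
    then Min ({1..s} - base_point s W ` {..r}) else journey s W r (length W))"
  unfolding set_visited[symmetric] by (simp add: base_point_def journey_def Let_def)

lemma strand_pos_range: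
  assumes "partial_word_on s W" "k \<le> length W" "1 \<le> j" "j \<le> s"
  shows "1 \<le> strand_pos W j k \<and> strand_pos W j k \<le> s"
  using assms(2)
proof (induction k)
  case (Suc k)
  then show ?case using strand_step_range[OF assms(1), of k "strand_pos W j k"] by simp
qed (use assms in simp)

lemma strand_pos_inj: "strand_pos W j k = strand_pos W j' k \<Longrightarrow> j = j'"
proof (induction k)
  case (Suc k)
  then have "strand_pos W j k = strand_pos W j' k" using strand_step_involution[of "W ! k"] by (metis strand_pos.simps(2))
  then show ?case by (rule Suc.IH)
qed simp

lemma base_point_range_inj:
  assumes W: "partial_word_on s W" and r: "r < s"
  shows "base_point s W ` {..r} \<subseteq> {1..s} \<and> inj_on (base_point s W) {..r}"
  using r
proof (induction r)
  case 0
  then show ?case by (simp add: base_point_0)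
next
  case (Suc r)
  then have IH: "base_point s W ` {..r} \<subseteq> {1..s}" "inj_on (base_point s W) {..r}" by simp_all
  have "card (base_point s W ` {..r}) = Suc r" using card_image[OF IH(2)] by simp
  then have "card ({1..s} - base_point s W ` {..r}) > 0" using Suc.prems IH(1) by (simp add: card_Diff_subset)
  then have "{1..s} - base_point s W ` {..r} \<noteq> {}" by (metis card.empty less_irrefl)
  then have M: "Min ({1..s} - base_point s W ` {..r}) \<in> {1..s} - base_point s W ` {..r}" by (intro Min_in) auto
  have "base_point s W r \<in> {1..s}" using IH(1) by auto
  then have x: "journey s W r (length W) \<in> {1..s}" using strand_pos_range[OF W, of "length W" "base_point s W r"] by (simp add: journey_def)
  have new: "base_point s W (Suc r) \<in> {1..s} - base_point s W ` {..r}" unfolding base_point_Suc using M x by simp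
  then show ?case using IH by (simp add: atMost_Suc)
qed

lemma base_point_bij:
  assumes W: "partial_word_on s W"
  shows "bij_betw (base_point s W) {..<s} {1..s}"
proof -
  have "s \<ge> 1" using W by (simp add: partial_word_on_def)
  then have e: "{..<s} = {..s - 1}" by auto
  have 1: "base_point s W ` {..<s} \<subseteq> {1..s}" "inj_on (base_point s W) {..<s}" unfolding e using base_point_range_inj[OF W, of "s - 1"] \<open>s \<ge> 1\<close> by auto
  have "card (base_point s W ` {..<s}) = card {1..s}" using card_image[OF 1(2)] by simp
  then have "base_point s W ` {..<s} = {1..s}" using 1(1) by (intro card_subset_eq) auto
  then show ?thesis using 1(2) by (simp add: bij_betw_def)
qed

lemma journey_bij:
  assumes W: "partial_word_on s W" and k: "k \<le> length W"
  shows "bij_betw (\<lambda>r. journey s W r k) {..<s} {1..s}"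
proof -
  have "inj_on (\<lambda>j. strand_pos W j k) {1..s}" using strand_pos_inj by (intro inj_onI)
  moreover have "(\<lambda>j. strand_pos W j k) ` {1..s} \<subseteq> {1..s}" using strand_pos_range[OF W k] by auto
  ultimately have "bij_betw (\<lambda>j. strand_pos W j k) {1..s} {1..s}"
    by (simp add: bij_betw_def endo_inj_surj)
  from bij_betw_trans[OF base_point_bij[OF W] this] show ?thesis by (simp add: comp_def journey_def)
qed

lemma journey_at:
  assumes W: "partial_word_on s W" and k: "k \<le> length W" and j: "1 \<le> j" "j \<le> s"
  obtains r where "r < s" "journey s W r k = j"
proof -
  have "j \<in> (\<lambda>r. journey s W r k) ` {..<s}" using bij_betw_imp_surj_on[OF journey_bij[OF W k]] j by simp
  then show thesis using that by blast
qed

lemma journey_inj: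
  assumes "partial_word_on s W" "k \<le> length W" "r < s" "r' < s" "journey s W r k = journey s W r' k"
  shows "r = r'"
  using bij_betw_imp_inj_on[OF journey_bij[OF assms(1,2)]] assms(3-5) by (auto dest: inj_onD)

lemma journey_range:
  assumes "partial_word_on s W" "k \<le> length W" "r < s"
  shows "1 \<le> journey s W r k \<and> journey s W r k \<le> s"
  using bij_betwE[OF journey_bij[OF assms(1,2)]] assms(3) by auto

lemma journey_Suc: "journey s W r (Suc k) = strand_step (W ! k) (journey s W r k)"
  by (simp add: journey_def)

section \<open>First visits\<close>

definition passes :: "nat \<Rightarrow> partial_word \<Rightarrow> nat \<Rightarrow> nat \<Rightarrow> bool" where
  "passes s W r l \<longleftrightarrow> (\<exists>i \<epsilon>. W ! l = Some (i, \<epsilon>) \<and> (journey s W r l = i \<or> journey s W r l = i + 1))"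

definition first_rank :: "nat \<Rightarrow> partial_word \<Rightarrow> nat \<Rightarrow> nat" where
  "first_rank s W l = (LEAST r. passes s W r l)"

text \<open>The journey visits strand after strand, and level after level on each strand.\<close>

definition first_time :: "nat \<Rightarrow> partial_word \<Rightarrow> nat \<Rightarrow> nat" where
  "first_time s W l = first_rank s W l * length W + l"

definition from_left :: "nat \<Rightarrow> partial_word \<Rightarrow> nat \<Rightarrow> bool" where
  "from_left s W l \<longleftrightarrow> journey s W (first_rank s W l) l = fst (the (W ! l))"

text \<open>With \<open>f\<close> a crossing is good if it is met first on the over-passing strand: this
strand comes from the left exactly for positive letters. Without \<open>f\<close> the roles of over and
under are exchanged.\<close>

definition good :: "bool \<Rightarrow> nat \<Rightarrow> partial_word \<Rightarrow> nat \<Rightarrow> bool" where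
  "good f s W l \<longleftrightarrow> (from_left s W l \<longleftrightarrow> snd (the (W ! l)) = f)"

lemma first_rank:
  assumes W: "partial_word_on s W" and l: "l < length W" "W ! l = Some (i, \<epsilon>)"
  shows "passes s W (first_rank s W l) l" "first_rank s W l < s" "\<And>r. passes s W r l \<Longrightarrow> first_rank s W l \<le> r"
proof -
  have "1 \<le> i" "i \<le> s" using partial_word_onD[OF W l] by auto
  then obtain r where r: "r < s" "journey s W r l = i" using journey_at[OF W, of l i] l(1) by auto
  then have p: "passes s W r l" using l(2) by (auto simp: passes_def)
  show "passes s W (first_rank s W l) l" unfolding first_rank_def using p by (rule LeastI)
  show le: "\<And>r. passes s W r l \<Longrightarrow> first_rank s W l \<le> r" unfolding first_rank_def by (rule Least_le)
  show "first_rank s W l < s" using le[OF p] r(1) by simp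
qed

lemma first_time_less:
  assumes "l < length W" "l' < length W"
  shows "first_time s W l < first_time s W l' \<longleftrightarrow>
     first_rank s W l < first_rank s W l' \<or> (first_rank s W l = first_rank s W l' \<and> l < l')"
proof -
  have *: "first_time s W l < first_time s W l'" if "first_rank s W l < first_rank s W l'" "l < length W" for l l'
  proof -
    have "first_time s W l < Suc (first_rank s W l) * length W" using that(2) by (simp add: first_time_def)
    also have "\<dots> \<le> first_rank s W l' * length W" using that(1) by (intro mult_le_mono1) simp
    finally show ?thesis by (simp add: first_time_def)
  qed
  consider "first_rank s W l < first_rank s W l'" | "first_rank s W l = first_rank s W l'" | "first_rank s W l' < first_rank s W l" by linarith
  then show ?thesis
  proof cases
    case 1 then show ?thesis using *[OF 1 assms(1)] by simp
  next
    case 2 then show ?thesis by (simp add: first_time_def)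
  next
    case 3 then show ?thesis using *[OF 3 assms(2)] by simp
  qed
qed

lemma first_time_inj:
  assumes "l < length W" "l' < length W" "first_time s W l = first_time s W l'"
  shows "l = l'"
  using first_time_less[OF assms(1,2), of s] first_time_less[OF assms(2,1), of s] assms(3) by auto

text \<open>Suppose that the first crossing of index \<open>i\<close> is met from the right. Up to then
no strand of the journey has changed between the positions up to \<open>i\<close> and those beyond. What
has been travelled of the current component lies beyond \<open>i\<close>, and by the choice of base
points all positions up to \<open>i\<close> have been visited before. Their strands fill the positions up
to \<open>i\<close> on the level of the crossing, so one of them takes part in the crossing, which was
thus met before.\<close>

lemma first_crossing_from_left:
  assumes W: "partial_word_on s W" and l: "l < length W" "W ! l = Some (i, \<epsilon>)"
    and first: "\<And>l' \<epsilon>'. l' < length W \<Longrightarrow> W ! l' = Some (i, \<epsilon>') \<Longrightarrow> first_time s W l \<le> first_time s W l'"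
  shows "from_left s W l"
proof (rule ccontr)
  assume nl: "\<not> from_left s W l"
  define R where "R = first_rank s W l"
  note fr = first_rank[OF W l, folded R_def]
  have i: "1 \<le> i" "i < s" using partial_word_onD[OF W l] by auto
  have XR: "journey s W R l = i + 1" using fr(1) nl l(2) by (auto simp: passes_def from_left_def R_def)
  have no_pass: "\<not> passes s W r l'" if l': "l' < length W" "W ! l' = Some (i, \<epsilon>')" and r: "r < R \<or> (r = R \<and> l' < l)" for r l' \<epsilon>'
  proof
    assume "passes s W r l'"
    then have "first_rank s W l' \<le> r" using first_rank(3)[OF W l'] by simp
    then have "first_time s W l' < first_time s W l"
      unfolding first_time_less[OF l'(1) l(1)] R_def[symmetric] using r by auto
    then show False using first[OF l'] by simp
  qed
  have side: "journey s W r k \<le> i \<longleftrightarrow> base_point s W r \<le> i" if "k \<le> length W" "r < R \<or> (r = R \<and> k \<le> l)" for r k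
    using that
  proof (induction k)
    case 0
    then show ?case by (simp add: journey_def)
  next
    case (Suc k)
    have np: "\<not> passes s W r k" if "W ! k = Some (i, \<epsilon>')" for \<epsilon>'
      using no_pass[OF _ that, of r] Suc.prems by auto
    have "journey s W r (Suc k) \<le> i \<longleftrightarrow> journey s W r k \<le> i"
    proof (cases "W ! k")
      case None
      then show ?thesis by (simp add: journey_Suc strand_step_def)
    next
      case (Some a)
      obtain i' \<epsilon>' where a: "a = (i', \<epsilon>')" by (cases a)
      show ?thesis
      proof (cases "i' = i")
        case True
        then have "journey s W r k \<noteq> i" "journey s W r k \<noteq> i + 1" using np[of \<epsilon>'] Some a by (auto simp: passes_def)
        then show ?thesis using Some a True by (simp add: journey_Suc strand_step_def)
      next
        case False
        then show ?thesis using Some a by (auto simp: journey_Suc strand_step_def)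
      qed
    qed
    then show ?case using Suc by auto
  qed
  have exhausted: "{1..i} \<subseteq> base_point s W ` {..<r}" if "r \<le> R" "base_point s W r > i" for r
    using that
  proof (induction r)
    case 0
    then show ?case using i by (simp add: base_point_0)
  next
    case (Suc r)
    show ?case
    proof (cases "journey s W r (length W) \<in> base_point s W ` {..r}")
      case False
      then have "journey s W r (length W) > i" using Suc.prems by (simp add: base_point_Suc)
      then have "base_point s W r > i" using side[of "length W" r] Suc.prems by simp
      then have "{1..i} \<subseteq> base_point s W ` {..<r}" using Suc by simp
      then show ?thesis by (auto simp: lessThan_Suc)
    next
      case True
      then have M: "Min ({1..s} - base_point s W ` {..r}) > i" using Suc.prems by (simp add: base_point_Suc)
      show ?thesis
      proof
        fix y assume y: "y \<in> {1..i}"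
        show "y \<in> base_point s W ` {..<Suc r}"
        proof (rule ccontr)
          assume "y \<notin> base_point s W ` {..<Suc r}"
          then have "y \<in> {1..s} - base_point s W ` {..r}" using y i by (auto simp: lessThan_Suc_atMost)
          then have "Min ({1..s} - base_point s W ` {..r}) \<le> y" by (intro Min_le) auto
          then show False using M y by simp
        qed
      qed
    qed
  qed
  have "base_point s W R > i" using side[of l R] l(1) XR by simp
  then have ex: "{1..i} \<subseteq> base_point s W ` {..<R}" using exhausted[of R] by simp
  have "(\<lambda>y. strand_pos W y l) ` {1..i} \<subseteq> {1..i}"
  proof
    fix z assume "z \<in> (\<lambda>y. strand_pos W y l) ` {1..i}"
    then obtain y where y: "y \<in> {1..i}" "z = strand_pos W y l" by blast
    then obtain r where r: "r < R" "y = base_point s W r" using ex by blast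
    have "z \<le> i" using side[of l r] r y l(1) by (simp add: journey_def)
    moreover have "1 \<le> z" using strand_pos_range[OF W, of l y] y i l(1) by simp
    ultimately show "z \<in> {1..i}" by simp
  qed
  then have "(\<lambda>y. strand_pos W y l) ` {1..i} = {1..i}"
    using strand_pos_inj by (intro endo_inj_surj inj_onI) auto
  then obtain y where y: "y \<in> {1..i}" "strand_pos W y l = i" using i by (metis (mono_tags, lifting) atLeastAtMost_iff imageE le_refl)
  then obtain r where r: "r < R" "y = base_point s W r" using ex by blast
  then have "passes s W r l" using y l(2) by (simp add: passes_def journey_def)
  then show False using fr(3) r(1) by fastforce
qed

section \<open>Changing and smoothing a crossing\<close>

lemma strand_step_sign: "strand_step (Some (i, \<epsilon>)) = strand_step (Some (i, \<epsilon>'))"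
  by (simp add: strand_step_def fun_eq_iff)

lemma journey_change:
  assumes "W ! l = Some (i, \<epsilon>)"
  shows "journey s (W[l := Some (i, \<epsilon>')]) = journey s W"
proof -
  define U where "U = W[l := Some (i, \<epsilon>')]"
  have step: "strand_step (U ! k) = strand_step (W ! k)" for k
    using assms strand_step_sign[of i \<epsilon> \<epsilon>']
    by (cases "l < length W"; cases "k = l") (simp_all add: U_def list_update_beyond)
  have pos: "strand_pos U j k = strand_pos W j k" for j k by (induction k) (simp_all add: step)
  have len: "length U = length W" by (simp add: U_def)
  have "visited s U r = visited s W r" for r by (induction r) (simp_all add: Let_def pos len)
  then show ?thesis by (simp add: U_def[symmetric] fun_eq_iff journey_def base_point_def pos)
qed

text \<open>The strands before the one that meets the crossing first do not pass through it, hence the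
order of the journey is the same up to there.\<close>

lemma journey_smooth:
  assumes W: "partial_word_on s W" and l: "l < length W" "W ! l = Some (i, \<epsilon>)"
  shows "r < first_rank s W l \<Longrightarrow> k \<le> length W \<Longrightarrow> journey s (W[l := None]) r k = journey s W r k"
    and "k \<le> l \<Longrightarrow> journey s (W[l := None]) (first_rank s W l) k = journey s W (first_rank s W l) k"
proof -
  define U where "U = W[l := None]"
  define R where "R = first_rank s W l"
  have U: "length U = length W" "U ! l = None" "\<And>k. k \<noteq> l \<Longrightarrow> U ! k = W ! k" using l by (simp_all add: U_def)
  have below: "strand_pos U j k = strand_pos W j k" if "k \<le> l" for j k
    using that by (induction k) (simp_all add: U(3))
  have above: "strand_pos U (base_point s W r) k = strand_pos W (base_point s W r) k" if r: "r < R" for r k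
  proof (induction k)
    case (Suc k)
    show ?case
    proof (cases "k = l")
      case True
      have "\<not> passes s W r l" using first_rank(3)[OF W l, of r] r by (auto simp: R_def)
      then have "strand_pos W (base_point s W r) l \<noteq> i" "strand_pos W (base_point s W r) l \<noteq> i + 1" using l by (auto simp: passes_def journey_def)
      then show ?thesis using True Suc U(2) l by (simp add: strand_step_def)
    next
      case False
      then show ?thesis using Suc U(3) by simp
    qed
  qed simp
  have b: "base_point s U r = base_point s W r \<and> base_point s U ` {..r} = base_point s W ` {..r}" if "r \<le> R" for r
    using that
  proof (induction r)
    case 0
    then show ?case by (simp add: base_point_0)
  next
    case (Suc r)
    then have IH: "base_point s U r = base_point s W r" "base_point s U ` {..r} = base_point s W ` {..r}" by simp_all
    have "journey s U r (length U) = journey s W r (length W)"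
      unfolding journey_def IH(1) U(1) using above[of r] Suc.prems by simp
    then have "base_point s U (Suc r) = base_point s W (Suc r)" unfolding base_point_Suc IH(2) by simp
    then show ?case using IH(2) by (simp add: atMost_Suc)
  qed
  show "r < first_rank s W l \<Longrightarrow> k \<le> length W \<Longrightarrow> journey s (W[l := None]) r k = journey s W r k"
    using b[of r] above[of r k] unfolding journey_def U_def[symmetric] R_def[symmetric] by simp
  show "k \<le> l \<Longrightarrow> journey s (W[l := None]) (first_rank s W l) k = journey s W (first_rank s W l) k"
    using b[of R] below[of k] unfolding journey_def U_def[symmetric] R_def[symmetric] by simp
qed

text \<open>Both journeys agree up to the time when the smoothed crossing was met, so they have the same
first visits up to this time.\<close>

lemma first_visit_smooth:
  assumes W: "partial_word_on s W" and l: "l < length W" "W ! l = Some (i, \<epsilon>)"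
    and m: "m < length W" "m \<noteq> l" "W ! m = Some (i', \<epsilon>')"
  shows "first_time s W m < first_time s W l \<Longrightarrow>
      first_time s (W[l := None]) m = first_time s W m \<and> from_left s (W[l := None]) m = from_left s W m"
    and "first_time s W l < first_time s W m \<Longrightarrow> first_time s W l < first_time s (W[l := None]) m"
proof -
  define U where "U = W[l := None]"
  define R where "R = first_rank s W l"
  have U: "length U = length W" "U ! m = W ! m" using l m by (simp_all add: U_def)
  have UW: "partial_word_on s U"
    using W set_update_subset_insert[of W l None] by (auto simp: U_def partial_word_on_def)
  have mU: "m < length U" "U ! m = Some (i', \<epsilon>')" using m U by simp_all
  have same: "journey s U r m = journey s W r m" if "r < R \<or> (r = R \<and> m < l)" for r
    using journey_smooth(1)[OF W l, of r m] journey_smooth(2)[OF W l, of m] that m unfolding U_def R_def by auto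
  have passes: "passes s U r m \<longleftrightarrow> passes s W r m" if "r < R \<or> (r = R \<and> m < l)" for r
    using same[OF that] U by (simp add: passes_def)
  show "first_time s (W[l := None]) m = first_time s W m \<and> from_left s (W[l := None]) m = from_left s W m"
    if "first_time s W m < first_time s W l"
  proof -
    have lt: "first_rank s W m < R \<or> (first_rank s W m = R \<and> m < l)"
      using that unfolding first_time_less[OF m(1) l(1)] R_def .
    have "first_rank s U m = first_rank s W m"
      unfolding first_rank_def[of s U]
    proof (rule Least_equality)
      show "passes s U (first_rank s W m) m" using passes[OF lt] first_rank(1)[OF W m(1,3)] by simp
      fix r assume r: "passes s U r m"
      show "first_rank s W m \<le> r"
      proof (rule ccontr)
        assume "\<not> first_rank s W m \<le> r"
        then have "passes s W r m" using r passes[of r] lt by auto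
        then show False using first_rank(3)[OF W m(1,3)] \<open>\<not> first_rank s W m \<le> r\<close> by simp
      qed
    qed
    then show ?thesis using same[OF lt] U by (simp add: first_time_def from_left_def U_def[symmetric])
  qed
  show "first_time s W l < first_time s (W[l := None]) m" if "first_time s W l < first_time s W m"
  proof (rule ccontr)
    assume neg: "\<not> first_time s W l < first_time s (W[l := None]) m"
    have le: "first_rank s U m * length W + m \<le> R * length W + l"
      using neg U by (simp add: first_time_def U_def R_def)
    have lt: "first_rank s U m < R \<or> (first_rank s U m = R \<and> m < l)"
    proof (cases "first_rank s U m < R")
      case False
      then have "R * length W \<le> first_rank s U m * length W" by simp
      moreover have "first_rank s U m = R"
      proof (rule ccontr)
        assume "first_rank s U m \<noteq> R"
        then have "Suc R * length W \<le> first_rank s U m * length W" using False by (intro mult_le_mono1) simp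
        then show False using le l(1) by simp
      qed
      ultimately show ?thesis using le m(2) by simp
    qed simp
    have "passes s W (first_rank s U m) m" using first_rank(1)[OF UW mU] passes[OF lt] by simp
    then have "first_rank s W m \<le> first_rank s U m" using first_rank(3)[OF W m(1,3)] by simp
    then have "first_time s W m < first_time s W l"
      unfolding first_time_less[OF m(1) l(1)] R_def[symmetric] using lt by auto
    then show False using that by simp
  qed
qed

section \<open>Leaves of the skein tree\<close>

lemma block_enumeration:
  fixes start :: "nat \<Rightarrow> bool"
  assumes "start 0"
  shows "s \<ge> 1 \<Longrightarrow> \<exists>R A. R \<ge> 1 \<and> A 0 = 0 \<and> A R = s \<and> (\<forall>k<R. A k < A (Suc k)) \<and>
    (\<forall>k<R. start (A k) \<and> (\<forall>r. A k < r \<and> r < A (Suc k) \<longrightarrow> \<not> start r))"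
proof (induction s rule: nat_induct_at_least)
  case base
  show ?case
    by (rule exI[of _ 1], rule exI[of _ "\<lambda>k. k"]) (use assms in auto)
next
  case (Suc s)
  then obtain R A where A: "R \<ge> 1" "A 0 = 0" "A R = s" "\<And>k. k < R \<Longrightarrow> A k < A (Suc k)"
    "\<And>k. k < R \<Longrightarrow> start (A k)" "\<And>k r. k < R \<Longrightarrow> A k < r \<Longrightarrow> r < A (Suc k) \<Longrightarrow> \<not> start r" by blast
  show ?case
  proof (cases "start s")
    case True
    show ?thesis
      by (rule exI[of _ "Suc R"], rule exI[of _ "A(Suc R := Suc s)"])
        (use A True in \<open>auto simp: less_Suc_eq\<close>)
  next
    case False
    obtain Q where Q: "R = Suc Q" using A(1) by (cases R) auto
    have "A Q < s" using A(4)[of Q] A(3) Q by simp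
    then show ?thesis
      by (intro exI[of _ R] exI[of _ "A(R := Suc s)"])
        (use A False Q in \<open>auto simp: less_Suc_eq\<close>)
  qed
qed

definition component_start :: "nat \<Rightarrow> partial_word \<Rightarrow> nat \<Rightarrow> bool" where
  "component_start s W r \<longleftrightarrow> (case r of 0 \<Rightarrow> True | Suc q \<Rightarrow> journey s W q (length W) \<in> base_point s W ` {..q})"

text \<open>The strands of complete components are mapped among themselves by the permutation of the
braid. So the last strand of a component can only be continued by a strand of this component, and all of
these but the first one have a predecessor already.\<close>

lemma component_closes:
  assumes W: "partial_word_on s W" and q: "component_start s W q" "q \<le> r" "r < s"
    and no: "\<And>p. q < p \<Longrightarrow> p \<le> r \<Longrightarrow> \<not> component_start s W p"
    and stop: "Suc r = s \<or> component_start s W (Suc r)"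
  shows "journey s W r (length W) = base_point s W q"
proof -
  define n where "n = length W"
  have binj: "p = p'" if "base_point s W p = base_point s W p'" "p < s" "p' < s" for p p'
    using bij_betw_imp_inj_on[OF base_point_bij[OF W]] that by (auto dest: inj_onD)
  have tinj: "p = p'" if "journey s W p n = journey s W p' n" "p < s" "p' < s" for p p'
    using journey_inj[OF W le_refl that(2,3)] that(1) by (simp add: n_def)
  have closed: "journey s W p n \<in> base_point s W ` {..<m}" if m: "m = s \<or> component_start s W m" "m \<le> s" "p < m" for p m
  proof (cases "m = s")
    case True
    have "journey s W p n \<in> {1..s}" using journey_range[OF W, of n p] that by (simp add: n_def)
    then show ?thesis using bij_betw_imp_surj_on[OF base_point_bij[OF W]] True by simp
  next
    case False
    show ?thesis
    proof (cases "Suc p = m")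
      case True
      then have "journey s W p n \<in> base_point s W ` {..p}" using m False by (auto simp: component_start_def n_def)
      then show ?thesis using True by (auto simp: lessThan_Suc_atMost[symmetric])
    next
      case F: False
      then have lt: "Suc p < m" using m by simp
      show ?thesis
      proof (cases "journey s W p n \<in> base_point s W ` {..p}")
        case True
        then show ?thesis using lt by auto
      next
        case notin: False
        then have "base_point s W (Suc p) = journey s W p n" by (simp add: base_point_Suc n_def)
        then show ?thesis using lt by (metis image_eqI lessThan_iff)
      qed
    qed
  qed
  have "journey s W r n \<in> base_point s W ` {..<Suc r}"
    using closed[of "Suc r" r] stop q(3) by auto
  then obtain p where p: "p < Suc r" "journey s W r n = base_point s W p" by auto
  have "\<not> p < q"
  proof
    assume pq: "p < q"
    have "inj_on (\<lambda>p. journey s W p n) {..<q}" using tinj q by (intro inj_onI) auto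
    moreover have "(\<lambda>p. journey s W p n) ` {..<q} \<subseteq> base_point s W ` {..<q}" using closed[of q] q by auto
    moreover have "card (base_point s W ` {..<q}) \<le> q" using card_image_le[of "{..<q}" "base_point s W"] by simp
    ultimately have "(\<lambda>p. journey s W p n) ` {..<q} = base_point s W ` {..<q}"
      by (intro card_seteq) (auto simp: card_image)
    then have "base_point s W p \<in> (\<lambda>p. journey s W p n) ` {..<q}" using pq by simp
    then obtain p2 where "p2 < q" "base_point s W p = journey s W p2 n" by auto
    then show False using tinj[of p2 r] p q by simp
  qed
  moreover have "\<not> q < p"
  proof
    assume qp: "q < p"
    then obtain m where m: "p = Suc m" by (cases p) auto
    have "\<not> component_start s W (Suc m)" using no[of p] qp p m by simp
    then have "base_point s W p = journey s W m n" by (simp add: component_start_def base_point_Suc n_def m)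
    then have "m = r" using tinj[of m r] p q m by simp
    then show False using p m by simp
  qed
  ultimately show ?thesis using p by (simp add: n_def)
qed

text \<open>On the journey each strand contributes its \<open>n\<close> levels and its five closing
edges. The last edge of a component is the last edge of a closing arc, and it has no crossing.\<close>

lemma good_diagram_unlink:
  assumes L: "oriented_link L" "has_diagram L (braid_diagram s W)" and W: "partial_word_on s W"
    and good: "\<And>l i \<epsilon>. l < length W \<Longrightarrow> W ! l = Some (i, \<epsilon>) \<Longrightarrow> good f s W l"
  shows "unlink L"
proof -
  define n where "n = length W"
  define c where "c = n + 5"
  have s1: "s \<ge> 1" using W by (simp add: partial_word_on_def)
  have cs0: "component_start s W 0" by (simp add: component_start_def)
  obtain R A where A: "R \<ge> 1" "A 0 = 0" "A R = s" "\<And>k. k < R \<Longrightarrow> A k < A (Suc k)"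
    "\<And>k. k < R \<Longrightarrow> component_start s W (A k)"
    "\<And>k r. k < R \<Longrightarrow> A k < r \<Longrightarrow> r < A (Suc k) \<Longrightarrow> \<not> component_start s W r"
    using block_enumeration[of "component_start s W", OF cs0 s1] by blast
  have A_mono: "A j \<le> A k" if "j \<le> k" "k \<le> R" for j k
    using that
  proof (induction k)
    case (Suc k)
    then show ?case using A(4)[of k] by (cases "j = Suc k") auto
  qed simp
  define v where "v N = (if N mod c \<le> n then grid (journey s W (N div c) (N mod c)) (N mod c)
    else closing_vertex s n (journey s W (N div c) n) (N mod c - n))" for N
  define nx where "nx N = (let k = (LEAST k. N < A (Suc k) * c) in if Suc N < A (Suc k) * c then Suc N else A k * c)" for N
  have c0: "c > 0" by (simp add: c_def)
  have nx: "nx N = (if Suc N < A (Suc k) * c then Suc N else A k * c)" if "k < R" "A k * c \<le> N" "N < A (Suc k) * c" for k N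
  proof -
    have "(LEAST k. N < A (Suc k) * c) = k"
    proof (rule Least_equality)
      fix j assume j: "N < A (Suc j) * c"
      show "k \<le> j"
      proof (rule ccontr)
        assume "\<not> k \<le> j"
        then have "A (Suc j) * c \<le> A k * c" using that by (intro mult_le_mono1 A_mono) auto
        then show False using j that by linarith
      qed
    qed (rule that)
    then show ?thesis by (simp add: nx_def)
  qed
  have block: "\<exists>k<R. A k \<le> r \<and> r < A (Suc k)" if "r < s" for r
    using block_exists[of A r R] A(2,3) that by simp
  have v_strand: "v (r * c + k) = grid (journey s W r k) k" if "k \<le> n" for r k
    using that by (simp add: v_def c_def)
  have v_closing: "v (r * c + (n + a)) = closing_vertex s n (journey s W r n) a" if "a < 5" for r a
    using that by (cases "a = 0") (simp_all add: v_def c_def closing_vertex_def Let_def)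
  have nx_inner: "nx (r * c + k) = r * c + Suc k" if r: "r < s" and k: "Suc k < c" for r k
  proof -
    obtain b where b: "b < R" "A b \<le> r" "r < A (Suc b)" using block[OF r] by blast
    have 1: "A b * c \<le> r * c" using b(2) by simp
    have 2: "Suc r * c \<le> A (Suc b) * c" using b(3) by (intro mult_le_mono1) simp
    have "A b * c \<le> r * c + k" using 1 by linarith
    moreover have "Suc (r * c + k) < A (Suc b) * c" using 2 k by simp
    ultimately show ?thesis using nx[OF b(1), of "r * c + k"] by simp
  qed
  have v_last: "v (nx (r * c + (n + 4))) = grid (journey s W r n) 0" if r: "r < s" for r
  proof -
    obtain b where b: "b < R" "A b \<le> r" "r < A (Suc b)" using block[OF r] by blast
    have 1: "A b * c \<le> r * c" using b(2) by simp
    have 2: "Suc r * c \<le> A (Suc b) * c" using b(3) by (intro mult_le_mono1) simp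
    have e: "Suc (r * c + (n + 4)) = Suc r * c" by (simp add: c_def)
    have nxe: "nx (r * c + (n + 4)) = (if Suc r * c < A (Suc b) * c then Suc r * c else A b * c)"
      using nx[OF b(1), of "r * c + (n + 4)"] 1 2 e by simp
    show ?thesis
    proof (cases "Suc r < A (Suc b)")
      case True
      then have "\<not> component_start s W (Suc r)" using A(6)[OF b(1), of "Suc r"] b(2) by simp
      then have "journey s W (Suc r) 0 = journey s W r n"
        by (simp add: component_start_def base_point_Suc n_def journey_def)
      moreover have "Suc r * c < A (Suc b) * c" using True c0 by (rule mult_less_mono1)
      then have "nx (r * c + (n + 4)) = Suc r * c + 0" unfolding nxe by simp
      ultimately show ?thesis using v_strand[of 0 "Suc r"] by simp
    next
      case False
      then have end': "Suc r = A (Suc b)" using b(3) by simp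
      have "Suc r = s \<or> component_start s W (Suc r)"
        using A(3) A(5)[of "Suc b"] b(1) end' by (cases "Suc b = R") auto
      then have "journey s W r n = base_point s W (A b)"
        unfolding n_def using A(5,6)[OF b(1)] b(2,3) r end' by (intro component_closes[OF W]) auto
      moreover have "nx (r * c + (n + 4)) = A b * c + 0" unfolding nxe end' by simp
      ultimately show ?thesis using v_strand[of 0 "A b"] by (simp add: journey_def)
    qed
  qed
  have strand: "(v (r * c + k), v (nx (r * c + k))) = strand_edge W k (journey s W r k)" if "r < s" "k < n" for r k
    using nx_inner[of r k] v_strand[of k r] v_strand[of "Suc k" r] that
    by (simp add: c_def strand_edge_def journey_Suc)
  have closing: "(v (r * c + (n + a)), v (nx (r * c + (n + a)))) =
      (closing_vertex s n (journey s W r n) a, closing_vertex s n (journey s W r n) (Suc a))" if r: "r < s" and a: "a < 5" for r a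
  proof (cases "a = 4")
    case True
    then show ?thesis using v_last[OF r] v_closing[of 4 r] by (simp add: closing_vertex_def Let_def)
  next
    case False
    then have "nx (r * c + (n + a)) = r * c + (n + Suc a)" using nx_inner[OF r, of "n + a"] a by (simp add: c_def)
    then show ?thesis using v_closing[of a r] v_closing[of "Suc a" r] a False by simp
  qed
  have split: "\<exists>r k. r < s \<and> k < c \<and> N = r * c + k" if "N < s * c" for N
    using that c0 by (intro exI[of _ "N div c"] exI[of _ "N mod c"]) (simp add: less_mult_imp_div_less)
  have split_case: thesis if N: "N < s * c" and a1: "\<And>r k. r < s \<Longrightarrow> k < n \<Longrightarrow> N = r * c + k \<Longrightarrow> thesis"
    and a2: "\<And>r a. r < s \<Longrightarrow> a < 5 \<Longrightarrow> N = r * c + (n + a) \<Longrightarrow> thesis" for N thesis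
  proof -
    obtain r k where rk: "r < s" "k < c" "N = r * c + k" using split[OF N] by blast
    show thesis
    proof (cases "k < n")
      case False
      then show thesis using a2[of r "k - n"] rk by (simp add: c_def)
    qed (use a1 rk in blast)
  qed
  have lt: "r * c + k < s * c" if "r < s" "k < c" for r k
  proof -
    have "r * c + k < Suc r * c" using that by simp
    also have "\<dots> \<le> s * c" using that by (intro mult_le_mono1) simp
    finally show ?thesis .
  qed
  have tr: "1 \<le> journey s W r k \<and> journey s W r k \<le> s" if "r < s" "k \<le> n" for r k
    using journey_range[OF W] that by (simp add: n_def)
  have ti: "r = r'" if "r < s" "r' < s" "k \<le> n" "journey s W r k = journey s W r' k" for r r' k
    using journey_inj[OF W] that by (simp add: n_def)
  have inj: "inj_on v {..<s * c}"
  proof (rule inj_onI)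
    fix N N' assume N: "N \<in> {..<s * c}" and N': "N' \<in> {..<s * c}" and eq: "v N = v N'"
    then have Nl: "N < s * c" "N' < s * c" by simp_all
    show "N = N'"
    proof (rule split_case[OF Nl(1)]; rule split_case[OF Nl(2)])
      fix r k r' k' assume a: "r < s" "k < n" "N = r * c + k" "r' < s" "k' < n" "N' = r' * c + k'"
      then have "k = k'" "journey s W r k = journey s W r' k'" using eq v_strand by auto
      then show ?thesis using ti[of r r' k] a by simp
    next
      fix r k r' a assume a: "r < s" "k < n" "N = r * c + k" "r' < s" "a < 5" "N' = r' * c + (n + a)"
      then show ?thesis
        using eq closing_vertex_not_start[of "journey s W r' n" s "journey s W r k" a k n] tr[of r k] tr[of r' n] v_strand[of k r] v_closing[of a r'] by simp
    next
      fix r a r' k assume a: "r < s" "a < 5" "N = r * c + (n + a)" "r' < s" "k < n" "N' = r' * c + k"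
      then show ?thesis
        using eq closing_vertex_not_start[of "journey s W r n" s "journey s W r' k" a k n] tr[of r' k] tr[of r n] v_strand[of k r'] v_closing[of a r] by simp
    next
      fix r a r' a' assume a: "r < s" "a < 5" "N = r * c + (n + a)" "r' < s" "a' < 5" "N' = r' * c + (n + a')"
      then have "closing_vertex s n (journey s W r n) a = closing_vertex s n (journey s W r' n) a'" using eq v_closing by simp
      then have "journey s W r n = journey s W r' n" "a = a'"
        using closing_vertex_inj[of "journey s W r n" s "journey s W r' n" a a' n] tr[of r n] tr[of r' n] a by auto
      then show ?thesis using ti[of r r' n] a by simp
    qed
  qed
  have Edg: "braid_edges s W = (\<lambda>N. (v N, v (nx N))) ` {..<s * c}"
  proof
    show "braid_edges s W \<subseteq> (\<lambda>N. (v N, v (nx N))) ` {..<s * c}"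
    proof
      fix e assume "e \<in> braid_edges s W"
      then show "e \<in> (\<lambda>N. (v N, v (nx N))) ` {..<s * c}"
      proof (rule braid_edges_cases)
        fix k j assume k: "k < length W" "1 \<le> j" "j \<le> s" "e = strand_edge W k j"
        obtain r where r: "r < s" "journey s W r k = j" using journey_at[OF W, of k j] k by auto
        have "e = (v (r * c + k), v (nx (r * c + k)))" using strand[OF r(1), of k] k r by (simp add: n_def)
        then show ?thesis using lt[of r k] r k by (intro image_eqI[of _ _ "r * c + k"]) (simp_all add: c_def n_def)
      next
        fix j a assume k: "1 \<le> j" "j \<le> s" "a < 5" "e = (closing_vertex s (length W) j a, closing_vertex s (length W) j (Suc a))"
        obtain r where r: "r < s" "journey s W r n = j" using journey_at[OF W, of n j] k by (auto simp: n_def)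
        have "e = (v (r * c + (n + a)), v (nx (r * c + (n + a))))" using closing[OF r(1), of a] k r by (simp add: n_def)
        then show ?thesis using lt[of r "n + a"] r k by (intro image_eqI[of _ _ "r * c + (n + a)"]) (simp_all add: c_def)
      qed
    qed
    show "(\<lambda>N. (v N, v (nx N))) ` {..<s * c} \<subseteq> braid_edges s W"
    proof
      fix e assume "e \<in> (\<lambda>N. (v N, v (nx N))) ` {..<s * c}"
      then obtain N where N: "N < s * c" "e = (v N, v (nx N))" by auto
      show "e \<in> braid_edges s W"
      proof (rule split_case[OF N(1)])
        fix r k assume a: "r < s" "k < n" "N = r * c + k"
        then have "e = strand_edge W k (journey s W r k)" using strand N(2) by simp
        then show ?thesis using tr[of r k] a unfolding braid_edges_def n_def by auto
      next
        fix r a assume a: "r < s" "a < 5" "N = r * c + (n + a)"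
        then have "e = (closing_vertex s n (journey s W r n) a, closing_vertex s n (journey s W r n) (Suc a))" using closing N(2) by simp
        then show ?thesis using tr[of r n] a unfolding braid_edges_def n_def by blast
      qed
    qed
  qed
  show ?thesis
  proof (rule descending_diagram_unlink[OF L(1) L(2)[unfolded braid_diagram_def] A(1), where A = "\<lambda>k. A k * c" and v = v and nx = nx and f = f])
    show "A 0 * c = 0" by (simp add: A(2))
    show "A k * c + 3 \<le> A (Suc k) * c" if "k < R" for k
    proof -
      have "Suc (A k) * c \<le> A (Suc k) * c" using A(4)[OF that] by (intro mult_le_mono1) simp
      then show ?thesis by (simp add: c_def)
    qed
    show "nx N = (if Suc N < A (Suc k) * c then Suc N else A k * c)" if "k < R" "A k * c \<le> N" "N < A (Suc k) * c" for k N
      using nx[OF that] .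
    show "inj_on v {..<A R * c}" "braid_edges s W = (\<lambda>N. (v N, v (nx N))) ` {..<A R * c}" using inj Edg A(3) by simp_all
    fix e e' assume "(e, e') \<in> braid_crossings W"
    then obtain l i \<epsilon> where l: "l < n" "W ! l = Some (i, \<epsilon>)"
      "(e, e') = (if \<epsilon> then (strand_edge W l i, strand_edge W l (i + 1)) else (strand_edge W l (i + 1), strand_edge W l i))"
      unfolding braid_crossings_def n_def by auto
    have lW: "l < length W" using l(1) by (simp add: n_def)
    have i: "1 \<le> i" "i + 1 \<le> s" using partial_word_onD[OF W lW l(2)] by auto
    obtain r1 where r1: "r1 < s" "journey s W r1 l = i" using journey_at[OF W, of l i] i lW by auto
    obtain r2 where r2: "r2 < s" "journey s W r2 l = i + 1" using journey_at[OF W, of l "i + 1"] i lW by auto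
    note fr = first_rank[OF W lW l(2)]
    have ps: "passes s W r1 l" "passes s W r2 l" using r1 r2 l(2) by (auto simp: passes_def)
    have fl: "from_left s W l \<longleftrightarrow> r1 < r2"
    proof
      assume "from_left s W l"
      then have "first_rank s W l = r1" using ti[of "first_rank s W l" r1 l] r1 fr(2) l by (simp add: from_left_def)
      then show "r1 < r2" using fr(3)[OF ps(2)] r1 r2 by (cases "r1 = r2") auto
    next
      assume lt: "r1 < r2"
      have "journey s W (first_rank s W l) l \<noteq> i + 1"
      proof
        assume "journey s W (first_rank s W l) l = i + 1"
        then have "first_rank s W l = r2" using ti[of "first_rank s W l" r2 l] r2 fr(2) l by simp
        then show False using fr(3)[OF ps(1)] lt by simp
      qed
      then show "from_left s W l" using fr(1) l(2) by (auto simp: passes_def from_left_def)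
    qed
    have gd: "r1 < r2 \<longleftrightarrow> \<epsilon> = f" using good[OF lW l(2)] l(2) by (simp add: good_def fl)
    have r12: "r1 \<noteq> r2" using r1 r2 by auto
    define N where "N r = r * c + l" for r
    have e: "(v (N r), v (nx (N r))) = strand_edge W l (journey s W r l)" "nx (N r) = Suc (N r)" "N r < A R * c" if "r < s" for r
      using strand[OF that l(1)] nx_inner[OF that, of l] l(1) lt[OF that, of l] A(3) by (simp_all add: N_def c_def)
    have less: "Suc (N r) < N r'" if "r < r'" for r r'
    proof -
      have "Suc r * c \<le> r' * c" using that by (intro mult_le_mono1) simp
      then show ?thesis by (simp add: N_def c_def)
    qed
    have E1: "strand_edge W l i = (v (N r1), v (Suc (N r1)))" using e(1,2)[OF r1(1)] r1(2) by simp
    have E2: "strand_edge W l (i + 1) = (v (N r2), v (Suc (N r2)))" using e(1,2)[OF r2(1)] r2(2) by simp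
    show "\<exists>N N'. Suc N < N' \<and> N' < A R * c \<and> nx N = Suc N \<and> nx N' = Suc N' \<and>
        (if f then (e, e') else (e', e)) = ((v N, v (Suc N)), (v N', v (Suc N')))"
    proof (cases "r1 < r2")
      case True
      then have "(if f then (e, e') else (e', e)) = ((v (N r1), v (Suc (N r1))), (v (N r2), v (Suc (N r2))))"
        using gd l(3) E1 E2 by (auto split: if_splits)
      then show ?thesis using less[OF True] e(2,3)[OF r1(1)] e(2,3)[OF r2(1)] by blast
    next
      case False
      then have lt: "r2 < r1" using r12 by simp
      have "(if f then (e, e') else (e', e)) = ((v (N r2), v (Suc (N r2))), (v (N r1), v (Suc (N r1))))"
        using gd False l(3) E1 E2 by (auto split: if_splits)
      then show ?thesis using less[OF lt] e(2,3)[OF r1(1)] e(2,3)[OF r2(1)] by blast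
    qed
  qed
qed

section \<open>The skein tree and its depth\<close>

text \<open>The letters of the sign for which a crossing met from the left is good.\<close>

definition favoured :: "bool \<Rightarrow> partial_word \<Rightarrow> nat set" where
  "favoured f W = {l. l < length W \<and> (\<exists>i. W ! l = Some (i, f))}"

definition pending :: "bool \<Rightarrow> nat \<Rightarrow> partial_word \<Rightarrow> nat \<Rightarrow> nat set" where
  "pending f s W t = {l. l < length W \<and> (\<exists>i. W ! l = Some (i, \<not> f)) \<and> t \<le> first_time s W l}"

definition indices :: "partial_word \<Rightarrow> nat set" where
  "indices W = {i. \<exists>l \<epsilon>. l < length W \<and> W ! l = Some (i, \<epsilon>)}"

lemma finite_sets: "finite (favoured f W)" "finite (pending f s W t)" "finite (indices W)"
proof -
  show "finite (favoured f W)" "finite (pending f s W t)"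
    by (rule finite_subset[of _ "{..<length W}"]; auto simp: favoured_def pending_def)+
  have "indices W \<subseteq> (\<lambda>l. fst (the (W ! l))) ` {..<length W}"
    by (force simp: indices_def)
  then show "finite (indices W)" by (rule finite_subset) simp
qed

lemma first_of_index:
  assumes W: "partial_word_on s W" and i: "i \<in> indices W"
  obtains l \<epsilon> where "l < length W" "W ! l = Some (i, \<epsilon>)" "from_left s W l"
proof -
  define S where "S = {l. l < length W \<and> (\<exists>\<epsilon>. W ! l = Some (i, \<epsilon>))}"
  have "S \<noteq> {}" using i by (auto simp: S_def indices_def)
  then obtain l where l: "l \<in> S" "\<And>l'. l' \<in> S \<Longrightarrow> first_time s W l \<le> first_time s W l'"
    using ex_has_least_nat[of "\<lambda>l. l \<in> S" _ "first_time s W"] by blast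
  then obtain \<epsilon> where e: "l < length W" "W ! l = Some (i, \<epsilon>)" by (auto simp: S_def)
  have "from_left s W l"
    by (rule first_crossing_from_left[OF W e]) (use l(2) in \<open>auto simp: S_def\<close>)
  then show thesis using that e by blast
qed

text \<open>At a leaf the first crossing of each index is met from the left and is good, so it has the
favoured sign.\<close>

lemma card_indices_le_favoured:
  assumes W: "partial_word_on s W" and good: "\<And>l i \<epsilon>. l < length W \<Longrightarrow> W ! l = Some (i, \<epsilon>) \<Longrightarrow> good f s W l"
  shows "card (indices W) \<le> card (favoured f W)"
proof -
  have "indices W \<subseteq> (\<lambda>l. fst (the (W ! l))) ` favoured f W"
  proof
    fix i assume "i \<in> indices W"
    then obtain l \<epsilon> where l: "l < length W" "W ! l = Some (i, \<epsilon>)" "from_left s W l"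
      using first_of_index[OF W] by blast
    then have "\<epsilon> = f" using good[OF l(1,2)] by (simp add: good_def)
    then have "l \<in> favoured f W" using l by (auto simp: favoured_def)
    then show "i \<in> (\<lambda>l. fst (the (W ! l))) ` favoured f W" using l(2) by force
  qed
  then show ?thesis using finite_sets(1) by (meson card_image_le card_mono finite_imageI le_trans)
qed

text \<open>The crossings met before the time \<open>t\<close> are good already. The first bad crossing
\<open>l\<close> is resolved. If it has the favoured sign, either resolution takes it out of
\<open>favoured\<close>; as it is not met from the left, it is not the first crossing of its index, and
so its index survives the smoothing. If it has the other sign, it counts twice in the bound; the crossing
change returns one of this to \<open>favoured\<close>, and the smoothing may lose an index.\<close>

lemma skein_tree_exists:
  assumes "partial_word_on s W" and "oriented_link L" "has_diagram L (braid_diagram s W)"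
    and "\<And>l i \<epsilon>. l < length W \<Longrightarrow> W ! l = Some (i, \<epsilon>) \<Longrightarrow> first_time s W l < t \<Longrightarrow> good f s W l"
  shows "\<exists>T. valid_skein_tree T \<and> root_link T = L \<and>
    depth T + card (indices W) \<le> card (favoured f W) + 2 * card (pending f s W t)"
  using assms
proof (induction "card {l. l < length W \<and> W ! l \<noteq> None \<and> t \<le> first_time s W l}" arbitrary: W L t rule: less_induct)
  case less
  note W = less.prems(1)
  define todo where "todo W t = {l. l < length W \<and> W ! l \<noteq> None \<and> t \<le> first_time s W l}" for W t
  have fin_todo: "finite (todo W t)" for W t by (rule finite_subset[of _ "{..<length W}"]) (auto simp: todo_def)
  show ?case
  proof (cases "\<forall>l i \<epsilon>. l < length W \<longrightarrow> W ! l = Some (i, \<epsilon>) \<longrightarrow> good f s W l")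
    case True
    then have "unlink L" using good_diagram_unlink[OF less.prems(2,3) W] by blast
    moreover have "card (indices W) \<le> card (favoured f W)" using card_indices_le_favoured[OF W] True by blast
    ultimately show ?thesis by (intro exI[of _ "Leaf L"]) simp
  next
    case False
    define bad where "bad = {l. l < length W \<and> W ! l \<noteq> None \<and> \<not> good f s W l}"
    have "bad \<noteq> {}" using False by (auto simp: bad_def)
    then obtain l where lb: "l \<in> bad" "\<And>l'. l' \<in> bad \<Longrightarrow> first_time s W l \<le> first_time s W l'"
      using ex_has_least_nat[of "\<lambda>l. l \<in> bad" _ "first_time s W"] by blast
    then obtain i \<epsilon> where l: "l < length W" "W ! l = Some (i, \<epsilon>)" and nb: "\<not> good f s W l" by (auto simp: bad_def)
    have tl: "t \<le> first_time s W l" using less.prems(4)[OF l] nb by (meson not_le)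
    define t' where "t' = Suc (first_time s W l)"
    have earlier: "good f s W m" if "m < length W" "W ! m = Some (i', \<epsilon>')" "first_time s W m < first_time s W l" for m i' \<epsilon>'
      using lb(2)[of m] that by (auto simp: bad_def)
    have ftn: "first_time s W m \<noteq> first_time s W l" if "m < length W" "m \<noteq> l" for m
      using first_time_inj[OF that(1) l(1)] that(2) by blast
    have il: "1 \<le> i" "i < s" using partial_word_onD[OF W l] by auto
    have upd: "partial_word_on s (W[l := y])" if "y = None \<or> (\<exists>\<delta>. y = Some (i, \<delta>))" for y
      using W il that set_update_subset_insert[of W l y] unfolding partial_word_on_def by blast

    define W1 where "W1 = W[l := Some (i, \<not> \<epsilon>)]"
    have W1: "partial_word_on s W1" "length W1 = length W" "W1 ! l = Some (i, \<not> \<epsilon>)" "\<And>m. m \<noteq> l \<Longrightarrow> W1 ! m = W ! m"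
      using upd l by (auto simp: W1_def)
    have tr1: "journey s W1 = journey s W" unfolding W1_def using journey_change l(2) by blast
    have ps1: "passes s W1 r m = passes s W r m" for r m
      using W1(3,4) l by (cases "m = l") (auto simp: passes_def tr1)
    have fr1: "first_rank s W1 m = first_rank s W m" for m by (simp add: first_rank_def ps1)
    have ft1: "first_time s W1 m = first_time s W m" for m by (simp add: first_time_def fr1 W1(2))
    have fl1: "from_left s W1 m = from_left s W m" for m
      using W1(3,4) l by (cases "m = l") (auto simp: from_left_def tr1 fr1)
    obtain L1 where L1: "oriented_link L1" "has_diagram L1 (braid_diagram s W1)" using braid_diagram_realised[OF W1(1)] by blast
    have good1: "good f s W1 m" if m: "m < length W1" "W1 ! m = Some (i', \<epsilon>')" "first_time s W1 m < t'" for m i' \<epsilon>'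
    proof (cases "m = l")
      case True
      then show ?thesis using nb W1(3) l by (auto simp: good_def fl1)
    next
      case False
      have mW: "m < length W" "W ! m = Some (i', \<epsilon>')" using m W1 False by simp_all
      have "first_time s W m < first_time s W l" using m(3) ftn[OF mW(1) False] by (simp add: ft1 t'_def less_Suc_eq)
      then have "good f s W m" using earlier[OF mW] by blast
      then show ?thesis using W1(4)[OF False] by (simp add: good_def fl1)
    qed
    have todo1: "card (todo W1 t') < card (todo W t)"
    proof (rule psubset_card_mono[OF fin_todo])
      have "todo W1 t' \<subseteq> todo W t - {l}"
      proof
        fix m assume m: "m \<in> todo W1 t'"
        then have ml: "m \<noteq> l" by (auto simp: todo_def ft1 t'_def)
        then show "m \<in> todo W t - {l}" using m W1(2) W1(4)[OF ml] tl by (auto simp: todo_def ft1 t'_def)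
      qed
      moreover have "l \<in> todo W t" using l tl by (simp add: todo_def)
      ultimately show "todo W1 t' \<subset> todo W t" by blast
    qed
    obtain T1 where T1: "valid_skein_tree T1" "root_link T1 = L1"
      "depth T1 + card (indices W1) \<le> card (favoured f W1) + 2 * card (pending f s W1 t')"
      using less.hyps[of W1 t' L1] todo1 W1(1) L1 good1 unfolding todo_def by blast

    define W0 where "W0 = W[l := None]"
    have W0: "partial_word_on s W0" "length W0 = length W" "W0 ! l = None" "\<And>m. m \<noteq> l \<Longrightarrow> W0 ! m = W ! m"
      using upd l by (auto simp: W0_def)
    have fv_less: "first_time s W0 m = first_time s W m \<and> from_left s W0 m = from_left s W m"
      if "m < length W" "m \<noteq> l" "W ! m = Some (i', \<epsilon>')" "first_time s W m < first_time s W l" for m i' \<epsilon>'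
      using first_visit_smooth(1)[OF W l that(1-3)] that(4) unfolding W0_def by blast
    have fv_greater: "first_time s W l < first_time s W0 m"
      if "m < length W" "m \<noteq> l" "W ! m = Some (i', \<epsilon>')" "first_time s W l < first_time s W m" for m i' \<epsilon>'
      using first_visit_smooth(2)[OF W l that(1-3)] that(4) unfolding W0_def by blast
    have late: "t' \<le> first_time s W m" if "m < length W" "m \<noteq> l" "W ! m = Some (i', \<epsilon>')" "t' \<le> first_time s W0 m" for m i' \<epsilon>'
    proof (rule ccontr)
      assume "\<not> t' \<le> first_time s W m"
      then have "first_time s W m < first_time s W l" using ftn[OF that(1,2)] by (simp add: t'_def less_Suc_eq)
      then show False using fv_less[OF that(1-3)] that(4) by (simp add: t'_def)
    qed
    obtain L0 where L0: "oriented_link L0" "has_diagram L0 (braid_diagram s W0)" using braid_diagram_realised[OF W0(1)] by blast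
    have good0: "good f s W0 m" if m: "m < length W0" "W0 ! m = Some (i', \<epsilon>')" "first_time s W0 m < t'" for m i' \<epsilon>'
    proof -
      have ml: "m \<noteq> l" using m W0(3) by auto
      have mW: "m < length W" "W ! m = Some (i', \<epsilon>')" using m W0 ml by simp_all
      have lt: "first_time s W m < first_time s W l"
        using fv_greater[OF mW(1) ml mW(2)] ftn[OF mW(1) ml] m(3) by (force simp: t'_def)
      then have "good f s W m" using earlier[OF mW] by blast
      then show ?thesis using W0(4)[OF ml] fv_less[OF mW(1) ml mW(2) lt] by (simp add: good_def)
    qed
    have todo0: "card (todo W0 t') < card (todo W t)"
    proof (rule psubset_card_mono[OF fin_todo])
      have "todo W0 t' \<subseteq> todo W t - {l}"
      proof
        fix m assume m: "m \<in> todo W0 t'"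
        then have ml: "m \<noteq> l" using W0(3) by (auto simp: todo_def)
        then obtain i' \<epsilon>' where mW: "m < length W" "W ! m = Some (i', \<epsilon>')" using m W0 by (auto simp: todo_def)
        have "t' \<le> first_time s W m" using late[OF mW(1) ml mW(2)] m by (simp add: todo_def)
        then show "m \<in> todo W t - {l}" using mW ml tl by (simp add: todo_def t'_def)
      qed
      moreover have "l \<in> todo W t" using l tl by (simp add: todo_def)
      ultimately show "todo W0 t' \<subset> todo W t" by blast
    qed
    obtain T0 where T0: "valid_skein_tree T0" "root_link T0 = L0"
      "depth T0 + card (indices W0) \<le> card (favoured f W0) + 2 * card (pending f s W0 t')"
      using less.hyps[of W0 t' L0] todo0 W0(1) L0 good0 unfolding todo_def by blast

    have Wself: "W[l := Some (i, \<epsilon>)] = W" using l by (metis list_update_id)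
    have triple: "skein_triple (braid_diagram s (W[l := Some (i, True)])) (braid_diagram s (W[l := Some (i, False)])) (braid_diagram s W0)"
      unfolding W0_def by (rule skein_triple_braid[OF W l(1) il])
    have skein: "skein_links L L1 L0 \<or> skein_links L1 L L0"
    proof (cases \<epsilon>)
      case True
      then have "skein_triple (braid_diagram s W) (braid_diagram s W1) (braid_diagram s W0)"
        using triple Wself by (simp add: W1_def)
      then show ?thesis unfolding skein_links_def using less.prems(3) L1 L0 by blast
    next
      case False
      then have "skein_triple (braid_diagram s W1) (braid_diagram s W) (braid_diagram s W0)"
        using triple Wself by (simp add: W1_def)
      then show ?thesis unfolding skein_links_def using less.prems(3) L1 L0 by blast
    qed
    have valid: "valid_skein_tree (Node L T1 T0)" using T0 T1 skein less.prems(2) by simp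

    have idx1: "indices W1 = indices W"
    proof
      show "indices W1 \<subseteq> indices W"
      proof
        fix j assume "j \<in> indices W1"
        then obtain m \<delta> where m: "m < length W" "W1 ! m = Some (j, \<delta>)" by (auto simp: indices_def W1(2))
        then show "j \<in> indices W" using W1(3,4) l by (cases "m = l") (auto simp: indices_def)
      qed
      show "indices W \<subseteq> indices W1"
      proof
        fix j assume "j \<in> indices W"
        then obtain m \<delta> where m: "m < length W" "W ! m = Some (j, \<delta>)" by (auto simp: indices_def)
        then have "\<exists>\<delta>. W1 ! m = Some (j, \<delta>)" using W1(3,4) l by (cases "m = l") auto
        then show "j \<in> indices W1" using m W1(2) by (auto simp: indices_def)
      qed
    qed
    have idx0: "indices W \<subseteq> insert i (indices W0)"
    proof
      fix j assume "j \<in> indices W"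
      then obtain m \<delta> where m: "m < length W" "W ! m = Some (j, \<delta>)" by (auto simp: indices_def)
      show "j \<in> insert i (indices W0)"
      proof (cases "m = l")
        case False
        then have "W0 ! m = Some (j, \<delta>)" using m W0(4) by simp
        then show ?thesis using m W0(2) by (auto simp: indices_def)
      qed (use m l in auto)
    qed
    have pend1: "pending f s W1 t' \<subseteq> pending f s W t - {l}"
    proof
      fix m assume m: "m \<in> pending f s W1 t'"
      have "m \<noteq> l" using m by (auto simp: pending_def ft1 t'_def)
      then show "m \<in> pending f s W t - {l}" using m W1(2,4) tl by (auto simp: pending_def ft1 t'_def)
    qed
    have pend0: "pending f s W0 t' \<subseteq> pending f s W t - {l}"
    proof
      fix m assume m: "m \<in> pending f s W0 t'"
      have ml: "m \<noteq> l" using m W0(3) by (auto simp: pending_def)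
      then obtain i' where mW: "m < length W" "W ! m = Some (i', \<not> f)" using m W0 by (auto simp: pending_def)
      have "t' \<le> first_time s W m" using late[OF mW(1) ml mW(2)] m by (simp add: pending_def)
      then show "m \<in> pending f s W t - {l}" using mW ml tl by (simp add: pending_def t'_def)
    qed
    have fav0: "favoured f W0 = favoured f W - {l}"
      using W0 by (auto simp: favoured_def) (metis option.distinct(1))+
    have fin: "finite (pending f s W t)" "finite (favoured f W)" by (rule finite_sets)+
    show ?thesis
    proof (intro exI[of _ "Node L T1 T0"] conjI valid)
      show "root_link (Node L T1 T0) = L" by simp
      show "depth (Node L T1 T0) + card (indices W) \<le> card (favoured f W) + 2 * card (pending f s W t)"
      proof (cases "\<epsilon> = f")
        case True
        have lf: "l \<in> favoured f W" using l True by (auto simp: favoured_def)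
        have cf: "card (favoured f W) = Suc (card (favoured f W - {l}))" by (rule card_Suc_Diff1[OF fin(2) lf, symmetric])
        have f1: "favoured f W1 = favoured f W - {l}"
          using W1 True by (auto simp: favoured_def) (metis option.inject prod.inject)+
        have p1: "card (pending f s W1 t') \<le> card (pending f s W t)" using pend1 fin by (meson Diff_subset card_mono subset_trans)
        have p0: "card (pending f s W0 t') \<le> card (pending f s W t)" using pend0 fin by (meson Diff_subset card_mono subset_trans)
        have "\<not> from_left s W l" using nb True l by (simp add: good_def)
        moreover have "i \<in> indices W" using l by (auto simp: indices_def)
        then obtain m \<delta> where m: "m < length W" "W ! m = Some (i, \<delta>)" "from_left s W m" using first_of_index[OF W] by blast
        ultimately have "m \<noteq> l" by auto
        then have "W0 ! m = Some (i, \<delta>)" using m W0(4) by simp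
        then have "i \<in> indices W0" using m W0(2) by (auto simp: indices_def)
        then have "card (indices W) \<le> card (indices W0)" using idx0 finite_sets(3) by (metis card_mono insert_absorb)
        then show ?thesis using T1(3) T0(3) cf f1 fav0 p1 p0 idx1 by simp
      next
        case False
        then have \<epsilon>: "\<epsilon> = (\<not> f)" by blast
        have lp: "l \<in> pending f s W t" using l tl \<epsilon> by (auto simp: pending_def)
        have cp: "card (pending f s W t) = Suc (card (pending f s W t - {l}))" by (rule card_Suc_Diff1[OF fin(1) lp, symmetric])
        have p1: "card (pending f s W1 t') \<le> card (pending f s W t - {l})" using pend1 fin by (intro card_mono) auto
        have p0: "card (pending f s W0 t') \<le> card (pending f s W t - {l})" using pend0 fin by (intro card_mono) auto
        have "favoured f W1 \<subseteq> insert l (favoured f W)" using W1 by (auto simp: favoured_def)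
        then have "card (favoured f W1) \<le> card (insert l (favoured f W))" using fin by (intro card_mono) auto
        also have "\<dots> \<le> Suc (card (favoured f W))" using fin by (simp add: card_insert_if)
        finally have f1: "card (favoured f W1) \<le> Suc (card (favoured f W))" .
        have f0: "card (favoured f W0) \<le> card (favoured f W)" unfolding fav0 using fin by (intro card_mono) auto
        have "card (indices W) \<le> card (insert i (indices W0))" using idx0 finite_sets(3) by (intro card_mono) auto
        also have "\<dots> \<le> Suc (card (indices W0))" using finite_sets(3) by (simp add: card_insert_if)
        finally show ?thesis using T1(3) T0(3) cp f1 f0 p1 p0 idx1 by simp
      qed
    qed
  qed
qed

lemma td_le_braid:
  assumes L: "oriented_link L" and rep: "(s, w) \<in> non_split_braid_reps L"
  shows "\<exists>d. td L \<le> enat d \<and> d + (s - 1) \<le> length w + min (pos_crossings w) (neg_crossings w)"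
proof -
  have w: "braid_word_on s w" "non_split s w" "has_diagram L (closed_braid_diagram s w)"
    using rep by (auto simp: non_split_braid_reps_def)
  define W where "W = map Some w"
  have W: "partial_word_on s W"
    using w(1) by (auto simp: braid_word_on_def partial_word_on_def W_def)
  have dia: "has_diagram L (braid_diagram s W)" using w(3) closed_braid_diagram_eq[OF w(1)] by (simp add: W_def)
  have idx: "s - 1 \<le> card (indices W)"
  proof -
    have "{1..<s} \<subseteq> indices W"
    proof
      fix i assume "i \<in> {1..<s}"
      then have "i \<in> fst ` set w" using w(2) by (simp add: non_split_def)
      then obtain \<epsilon> where "(i, \<epsilon>) \<in> set w" by force
      then obtain l where "l < length w" "w ! l = (i, \<epsilon>)" by (metis in_set_conv_nth)
      then show "i \<in> indices W" by (auto simp: indices_def W_def)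
    qed
    then have "card {1..<s} \<le> card (indices W)" using finite_sets(3) by (rule card_mono[rotated])
    then show ?thesis by simp
  qed
  have cnt: "card {l. l < length w \<and> snd (w ! l) = f} = length (filter (\<lambda>x. snd x = f) w)" for f
    by (simp add: length_filter_conv_card)
  have bound: "\<exists>T. valid_skein_tree T \<and> root_link T = L \<and>
      depth T + (s - 1) \<le> length (filter (\<lambda>x. snd x = f) w) + 2 * length (filter (\<lambda>x. snd x = (\<not> f)) w)" for f
  proof -
    obtain T where T: "valid_skein_tree T" "root_link T = L"
      "depth T + card (indices W) \<le> card (favoured f W) + 2 * card (pending f s W 0)"
      using skein_tree_exists[OF W L dia, of 0 f] by auto
    have "favoured f W = {l. l < length w \<and> snd (w ! l) = f}" "pending f s W 0 = {l. l < length w \<and> snd (w ! l) = (\<not> f)}"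
      by (auto simp: favoured_def pending_def W_def prod_eq_iff)
    then show ?thesis using T idx cnt by (intro exI[of _ T]) simp
  qed
  have td: "td L \<le> enat (depth T)" if "valid_skein_tree T" "root_link T = L" for T
    unfolding td_def using that by (intro INF_lower) simp
  have len: "pos_crossings w + neg_crossings w = length w"
    unfolding pos_crossings_def neg_crossings_def by (rule sum_length_filter_compl)
  have p: "length (filter (\<lambda>x. snd x = True) w) = pos_crossings w" "length (filter (\<lambda>x. snd x = False) w) = neg_crossings w"
    by (simp_all add: pos_crossings_def neg_crossings_def)
  obtain T where T: "valid_skein_tree T" "root_link T = L" "depth T + (s - 1) \<le> pos_crossings w + 2 * neg_crossings w"
    using bound[of True] p by auto
  obtain U where U: "valid_skein_tree U" "root_link U = L" "depth U + (s - 1) \<le> neg_crossings w + 2 * pos_crossings w"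
    using bound[of False] p by auto
  show ?thesis
  proof (cases "neg_crossings w \<le> pos_crossings w")
    case True
    then show ?thesis using td[OF T(1,2)] T(3) len by (intro exI[of _ "depth T"]) auto
  next
    case False
    then show ?thesis using td[OF U(1,2)] U(3) len by (intro exI[of _ "depth U"]) auto
  qed
qed

theorem theorem6p1:
  fixes L :: "(real \<Rightarrow> sphere_pt) set"
  assumes "oriented_link L"
    and "\<not> unlink L"
  shows "ereal_of_enat (td L) \<le>
    (INF (s, w)\<in>non_split_braid_reps L.
       ereal (real (length w) - real s + 1 + real (min (pos_crossings w) (neg_crossings w))))"
proof (rule INF_greatest, clarify)
  fix s w assume sw: "(s, w) \<in> non_split_braid_reps L"
  then have "s \<ge> 1" by (simp add: non_split_braid_reps_def braid_word_on_def)
  obtain d where d: "td L \<le> enat d" "d + (s - 1) \<le> length w + min (pos_crossings w) (neg_crossings w)"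
    using td_le_braid[OF assms(1) sw] by blast
  have "ereal_of_enat (td L) \<le> ereal_of_enat (enat d)" using d(1) unfolding ereal_of_enat_le_iff .
  also have "\<dots> = ereal (real d)" by simp
  also have "real d + (real s - 1) \<le> real (length w) + real (min (pos_crossings w) (neg_crossings w))"
    using d(2) \<open>s \<ge> 1\<close> by (metis of_nat_1 of_nat_add of_nat_diff of_nat_le_iff)
  then have "ereal (real d) \<le> ereal (real (length w) - real s + 1 + real (min (pos_crossings w) (neg_crossings w)))" by simp
  finally show "ereal_of_enat (td L) \<le> ereal (real (length w) - real s + 1 + real (min (pos_crossings w) (neg_crossings w)))" .
qed

end
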